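(* Let $f:X\to X$ be a transitive (one-sided) subshift of finite type, with the metric $d_\theta$ on $X$ computable (equivalently, $\theta\in(0,1)$ is a computable real number). If $\Phi\in C(X,\mathbb{R}^m)$ is computable, then the rotation set $\mathrm{Rot}(\Phi)\subset\mathbb{R}^m$ is a computable compact set.
   Context: Shifts. Let $\mathcal{A}=\{0,\dots,d-1\}$ and let $A$ be a $d\times d$ matrix with entries in $\{0,1\}$. $X=X_A$ is the set of sequences $x=(x_k)_{k\ge1}\in\mathcal{A}^{\mathbb{N}}$ with $A_{x_k,x_{k+1}}=1$ for all $k$, where every letter of $\mathcal{A}$ is assumed to occur in some sequence of $X$; $f(x)_k=x_{k+1}$ is the shift map, and $f:X\to X$ is called a subshift of finite type. The metric is $d_\theta(x,y)=\theta^{\min\{k:\,x_k\ne y_k\}}$ for $x\ne y$, $d_\theta(x,x)=0$. $f$ is transitive if for all non-empty open $U,V\subset X$ there is $n\in\mathbb{N}$ with $f^n(U)\cap V\neq\emptyset$ (equivalently, $A$ is irreducible). Rotation set. $\mathcal{M}$ is the set of $f$-invariant Borel probability measures on $X$. For $\Phi=(\Phi_1,\dots,\Phi_m)\in C(X,\mathbb{R}^m)$, $\mathrm{rv}(\mu)=(\int\Phi_1\,d\mu,\dots,\int\Phi_m\,d\mu)$ and $\mathrm{Rot}(\Phi)=\{\mathrm{rv}(\mu):\mu\in\mathcal{M}\}$, a compact convex set. Computability. An oracle for $x\in X$ is a function $\phi$ with $\phi(n)=x_n$ for all $n$. A real number $\alpha$ is computable if there is a Turing machine which on input $n$ outputs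 a rational $q$ with $|q-\alpha|<2^{-n}$. $\Phi:X\to\mathbb{R}^m$ is computable if there is an oracle Turing machine $\psi$ such that for every $x\in X$, every oracle $\phi$ for $x$ and every $n\in\mathbb{N}$, $\psi(\phi,n)\in\mathbb{Q}^m$ and $\|\psi(\phi,n)-\Phi(x)\|<2^{-n}$. A compact set $S\subset\mathbb{R}^m$ is computable if there is a Turing machine which on input $n$ outputs a finite list of pairs $(q_i,l_i)\in\mathbb{Q}^m\times\mathbb{Z}$ such that the Hausdorff distance between $\bigcup_i\overline{B}(q_i,2^{-l_i})$ and $S$ is less than $2^{-n}$. *)

theory Defs
  imports "HOL-Analysis.Analysis" "HOL-Probability.Probability_Measure" "HOL-Library.Nat_Bijection"
begin

section \<open>Turing machines with an oracle\<close>

text \<open>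
  Deterministic multitape machines with finitely many states and symbols. States and symbols are
  initial segments of the natural numbers. Every tape is infinite to the right only, and moving
  left in cell 0 leaves the head where it is. Symbol 0 is the blank, symbol 1 is written in cell 0
  of every tape at the start, and symbol 2 is the stroke of the unary notation. Tape 0 carries the
  input, tape 1 the output, and tape 2 is the query tape.
\<close>

datatype move = Left | Stay | Right

record tm =
  num_tapes :: nat
  num_states :: nat
  num_symbols :: nat
  start_state :: nat
  halt_state :: nat
  query_states :: "(nat \<times> nat) option"
    \<comment> \<open>the query state and the state entered once the oracle has answered;
       \<open>None\<close> for a machine without an oracle\<close>
  trans :: "nat \<Rightarrow> nat list \<Rightarrow> nat \<times> (nat \<times> move) list"

text \<open>
  The transition function matters only on states and symbols in range, hence on finitely many
  arguments.
\<close>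

definition oracle_TM :: "tm \<Rightarrow> bool" where
  "oracle_TM M \<longleftrightarrow>
     3 \<le> num_tapes M \<and> 3 \<le> num_symbols M \<and>
     start_state M < num_states M \<and> halt_state M < num_states M \<and>
     (\<forall>q r. query_states M = Some (q, r) \<longrightarrow> q < num_states M \<and> r < num_states M) \<and>
     (\<forall>q < num_states M. \<forall>as.
        length as = num_tapes M \<and> set as \<subseteq> {..<num_symbols M} \<longrightarrow>
        fst (trans M q as) < num_states M \<and>
        length (snd (trans M q as)) = num_tapes M \<and>
        fst ` set (snd (trans M q as)) \<subseteq> {..<num_symbols M})"

definition plain_TM :: "tm \<Rightarrow> bool" where
  "plain_TM M \<longleftrightarrow> oracle_TM M \<and> query_states M = None"

type_synonym tape = "nat \<times> (nat \<Rightarrow> nat)" \<comment> \<open>head position and contents\<close>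
type_synonym config = "nat \<times> tape list"

definition unary :: "nat \<Rightarrow> nat \<Rightarrow> nat" where
  "unary k = (\<lambda>i. if i = 0 then 1 else if i \<le> k then 2 else 0)"

definition unary_value :: "(nat \<Rightarrow> nat) \<Rightarrow> nat" where
  "unary_value t = (LEAST k. t (Suc k) \<noteq> 2)"

fun move_head :: "move \<Rightarrow> nat \<Rightarrow> nat" where
  "move_head Left h = h - 1"
| "move_head Stay h = h"
| "move_head Right h = Suc h"

definition act :: "nat \<times> move \<Rightarrow> tape \<Rightarrow> tape" where
  "act = (\<lambda>(s, mv) (h, t). (move_head mv h, t(h := s)))"

definition ordinary_step :: "tm \<Rightarrow> config \<Rightarrow> config" where
  "ordinary_step M = (\<lambda>(q, ts).
     let (q', as) = trans M q (map (\<lambda>(h, t). t h) ts) in (q', map2 act as ts))"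

text \<open>
  A query replaces the number on the query tape by the value of the oracle at that number and
  rewinds the head of that tape.
\<close>

definition step :: "tm \<Rightarrow> (nat \<Rightarrow> nat) \<Rightarrow> config \<Rightarrow> config" where
  "step M \<phi> = (\<lambda>(q, ts).
     if q = halt_state M then (q, ts)
     else case query_states M of
         None \<Rightarrow> ordinary_step M (q, ts)
       | Some (qq, qa) \<Rightarrow>
           if q = qq then (qa, ts[2 := (0, unary (\<phi> (unary_value (snd (ts ! 2)))))])
           else ordinary_step M (q, ts))"

definition initial_config :: "tm \<Rightarrow> nat \<Rightarrow> config" where
  "initial_config M n =
     (start_state M, (0, unary n) # replicate (num_tapes M - 1) (0, unary 0))"

definition outputs :: "tm \<Rightarrow> (nat \<Rightarrow> nat) \<Rightarrow> nat \<Rightarrow> nat \<Rightarrow> bool" where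
  "outputs M \<phi> n c \<longleftrightarrow>
     (\<exists>s q ts. (step M \<phi> ^^ s) (initial_config M n) = (q, ts) \<and> q = halt_state M \<and>
               c = unary_value (snd (ts ! 1)))"

text \<open>Without query states the oracle argument is irrelevant.\<close>

definition plain_outputs :: "tm \<Rightarrow> nat \<Rightarrow> nat \<Rightarrow> bool" where
  "plain_outputs M n c \<longleftrightarrow> outputs M (\<lambda>_. 0) n c"


section \<open>Computable reals, functions and compact sets\<close>

text \<open>
  Rationals, vectors and lists are output as their codes under the explicit pairings of the
  library. The coordinates of a vector are listed in the order given by
  \<^const>\<open>to_nat_on\<close>, a fixed bijection from the finite index type onto an initial segment
  of the natural numbers.
\<close>

definition codes_rat_vector :: "nat \<Rightarrow> real ^ 'm::finite \<Rightarrow> bool" where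
  "codes_rat_vector c v \<longleftrightarrow>
     length (list_decode c) = CARD('m) \<and>
     (\<forall>i. v $ i = of_rat (nat_to_rat_surj (list_decode c ! to_nat_on (UNIV :: 'm set) i)))"

definition codes_ball_list :: "nat \<Rightarrow> ((real ^ 'm::finite) \<times> int) list \<Rightarrow> bool" where
  "codes_ball_list c ps \<longleftrightarrow>
     list_all2 (\<lambda>a (q, l). codes_rat_vector (fst (prod_decode a)) q \<and>
                           l = int_decode (snd (prod_decode a)))
       (list_decode c) ps"

definition computable_real :: "real \<Rightarrow> bool" where
  "computable_real \<alpha> \<longleftrightarrow>
     (\<exists>M. plain_TM M \<and>
       (\<forall>n. \<exists>c. plain_outputs M n c \<and> \<bar>of_rat (nat_to_rat_surj c) - \<alpha>\<bar> < (1/2) ^ n))"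

text \<open>
  Sequences are indexed from 0 here: \<open>x k\<close> is the letter usually written with index \<open>k + 1\<close>.
\<close>

definition oracle_for :: "(nat \<Rightarrow> nat) \<Rightarrow> (nat \<Rightarrow> nat) \<Rightarrow> bool" where
  "oracle_for \<phi> x \<longleftrightarrow> (\<forall>n. \<phi> n = x n)"

definition computable_on :: "(nat \<Rightarrow> nat) set \<Rightarrow> ((nat \<Rightarrow> nat) \<Rightarrow> real ^ 'm::finite) \<Rightarrow> bool" where
  "computable_on X \<Phi> \<longleftrightarrow>
     (\<exists>\<psi>. oracle_TM \<psi> \<and>
       (\<forall>x\<in>X. \<forall>\<phi>. oracle_for \<phi> x \<longrightarrow>
         (\<forall>n. \<exists>c q. outputs \<psi> \<phi> n c \<and> codes_rat_vector c q \<and> norm (q - \<Phi> x) < (1/2) ^ n)))"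

text \<open>The Hausdorff distance is meant for nonempty bounded sets only.\<close>

definition hausdorff_dist :: "'a::metric_space set \<Rightarrow> 'a set \<Rightarrow> real" where
  "hausdorff_dist S T = max (SUP x\<in>S. infdist x T) (SUP y\<in>T. infdist y S)"

text \<open>The empty set is approximated by the empty list, and a nonempty set by nonempty lists.\<close>

definition computable_compact :: "(real ^ 'm::finite) set \<Rightarrow> bool" where
  "computable_compact S \<longleftrightarrow> compact S \<and>
     (\<exists>M. plain_TM M \<and>
       (\<forall>n. \<exists>c ps. plain_outputs M n c \<and> codes_ball_list c ps \<and>
          (ps = [] \<longleftrightarrow> S = {}) \<and>
          (S \<noteq> {} \<longrightarrow>
             hausdorff_dist (\<Union>(q, l)\<in>set ps. cball q (2 powi (- l))) S < (1/2) ^ n)))"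


section \<open>Subshifts of finite type and rotation sets\<close>

definition sft :: "nat \<Rightarrow> (nat \<Rightarrow> nat \<Rightarrow> nat) \<Rightarrow> (nat \<Rightarrow> nat) set" where
  "sft d A = {x. (\<forall>k. x k < d) \<and> (\<forall>k. A (x k) (x (Suc k)) = 1)}"

definition transition_matrix :: "nat \<Rightarrow> (nat \<Rightarrow> nat \<Rightarrow> nat) \<Rightarrow> bool" where
  "transition_matrix d A \<longleftrightarrow>
     1 \<le> d \<and> (\<forall>i<d. \<forall>j<d. A i j \<in> {0, 1}) \<and> (\<forall>a<d. \<exists>x\<in>sft d A. \<exists>k. x k = a)"

definition shift :: "(nat \<Rightarrow> nat) \<Rightarrow> nat \<Rightarrow> nat" where
  "shift x = (\<lambda>k. x (Suc k))"

text \<open>The exponent is the first index of disagreement, counted from 1.\<close>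

definition dist_theta :: "real \<Rightarrow> (nat \<Rightarrow> nat) \<Rightarrow> (nat \<Rightarrow> nat) \<Rightarrow> real" where
  "dist_theta \<theta> x y = (if x = y then 0 else \<theta> ^ Suc (LEAST k. x k \<noteq> y k))"

definition sft_top :: "real \<Rightarrow> nat \<Rightarrow> (nat \<Rightarrow> nat \<Rightarrow> nat) \<Rightarrow> (nat \<Rightarrow> nat) topology" where
  "sft_top \<theta> d A = Metric_space.mtopology (sft d A) (dist_theta \<theta>)"

definition transitive_shift :: "real \<Rightarrow> nat \<Rightarrow> (nat \<Rightarrow> nat \<Rightarrow> nat) \<Rightarrow> bool" where
  "transitive_shift \<theta> d A \<longleftrightarrow>
     (\<forall>U V. openin (sft_top \<theta> d A) U \<and> openin (sft_top \<theta> d A) V \<and> U \<noteq> {} \<and> V \<noteq> {} \<longrightarrow>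
       (\<exists>n. (shift ^^ n) ` U \<inter> V \<noteq> {}))"

definition invariant_measures ::
  "real \<Rightarrow> nat \<Rightarrow> (nat \<Rightarrow> nat \<Rightarrow> nat) \<Rightarrow> (nat \<Rightarrow> nat) measure set" where
  "invariant_measures \<theta> d A =
     {\<mu>. prob_space \<mu> \<and> space \<mu> = sft d A \<and>
         sets \<mu> = sigma_sets (sft d A) {U. openin (sft_top \<theta> d A) U} \<and>
         (\<forall>B\<in>sets \<mu>. emeasure \<mu> (shift -` B \<inter> space \<mu>) = emeasure \<mu> B)}"

definition rv :: "((nat \<Rightarrow> nat) \<Rightarrow> real ^ 'm::finite) \<Rightarrow> (nat \<Rightarrow> nat) measure \<Rightarrow> real ^ 'm" where
  "rv \<Phi> \<mu> = (\<chi> i. integral\<^sup>L \<mu> (\<lambda>x. \<Phi> x $ i))"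

definition Rot ::
  "real \<Rightarrow> nat \<Rightarrow> (nat \<Rightarrow> nat \<Rightarrow> nat) \<Rightarrow> ((nat \<Rightarrow> nat) \<Rightarrow> real ^ 'm::finite) \<Rightarrow> (real ^ 'm) set" where
  "Rot \<theta> d A \<Phi> = rv \<Phi> ` invariant_measures \<theta> d A"

end

theory Submission
  imports Defs "HOL-Probability.Helly_Selection"
begin

text \<open>
  Let \<open>E K L\<close> be the set of averages over \<open>K\<close> arbitrary points of the ergodic averages of length
  \<open>L\<close>. A rotation vector is the integral of any such ergodic average, so a greedy choice of points
  brings an element of \<open>E K L\<close> within \<open>2 * C / sqrt K\<close> of it. Conversely, by transitivity every orbit
  segment of length \<open>L\<close> is shadowed by a periodic orbit whose period is at most \<open>L\<close> plus a constant,
  so \<open>E K L\<close> is close to the rotation set with an explicit error, given a modulus of continuity of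
  the potential. The modulus is found by running the oracle machine on all points spelled by \<open>N\<close>
  letters until no query exceeds \<open>N\<close>. Hence suitable \<open>K\<close> and \<open>L\<close> are computable, and the list of the
  centers in a finite net of \<open>E K L\<close> is the approximation. Computability by Turing machines is
  reduced to total recursive functions, in which oracle machines are simulated.
\<close>

section \<open>Counter programs and their compilation to Turing machines\<close>

text \<open>A computable compact set needs an error bound that is known in advance, so no step may
  rest on a limit without a rate; the ergodic theorem provides none. Averaging over many points
  gives a rate that depends neither on the measure nor on the dimension: choosing each point against
  the accumulated deviation is the argument behind the approximate Caratheodory theorem, with the
  error \<open>1 / sqrt K\<close> known from sums of orthogonal vectors. The bound \<open>C\<close>
  of the potential and the bound \<open>R\<close> for the connecting words are only shown to exist.
  They may be built into the machine, since a machine is sought for each fixed system. The modulus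
  of continuity, on the other hand, is needed at every precision and has to be computed. Since the
  simulation must be a total function, every natural number is made to spell a point of the
  subshift: there the oracle machine is known to halt.\<close>

datatype com = Inc nat | Dec nat | Seq com com | Loop nat com

inductive exec :: "com \<Rightarrow> (nat \<Rightarrow> nat) \<Rightarrow> (nat \<Rightarrow> nat) \<Rightarrow> bool" where
  exec_Inc: "exec (Inc r) s (s(r := Suc (s r)))"
| exec_Dec: "exec (Dec r) s (s(r := s r - 1))"
| exec_Seq: "exec c1 s s' \<Longrightarrow> exec c2 s' s'' \<Longrightarrow> exec (Seq c1 c2) s s''"
| exec_Loop_0: "s r = 0 \<Longrightarrow> exec (Loop r c) s s"
| exec_Loop_Suc: "s r \<noteq> 0 \<Longrightarrow> exec c s s' \<Longrightarrow> exec (Loop r c) s' s'' \<Longrightarrow> exec (Loop r c) s s''"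

datatype instr = IInc nat | IDec nat | ITest nat nat nat

text \<open>\<open>a\<close> is the absolute address of the first instruction. A loop ends with a
  second copy of its opening test, which takes the place of an unconditional jump back.\<close>

fun code :: "nat \<Rightarrow> com \<Rightarrow> instr list" where
  "code a (Inc r) = [IInc r]"
| "code a (Dec r) = [IDec r]"
| "code a (Seq c1 c2) = code a c1 @ code (a + length (code a c1)) c2"
| "code a (Loop r c) =
     (let b = a + length (code (Suc a) c) + 2
      in ITest r b (Suc a) # code (Suc a) c @ [ITest r b (Suc a)])"

fun regs :: "com \<Rightarrow> nat set" where
  "regs (Inc r) = {r}"
| "regs (Dec r) = {r}"
| "regs (Seq c1 c2) = regs c1 \<union> regs c2"
| "regs (Loop r c) = insert r (regs c)"

lemma finite_regs: "finite (regs c)"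
  by (induction c) auto

lemma code_target_le:
  "ITest r x y \<in> set (code a c) \<Longrightarrow> x \<le> a + length (code a c) \<and> y \<le> a + length (code a c)"
  by (induction c arbitrary: a) (force simp: Let_def)+

definition keep :: "nat list \<Rightarrow> (nat \<times> move) list" where
  "keep as = map (\<lambda>a. (a, Stay)) as"

text \<open>
  State \<open>2 * pc\<close> is the beginning of instruction \<open>pc\<close>; an increment moves right first
  and writes the stroke in the intermediate state \<open>2 * pc + 1\<close>. The start state runs to the end
  of the input, so that from then on every head stands on the last stroke of its tape.
\<close>

definition machine_trans :: "instr list \<Rightarrow> nat \<Rightarrow> nat list \<Rightarrow> nat \<times> (nat \<times> move) list" where
  "machine_trans is q as =
     (if q = 2 * length is + 1 then
        (if as ! 0 = 0 then (0, (keep as)[0 := (0, Left)]) else (q, (keep as)[0 := (as ! 0, Right)]))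
      else if q < 2 * length is then
        (case is ! (q div 2) of
           IInc r \<Rightarrow> (if even q then (q + 1, (keep as)[r := (if r < length as then as ! r else 0, Right)])
                      else (q + 1, (keep as)[r := (2, Stay)]))
         | IDec r \<Rightarrow> (2 * Suc (q div 2), if as ! r = 1 then keep as else (keep as)[r := (0, Left)])
         | ITest r a b \<Rightarrow> (if as ! r = 1 then 2 * a else 2 * b, keep as))
      else (0, keep as))"

definition machine :: "nat \<Rightarrow> instr list \<Rightarrow> tm" where
  "machine T is = \<lparr>num_tapes = T, num_states = 2 * length is + 2, num_symbols = 3,
     start_state = 2 * length is + 1, halt_state = 2 * length is, query_states = None,
     trans = machine_trans is\<rparr>"

lemma set_keep_update:
  "fst ` set (keep as) \<subseteq> S \<Longrightarrow> x \<in> S \<Longrightarrow> fst ` set ((keep as)[r := (x, mv)]) \<subseteq> S"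
  using set_update_subset_insert[of "keep as" r "(x, mv)"] by force

lemma plain_TM_machine:
  assumes "3 \<le> T" and targets: "\<And>r x y. ITest r x y \<in> set is \<Longrightarrow> x \<le> length is \<and> y \<le> length is"
  shows "plain_TM (machine T is)"
proof -
  have "fst (machine_trans is q as) < 2 * length is + 2 \<and>
        length (snd (machine_trans is q as)) = T \<and>
        fst ` set (snd (machine_trans is q as)) \<subseteq> {..<3}"
    if q: "q < 2 * length is + 2" and as: "length as = T" "set as \<subseteq> {..<3}" for q as
  proof -
    have len: "length (keep as) = T"
      using as by (simp add: keep_def)
    have k: "fst ` set (keep as) \<subseteq> {..<3}"
      using as by (auto simp: keep_def)
    have nth: "as ! r < 3" if "r < T" for r
      using as that nth_mem by fastforce
    have upd: "fst ` set ((keep as)[r := (x, mv)]) \<subseteq> {..<3}" if "x < 3" for r x mv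
      using set_keep_update[OF k, of x] that by simp
    have tgt: "x \<le> length is \<and> y \<le> length is" if "is ! (q div 2) = ITest r x y" "q < 2 * length is" for r x y
      using targets that nth_mem[of "q div 2" "is"] by (metis less_mult_imp_div_less mult.commute)
    have "fst (machine_trans is q as) < 2 * length is + 2"
      using q by (auto simp: machine_trans_def split: instr.split dest!: tgt)
    moreover have "length (snd (machine_trans is q as)) = T"
      by (auto simp: machine_trans_def len split: instr.split)
    moreover have "fst ` set (snd (machine_trans is q as)) \<subseteq> {..<3}"
      using \<open>3 \<le> T\<close> as(1)
      by (simp add: machine_trans_def split: instr.split) (use k upd nth in auto)
    ultimately show ?thesis by blast
  qed
  then show ?thesis
    using assms(1) by (simp add: plain_TM_def oracle_TM_def machine_def)
qed

section \<open>Runs of compiled machines\<close>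

definition reaches :: "tm \<Rightarrow> config \<Rightarrow> config \<Rightarrow> bool" where
  "reaches M c c' \<longleftrightarrow> (\<exists>n. (step M (\<lambda>_. 0) ^^ n) c = c')"

lemma reaches_refl: "reaches M c c"
  unfolding reaches_def by (rule exI[of _ 0]) simp

lemma reaches_trans: "reaches M c c' \<Longrightarrow> reaches M c' c'' \<Longrightarrow> reaches M c c''"
  unfolding reaches_def by (metis comp_apply funpow_add)

lemma reaches_step: "step M (\<lambda>_. 0) c = c' \<Longrightarrow> reaches M c' c'' \<Longrightarrow> reaches M c c''"
  unfolding reaches_def by (metis comp_apply funpow_Suc_right)

text \<open>With the head on the last stroke a zero test reads a single symbol: the head sees the
  end marker 1 exactly if the register is zero.\<close>

definition register_tapes :: "nat \<Rightarrow> (nat \<Rightarrow> nat) \<Rightarrow> tape list" where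
  "register_tapes T s = map (\<lambda>r. (s r, unary (s r))) [0..<T]"

lemma length_register_tapes [simp]: "length (register_tapes T s) = T"
  by (simp add: register_tapes_def)

lemma nth_register_tapes [simp]: "r < T \<Longrightarrow> register_tapes T s ! r = (s r, unary (s r))"
  by (simp add: register_tapes_def)

definition scan :: "tape list \<Rightarrow> nat list" where
  "scan ts = map (\<lambda>(h, t). t h) ts"

lemma length_scan [simp]: "length (scan ts) = length ts"
  by (simp add: scan_def)

lemma act_apply: "act (a, mv) (h, t) = (move_head mv h, t(h := a))"
  by (simp add: act_def)

lemma map2_act_keep: "map2 act (keep (scan ts)) ts = ts"
  by (rule nth_equalityI) (auto simp: keep_def scan_def act_apply split: prod.split)

lemma map2_act_keep_update:
  "map2 act ((keep (scan ts))[r := a]) ts = ts[r := act a (ts ! r)]"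
proof (rule nth_equalityI)
  fix i assume "i < length (map2 act ((keep (scan ts))[r := a]) ts)"
  then have i: "i < length ts" by (simp add: keep_def scan_def)
  have "map2 act (keep (scan ts)) ts ! i = ts ! i"
    by (simp add: map2_act_keep)
  then show "map2 act ((keep (scan ts))[r := a]) ts ! i = ts[r := act a (ts ! r)] ! i"
    using i by (cases "i = r") (auto simp: keep_def)
qed (simp add: keep_def)

lemma step_machine:
  "q \<noteq> 2 * length is \<Longrightarrow> step (machine T is) \<phi> (q, ts) =
     (fst (machine_trans is q (scan ts)), map2 act (snd (machine_trans is q (scan ts))) ts)"
  by (simp add: step_def machine_def ordinary_step_def scan_def split: prod.split)

lemma scan_register: "r < T \<Longrightarrow> scan (register_tapes T s) ! r = (if s r = 0 then 1 else 2)"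
  by (simp add: scan_def unary_def)

lemma register_tapes_update:
  "(register_tapes T s)[r := (v, unary v)] = register_tapes T (s(r := v))"
  by (rule nth_equalityI) (auto simp: register_tapes_def nth_list_update)

lemma unary_Suc: "(unary v)(Suc v := 2) = unary (Suc v)"
  by (auto simp: unary_def fun_eq_iff)

lemma unary_rewrite: "(unary v)(v := if v = 0 then 1 else 2) = unary v"
  by (auto simp: unary_def fun_eq_iff)

lemma unary_pred: "0 < v \<Longrightarrow> (unary v)(v := 0) = unary (v - 1)"
  by (auto simp: unary_def fun_eq_iff)

lemma reaches_IInc:
  assumes "pc < length is" "is ! pc = IInc r" "r < T"
  shows "reaches (machine T is) (2 * pc, register_tapes T s)
           (2 * Suc pc, register_tapes T (s(r := Suc (s r))))"
proof -
  let ?ts = "(register_tapes T s)[r := (Suc (s r), unary (s r))]"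
  have 1: "step (machine T is) (\<lambda>_. 0) (2 * pc, register_tapes T s) = (2 * pc + 1, ?ts)"
    using assms unary_rewrite[of "s r"]
    by (simp add: step_machine machine_trans_def map2_act_keep_update act_apply scan_register)
  have "2 * pc + 1 \<noteq> 2 * length is"
    by presburger
  then have 2: "step (machine T is) (\<lambda>_. 0) (2 * pc + 1, ?ts)
      = (2 * Suc pc, register_tapes T (s(r := Suc (s r))))"
    using assms
    by (subst step_machine)
       (simp_all add: machine_trans_def map2_act_keep_update act_apply unary_Suc register_tapes_update)
  show ?thesis
    by (rule reaches_step[OF 1 reaches_step[OF 2 reaches_refl]])
qed

lemma reaches_IDec:
  assumes "pc < length is" "is ! pc = IDec r" "r < T"
  shows "reaches (machine T is) (2 * pc, register_tapes T s)
           (2 * Suc pc, register_tapes T (s(r := s r - 1)))"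
proof (rule reaches_step[OF _ reaches_refl])
  show "step (machine T is) (\<lambda>_. 0) (2 * pc, register_tapes T s)
      = (2 * Suc pc, register_tapes T (s(r := s r - 1)))"
  proof (cases "s r = 0")
    case True
    then have "s(r := s r - 1) = s" by auto
    with True show ?thesis
      using assms by (simp add: step_machine machine_trans_def map2_act_keep scan_register)
  next
    case False
    then show ?thesis
      using assms unary_pred[of "s r"] register_tapes_update[of T s r "s r - 1"]
      by (simp add: step_machine machine_trans_def map2_act_keep_update scan_register act_apply)
  qed
qed

lemma reaches_ITest:
  assumes "pc < length is" "is ! pc = ITest r a b" "r < T"
  shows "reaches (machine T is) (2 * pc, register_tapes T s)
           (if s r = 0 then 2 * a else 2 * b, register_tapes T s)"
  by (rule reaches_step[OF _ reaches_refl])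
     (use assms in \<open>simp add: step_machine machine_trans_def map2_act_keep scan_register\<close>)

text \<open>The induction follows the execution and not the program, because a loop repeats the same
  code at the same addresses.\<close>

lemma reaches_code:
  assumes "exec c s s'" "is = pre @ code (length pre) c @ post" "regs c \<subseteq> {..<T}"
  shows "reaches (machine T is) (2 * length pre, register_tapes T s)
           (2 * (length pre + length (code (length pre) c)), register_tapes T s')"
  using assms
proof (induction arbitrary: pre post rule: exec.induct)
  case (exec_Inc r s)
  then show ?case
    using reaches_IInc[of "length pre" "is" r T s] by (simp add: nth_append fun_upd_def)
next
  case (exec_Dec r s)
  then show ?case
    using reaches_IDec[of "length pre" "is" r T s] by (simp add: nth_append fun_upd_def)
next
  case (exec_Seq c1 s s' c2 s'')
  let ?c1 = "code (length pre) c1"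
  have "reaches (machine T is) (2 * length pre, register_tapes T s)
      (2 * (length pre + length ?c1), register_tapes T s')"
    by (rule exec_Seq.IH(1)) (use exec_Seq.prems in auto)
  moreover have "reaches (machine T is) (2 * length (pre @ ?c1), register_tapes T s')
      (2 * (length (pre @ ?c1) + length (code (length (pre @ ?c1)) c2)), register_tapes T s'')"
    by (rule exec_Seq.IH(2)) (use exec_Seq.prems in auto)
  ultimately show ?case
    by (auto intro: reaches_trans simp: add.assoc)
next
  case (exec_Loop_0 s r c)
  then show ?case
    using reaches_ITest[of "length pre" "is" r _ _ T s] by (simp add: nth_append Let_def)
next
  case (exec_Loop_Suc s r c s' s'')
  let ?n = "length pre" and ?c = "code (Suc (length pre)) c"
  let ?t = "ITest r (?n + length ?c + 2) (Suc ?n)"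
  have is_eq: "is = (pre @ [?t]) @ code (length (pre @ [?t])) c @ (?t # post)"
    using exec_Loop_Suc.prems by (simp add: Let_def)
  have r: "r < T"
    using exec_Loop_Suc.prems by simp
  have nth1: "?n < length is" "is ! ?n = ?t"
    by (subst is_eq, simp add: nth_append)+
  have nth2: "Suc ?n + length ?c < length is" "is ! (Suc ?n + length ?c) = ?t"
    by (subst is_eq, simp add: nth_append)+
  have in_body: "reaches (machine T is) (2 * ?n, register_tapes T s) (2 * Suc ?n, register_tapes T s)"
    using reaches_ITest[OF nth1 r, of s] exec_Loop_Suc.hyps by simp
  have body: "reaches (machine T is) (2 * Suc ?n, register_tapes T s)
      (2 * (Suc ?n + length ?c), register_tapes T s')"
    using exec_Loop_Suc.IH(1)[OF is_eq] exec_Loop_Suc.prems by simp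
  have again: "reaches (machine T is) (2 * ?n, register_tapes T s')
      (2 * (?n + length (code ?n (Loop r c))), register_tapes T s'')"
    by (rule exec_Loop_Suc.IH(2)) (use exec_Loop_Suc.prems in auto)
  \<comment> \<open>Control is at the closing test, while the run \<open>again\<close> starts at the
    opening one. If the register is nonzero, both tests lead to the same configuration in one step,
    so that only the first step of the run has to be exchanged. A run of no steps is excluded
    because the addresses differ.\<close>
  have jump: "reaches (machine T is) (2 * (Suc ?n + length ?c), register_tapes T s')
      (2 * (?n + length (code ?n (Loop r c))), register_tapes T s'')"
  proof (cases "s' r = 0")
    case True
    then have "s'' = s'"
      using exec_Loop_Suc.hyps(3) by (auto elim: exec.cases)
    with True show ?thesis
      using reaches_ITest[OF nth2 r, of s'] by (simp add: Let_def)
  next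
    case False
    have "step (machine T is) (\<lambda>_. 0) (2 * ?n, register_tapes T s') = (2 * Suc ?n, register_tapes T s')"
      using nth1 r False by (simp add: step_machine machine_trans_def map2_act_keep scan_register)
    moreover have "step (machine T is) (\<lambda>_. 0) (2 * (Suc ?n + length ?c), register_tapes T s')
        = (2 * Suc ?n, register_tapes T s')"
      using nth2 r False by (simp add: step_machine machine_trans_def map2_act_keep scan_register)
    ultimately have eq: "step (machine T is) (\<lambda>_. 0) (2 * ?n, register_tapes T s')
       = step (machine T is) (\<lambda>_. 0) (2 * (Suc ?n + length ?c), register_tapes T s')" by simp
    obtain k where k: "(step (machine T is) (\<lambda>_. 0) ^^ k) (2 * ?n, register_tapes T s')
        = (2 * (?n + length (code ?n (Loop r c))), register_tapes T s'')"
      using again by (auto simp: reaches_def)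
    show ?thesis
    proof (cases k)
      case 0
      then show ?thesis using k by (simp add: Let_def)
    next
      case (Suc k')
      then have "(step (machine T is) (\<lambda>_. 0) ^^ k) (2 * (Suc ?n + length ?c), register_tapes T s')
          = (2 * (?n + length (code ?n (Loop r c))), register_tapes T s'')"
        using k eq by (simp add: funpow_Suc_right del: funpow.simps)
      then show ?thesis by (auto simp: reaches_def)
    qed
  qed
  show ?case
    by (rule reaches_trans[OF in_body reaches_trans[OF body jump]])
qed

lemma reaches_end_of_input:
  assumes "0 < T"
  shows "reaches (machine T is) (initial_config (machine T is) n)
           (0, register_tapes T ((\<lambda>_. 0)(0 := n)))"
proof -
  let ?M = "machine T is" and ?q = "2 * length is + 1"
  let ?ts = "\<lambda>h. (register_tapes T ((\<lambda>_. 0)(0 := n)))[0 := (h, unary n)]"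
  have init: "initial_config ?M n = (?q, ?ts 0)"
    using assms
    by (auto simp: initial_config_def machine_def register_tapes_def nth_Cons'
        intro!: nth_equalityI)
  have "scan (?ts h) ! 0 = unary n h" for h
    using assms by (simp add: scan_def)
  note sc = this
  have move: "step ?M (\<lambda>_. 0) (?q, ?ts h) = (?q, ?ts (Suc h))" if "h \<le> n" for h
  proof -
    have "unary n h \<noteq> 0" using that by (simp add: unary_def)
    then show ?thesis
      using assms by (simp add: step_machine machine_trans_def sc map2_act_keep_update act_apply)
  qed
  have "(step ?M (\<lambda>_. 0) ^^ h) (?q, ?ts 0) = (?q, ?ts h)" if "h \<le> Suc n" for h
    using that by (induction h) (use move in auto)
  from this[of "Suc n"] have to_blank: "reaches ?M (?q, ?ts 0) (?q, ?ts (Suc n))"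
    unfolding reaches_def by blast
  have blank: "unary n (Suc n) = 0" "(unary n)(Suc n := 0) = unary n"
    by (auto simp: unary_def)
  then have "step ?M (\<lambda>_. 0) (?q, ?ts (Suc n)) = (0, ?ts n)"
    using assms by (simp add: step_machine machine_trans_def sc map2_act_keep_update act_apply)
  from reaches_trans[OF to_blank reaches_step[OF this reaches_refl]] show ?thesis
    unfolding init register_tapes_update by simp
qed

lemma unary_value_unary: "unary_value (unary v) = v"
  unfolding unary_value_def by (rule Least_equality) (auto simp: unary_def split: if_splits)

theorem compile_correct:
  assumes "\<And>n. \<exists>s'. exec c ((\<lambda>_. 0)(0 := n)) s' \<and> s' 1 = f n"
  shows "\<exists>M. plain_TM M \<and> (\<forall>n. plain_outputs M n (f n))"
proof -
  \<comment> \<open>The summand 3 secures the three tapes that every machine must have.\<close>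
  define T where "T = Suc (Max (regs c)) + 3"
  define "is" where "is = code 0 c"
  let ?M = "machine T is"
  have T: "regs c \<subseteq> {..<T}" "3 \<le> T"
    using Max_ge[OF finite_regs, of _ c] by (fastforce simp: T_def intro: le_less_trans)+
  have "plain_TM ?M"
    by (rule plain_TM_machine) (use T code_target_le[of _ _ _ 0 c] in \<open>auto simp: is_def\<close>)
  moreover have "plain_outputs ?M n (f n)" for n
  proof -
    obtain s' where s': "exec c ((\<lambda>_. 0)(0 := n)) s'" "s' 1 = f n"
      using assms by blast
    have "reaches ?M (0, register_tapes T ((\<lambda>_. 0)(0 := n))) (2 * length is, register_tapes T s')"
      using reaches_code[OF s'(1), of "is" "[]" "[]" T] T by (simp add: is_def)
    then have "reaches ?M (initial_config ?M n) (2 * length is, register_tapes T s')"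
      using reaches_end_of_input[of T "is" n] T by (meson reaches_trans less_le_trans zero_less_numeral)
    then show ?thesis
      using T s'(2)
      by (force simp: plain_outputs_def outputs_def reaches_def machine_def unary_value_unary)
  qed
  ultimately show ?thesis by blast
qed

section \<open>Total recursive functions\<close>

definition pi1 :: "nat \<Rightarrow> nat" where "pi1 z = fst (prod_decode z)"
definition pi2 :: "nat \<Rightarrow> nat" where "pi2 z = snd (prod_decode z)"

lemma pi_prod_encode [simp]: "pi1 (prod_encode (a, b)) = a" "pi2 (prod_encode (a, b)) = b"
  by (simp_all add: pi1_def pi2_def)

lemma prod_encode_pi [simp]: "prod_encode (pi1 z, pi2 z) = z"
  by (simp add: pi1_def pi2_def)

text \<open>
  A program computing \<open>f\<close> works in place on register \<open>k\<close>; it may use the registers above \<open>k\<close>,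
  which are zero before and after, and leaves those below \<open>k\<close> alone.
\<close>

definition computes :: "nat \<Rightarrow> com \<Rightarrow> (nat \<Rightarrow> nat) \<Rightarrow> bool" where
  "computes k c f \<longleftrightarrow> (\<forall>s. (\<forall>r>k. s r = 0) \<longrightarrow> exec c s (s(k := f (s k))))"

text \<open>The quantifier over the base register replaces renaming: a subprogram can be put on any
  register with free space above it. Termination on every input is included, so only total functions
  occur.\<close>

definition recursive :: "(nat \<Rightarrow> nat) \<Rightarrow> bool" where
  "recursive f \<longleftrightarrow> (\<forall>k. \<exists>c. computes k c f)"

lemma recursiveI:
  assumes "\<And>k s. \<forall>r>k. s r = 0 \<Longrightarrow> exec (c k) s (s(k := f (s k)))"
  shows "recursive f"
  using assms by (auto simp: recursive_def computes_def)

lemma recursiveE: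
  assumes "recursive f"
  obtains c where "\<And>k s. \<forall>r>k. s r = 0 \<Longrightarrow> exec (c k) s (s(k := f (s k)))"
  using assms unfolding recursive_def computes_def by metis

lemma exec_eq: "exec c s t \<Longrightarrow> t = t' \<Longrightarrow> exec c s t'"
  by simp

text \<open>Loops are verified by giving the exact state \<open>S i\<close> after \<open>i\<close>
  rounds and the number \<open>n\<close> of rounds, which settles termination as well.\<close>

lemma exec_Loop_iterate:
  assumes "\<And>i. i < n \<Longrightarrow> S i r \<noteq> 0" "\<And>i. i < n \<Longrightarrow> exec c (S i) (S (Suc i))" "S n r = 0"
  shows "exec (Loop r c) (S 0) (S n)"
  using assms
proof (induction n arbitrary: S)
  case 0
  then show ?case by (simp add: exec_Loop_0)
next
  case (Suc n)
  have "exec (Loop r c) (S (Suc 0)) (S (Suc n))"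
    using Suc.IH[of "\<lambda>i. S (Suc i)"] Suc.prems by simp
  with Suc.prems(1)[of 0] Suc.prems(2)[of 0] show ?case
    by (intro exec_Loop_Suc[of "S 0" r c "S (Suc 0)"]) simp_all
qed

lemma exec_Loop_iterate':
  assumes "s = S 0" "t = S n"
    "\<And>i. i < n \<Longrightarrow> S i r \<noteq> 0" "\<And>i. i < n \<Longrightarrow> exec c (S i) (S (Suc i))" "S n r = 0"
  shows "exec (Loop r c) s t"
  unfolding assms(1,2) by (rule exec_Loop_iterate) (fact assms)+

lemma exec_Loop_once: "s r \<noteq> 0 \<Longrightarrow> exec c s s' \<Longrightarrow> s' r = 0 \<Longrightarrow> exec (Loop r c) s s'"
  by (rule exec_Loop_Suc[OF _ _ exec_Loop_0])

inductive_cases exec_SeqE: "exec (Seq c1 c2) s t"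

lemma exec_Seq_assoc: "exec (Seq (Seq c1 c2) c3) s t \<Longrightarrow> exec (Seq c1 (Seq c2 c3)) s t"
  by (auto elim!: exec_SeqE intro: exec_Seq)

section \<open>Register programs for copying and pairing\<close>

definition clear :: "nat \<Rightarrow> com" where
  "clear r = Loop r (Dec r)"

lemma exec_clear: "exec (clear r) s (s(r := 0))"
  unfolding clear_def
  by (rule exec_Loop_iterate'[where S = "\<lambda>i. s(r := s r - i)" and n = "s r"])
     (auto intro!: exec_eq[OF exec_Dec])

definition move2 :: "nat \<Rightarrow> nat \<Rightarrow> nat \<Rightarrow> com" where
  "move2 a b c = Loop a (Seq (Dec a) (Seq (Inc b) (Inc c)))"

lemma exec_move2:
  assumes "a \<noteq> b" "a \<noteq> c" "b \<noteq> c"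
  shows "exec (move2 a b c) s (s(a := 0, b := s b + s a, c := s c + s a))"
  unfolding move2_def
proof (rule exec_Loop_iterate'[where S = "\<lambda>i. s(a := s a - i, b := s b + i, c := s c + i)" and n = "s a"])
  fix i assume "i < s a"
  show "exec (Seq (Dec a) (Seq (Inc b) (Inc c))) (s(a := s a - i, b := s b + i, c := s c + i))
      (s(a := s a - Suc i, b := s b + Suc i, c := s c + Suc i))"
    by (rule exec_Seq[OF exec_Dec exec_Seq[OF exec_Inc exec_eq[OF exec_Inc]]])
       (use assms in \<open>auto simp: fun_eq_iff\<close>)
qed (use assms in auto)

definition transfer :: "nat \<Rightarrow> nat \<Rightarrow> com" where
  "transfer a b = Loop a (Seq (Dec a) (Inc b))"

lemma exec_transfer:
  assumes "a \<noteq> b"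
  shows "exec (transfer a b) s (s(a := 0, b := s b + s a))"
  unfolding transfer_def
proof (rule exec_Loop_iterate'[where S = "\<lambda>i. s(a := s a - i, b := s b + i)" and n = "s a"])
  fix i assume "i < s a"
  show "exec (Seq (Dec a) (Inc b)) (s(a := s a - i, b := s b + i)) (s(a := s a - Suc i, b := s b + Suc i))"
    by (rule exec_Seq[OF exec_Dec exec_eq[OF exec_Inc]]) (use assms in \<open>auto simp: fun_eq_iff\<close>)
qed (use assms in auto)

text \<open>Reading a register empties it, so the value is sent to two registers and one of them is
  moved back.\<close>

definition copy :: "nat \<Rightarrow> nat \<Rightarrow> nat \<Rightarrow> com" where
  "copy a b t = Seq (move2 a b t) (transfer t a)"

lemma exec_copy:
  assumes "a \<noteq> b" "a \<noteq> t" "b \<noteq> t" "s t = 0"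
  shows "exec (copy a b t) s (s(b := s b + s a))"
  unfolding copy_def
  by (rule exec_Seq[OF exec_move2 exec_eq[OF exec_transfer]])
     (use assms in \<open>auto simp: fun_eq_iff\<close>)

text \<open>\<open>prod_encode (a, b)\<close> is \<open>triangle (a + b) + a\<close>. The first
  moves put \<open>a\<close> into register \<open>k\<close> and \<open>a + b\<close> into register
  \<open>k + 3\<close>; the loop then adds \<open>a + b\<close>, \<open>a + b - 1\<close>, ...,
  \<open>1\<close>.\<close>

definition pack :: "nat \<Rightarrow> com" where
  "pack k = Seq (move2 (k + 1) k (k + 3)) (Seq (transfer (k + 2) (k + 3))
     (Loop (k + 3) (Seq (copy (k + 3) k (k + 4)) (Dec (k + 3)))))"

lemma exec_pack:
  assumes "s k = 0" "\<And>r. r > k + 2 \<Longrightarrow> s r = 0"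
  shows "exec (pack k) s (s(k := prod_encode (s (k + 1), s (k + 2)), k + 1 := 0, k + 2 := 0))"
proof -
  let ?a = "s (k + 1)" and ?b = "s (k + 2)"
  let ?s = "s(k := ?a, k + 1 := 0, k + 2 := 0, k + 3 := ?a + ?b)"
  let ?S = "\<lambda>i. ?s(k := ?a + triangle (?a + ?b) - triangle (?a + ?b - i), k + 3 := ?a + ?b - i)"
  have 1: "exec (Seq (move2 (k + 1) k (k + 3)) (transfer (k + 2) (k + 3))) s ?s"
    by (rule exec_Seq[OF exec_move2 exec_eq[OF exec_transfer]])
       (use assms in \<open>auto simp: fun_eq_iff\<close>)
  have tri: "triangle (n - Suc i) + (n - i) = triangle (n - i)" if "i < n" for i n
    using that by (metis Suc_diff_Suc triangle_Suc)
  have mono: "triangle (n - i) \<le> triangle n" for i n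
    unfolding triangle_def by (intro div_le_mono mult_le_mono) auto
  have "exec (Loop (k + 3) (Seq (copy (k + 3) k (k + 4)) (Dec (k + 3)))) ?s (?S (?a + ?b))"
  proof (rule exec_Loop_iterate'[where S = ?S and n = "?a + ?b"])
    fix i assume i: "i < ?a + ?b"
    show "exec (Seq (copy (k + 3) k (k + 4)) (Dec (k + 3))) (?S i) (?S (Suc i))"
      by (rule exec_Seq[OF exec_copy exec_eq[OF exec_Dec]])
         (use assms tri[OF i] mono[of "?a + ?b" i] in \<open>auto simp: fun_eq_iff\<close>)
  qed (use mono[of "?a + ?b"] in auto)
  moreover have "?S (?a + ?b) = s(k := prod_encode (?a, ?b), k + 1 := 0, k + 2 := 0)"
    using assms by (auto simp: fun_eq_iff prod_encode_def)
  ultimately have "exec (Loop (k + 3) (Seq (copy (k + 3) k (k + 4)) (Dec (k + 3)))) ?s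
      (s(k := prod_encode (?a, ?b), k + 1 := 0, k + 2 := 0))" by simp
  from exec_Seq_assoc[OF exec_Seq[OF 1 this]] show ?thesis
    unfolding pack_def .
qed

lemma pi_0 [simp]: "pi1 0 = 0" "pi2 0 = 0"
  by (simp_all add: pi1_def pi2_def prod_decode_def prod_decode_aux.simps)

text \<open>Successive codes walk along the diagonals of the pairing. Hence a pair can be decoded by
  advancing it once per unit of its code, without solving for the diagonal.\<close>

lemma pi_Suc:
  "pi1 (Suc z) = (if pi2 z = 0 then 0 else Suc (pi1 z))"
  "pi2 (Suc z) = (if pi2 z = 0 then Suc (pi1 z) else pi2 z - 1)"
proof -
  define a b where "a = pi1 z" and "b = pi2 z"
  have z: "z = prod_encode (a, b)"
    by (simp add: a_def b_def)
  have "Suc z = (if b = 0 then prod_encode (0, Suc a) else prod_encode (Suc a, b - 1))"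
    unfolding z by (cases b) (simp_all add: prod_encode_def)
  then show "pi1 (Suc z) = (if pi2 z = 0 then 0 else Suc (pi1 z))"
    "pi2 (Suc z) = (if pi2 z = 0 then Suc (pi1 z) else pi2 z - 1)"
    by (auto simp flip: a_def b_def)
qed

text \<open>
  Register \<open>k + 3\<close> is a flag that selects the branch: it is reset if register \<open>k + 2\<close> is positive.
\<close>

definition next_pair :: "nat \<Rightarrow> com" where
  "next_pair k = Seq (Inc (k + 3)) (Seq (copy (k + 2) (k + 4) (k + 5))
     (Seq (Loop (k + 4) (Seq (clear (k + 4)) (Seq (Dec (k + 3)) (Seq (Inc (k + 1)) (Dec (k + 2))))))
          (Loop (k + 3) (Seq (Dec (k + 3)) (Seq (transfer (k + 1) (k + 2)) (Inc (k + 2)))))))"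

lemma exec_next_pair:
  assumes "\<And>r. r > k + 2 \<Longrightarrow> s r = 0" "s (k + 1) = pi1 z" "s (k + 2) = pi2 z"
  shows "exec (next_pair k) s (s(k + 1 := pi1 (Suc z), k + 2 := pi2 (Suc z)))"
proof -
  let ?s = "s(k + 3 := 1, k + 4 := pi2 z)"
  have 1: "exec (copy (k + 2) (k + 4) (k + 5)) (s(k + 3 := Suc (s (k + 3)))) ?s"
    by (rule exec_eq[OF exec_copy]) (use assms in \<open>auto simp: fun_eq_iff\<close>)
  have "exec (Seq (Loop (k + 4) (Seq (clear (k + 4)) (Seq (Dec (k + 3)) (Seq (Inc (k + 1)) (Dec (k + 2))))))
          (Loop (k + 3) (Seq (Dec (k + 3)) (Seq (transfer (k + 1) (k + 2)) (Inc (k + 2))))))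
      ?s (s(k + 1 := pi1 (Suc z), k + 2 := pi2 (Suc z)))"
  proof (cases "pi2 z = 0")
    case True
    have "exec (Loop (k + 3) (Seq (Dec (k + 3)) (Seq (transfer (k + 1) (k + 2)) (Inc (k + 2)))))
       ?s (s(k + 1 := pi1 (Suc z), k + 2 := pi2 (Suc z)))"
      by (rule exec_Loop_once[OF _ exec_Seq[OF exec_Dec exec_Seq[OF exec_transfer exec_eq[OF exec_Inc]]]])
         (use assms True in \<open>auto simp: fun_eq_iff pi_Suc\<close>)
    from exec_Seq[OF exec_Loop_0 this] show ?thesis
      by (simp add: True)
  next
    case False
    have "exec (Loop (k + 4) (Seq (clear (k + 4)) (Seq (Dec (k + 3)) (Seq (Inc (k + 1)) (Dec (k + 2))))))
       ?s (s(k + 1 := pi1 (Suc z), k + 2 := pi2 (Suc z)))"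
      by (rule exec_Loop_once[OF _ exec_Seq[OF exec_clear exec_Seq[OF exec_Dec exec_Seq[OF exec_Inc exec_eq[OF exec_Dec]]]]])
         (use assms False in \<open>auto simp: fun_eq_iff pi_Suc\<close>)
    from exec_Seq[OF this exec_Loop_0] show ?thesis
      by (simp add: assms)
  qed
  then show ?thesis
    unfolding next_pair_def by (rule exec_Seq[OF exec_Inc exec_Seq[OF 1]])
qed

definition unpack :: "nat \<Rightarrow> com" where
  "unpack k = Loop k (Seq (Dec k) (next_pair k))"

lemma exec_unpack:
  assumes "\<And>r. r > k \<Longrightarrow> s r = 0"
  shows "exec (unpack k) s (s(k := 0, k + 1 := pi1 (s k), k + 2 := pi2 (s k)))"
  unfolding unpack_def
proof (rule exec_Loop_iterate'[where S = "\<lambda>i. s(k := s k - i, k + 1 := pi1 i, k + 2 := pi2 i)" and n = "s k"])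
  fix i assume "i < s k"
  show "exec (Seq (Dec k) (next_pair k)) (s(k := s k - i, k + 1 := pi1 i, k + 2 := pi2 i))
     (s(k := s k - Suc i, k + 1 := pi1 (Suc i), k + 2 := pi2 (Suc i)))"
    by (rule exec_Seq[OF exec_Dec exec_eq[OF exec_next_pair[where z = i]]])
       (use assms in \<open>auto simp: fun_eq_iff\<close>)
qed (use assms in \<open>auto simp: fun_eq_iff\<close>)

section \<open>Composition, iteration and search\<close>

lemma recursive_id: "recursive (\<lambda>x. x)"
  by (rule recursiveI[where c = "\<lambda>k. Seq (Inc k) (Dec k)"])
     (auto intro!: exec_eq[OF exec_Seq[OF exec_Inc exec_Dec]])

lemma recursive_comp:
  assumes "recursive f" "recursive g"
  shows "recursive (\<lambda>x. f (g x))"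
proof -
  obtain cf where cf: "\<And>k s. \<forall>r>k. s r = 0 \<Longrightarrow> exec (cf k) s (s(k := f (s k)))"
    using assms(1) by (elim recursiveE) blast
  obtain cg where cg: "\<And>k s. \<forall>r>k. s r = 0 \<Longrightarrow> exec (cg k) s (s(k := g (s k)))"
    using assms(2) by (elim recursiveE) blast
  show ?thesis
    by (rule recursiveI[where c = "\<lambda>k. Seq (cg k) (cf k)"], rule exec_Seq[OF cg exec_eq[OF cf]]) auto
qed

lemma recursive_Suc_base: "recursive Suc"
  by (rule recursiveI[where c = "\<lambda>k. Inc k"]) (rule exec_Inc)

lemma recursive_Suc: "recursive f \<Longrightarrow> recursive (\<lambda>x. Suc (f x))"
  by (rule recursive_comp[OF recursive_Suc_base])

lemma recursive_const: "recursive (\<lambda>x. c)"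
proof (induction c)
  case 0
  show ?case by (rule recursiveI[where c = clear]) (rule exec_clear)
qed (rule recursive_Suc)

lemma recursive_pi1: "recursive f \<Longrightarrow> recursive (\<lambda>x. pi1 (f x))"
  by (rule recursive_comp[of pi1],
      rule recursiveI[where c = "\<lambda>k. Seq (unpack k) (Seq (clear (k + 2)) (transfer (k + 1) k))"],
      rule exec_Seq[OF exec_unpack exec_Seq[OF exec_clear exec_eq[OF exec_transfer]]])
     (auto simp: fun_eq_iff)

lemma recursive_pi2: "recursive f \<Longrightarrow> recursive (\<lambda>x. pi2 (f x))"
  by (rule recursive_comp[of pi2],
      rule recursiveI[where c = "\<lambda>k. Seq (unpack k) (Seq (clear (k + 1)) (transfer (k + 2) k))"],
      rule exec_Seq[OF exec_unpack exec_Seq[OF exec_clear exec_eq[OF exec_transfer]]])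
     (auto simp: fun_eq_iff)

lemma recursive_prod_encode:
  assumes "recursive f" "recursive g"
  shows "recursive (\<lambda>x. prod_encode (f x, g x))"
proof -
  obtain cf where cf: "\<And>k s. \<forall>r>k. s r = 0 \<Longrightarrow> exec (cf k) s (s(k := f (s k)))"
    using assms(1) by (elim recursiveE) blast
  obtain cg where cg: "\<And>k s. \<forall>r>k. s r = 0 \<Longrightarrow> exec (cg k) s (s(k := g (s k)))"
    using assms(2) by (elim recursiveE) blast
  let ?c = "\<lambda>k. Seq (copy k (k + 1) (k + 2)) (Seq (cf (k + 1)) (Seq (copy k (k + 2) (k + 3))
      (Seq (cg (k + 2)) (Seq (clear k) (pack k)))))"
  show ?thesis
  proof (rule recursiveI[where c = ?c])
    fix k and s :: "nat \<Rightarrow> nat"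
    assume z: "\<forall>r>k. s r = 0"
    have 1: "exec (copy k (k + 1) (k + 2)) s (s(k + 1 := s k))"
      by (rule exec_eq[OF exec_copy]) (use z in auto)
    have 2: "exec (cf (k + 1)) (s(k + 1 := s k)) (s(k + 1 := f (s k)))"
      by (rule exec_eq[OF cf]) (use z in auto)
    have 3: "exec (copy k (k + 2) (k + 3)) (s(k + 1 := f (s k))) (s(k + 1 := f (s k), k + 2 := s k))"
      by (rule exec_eq[OF exec_copy]) (use z in auto)
    have 4: "exec (cg (k + 2)) (s(k + 1 := f (s k), k + 2 := s k)) (s(k + 1 := f (s k), k + 2 := g (s k)))"
      by (rule exec_eq[OF cg]) (use z in auto)
    have 5: "exec (Seq (clear k) (pack k)) (s(k + 1 := f (s k), k + 2 := g (s k)))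
        (s(k := prod_encode (f (s k), g (s k))))"
      by (rule exec_Seq[OF exec_clear exec_eq[OF exec_pack]]) (use z in \<open>auto simp: fun_eq_iff\<close>)
    show "exec (?c k) s (s(k := prod_encode (f (s k), g (s k))))"
      by (rule exec_Seq[OF 1 exec_Seq[OF 2 exec_Seq[OF 3 exec_Seq[OF 4 5]]]])
  qed
qed

lemma recursive_iterate:
  assumes "recursive f"
  shows "recursive (\<lambda>z. (f ^^ pi1 z) (pi2 z))"
proof -
  obtain cf where cf: "\<And>k s. \<forall>r>k. s r = 0 \<Longrightarrow> exec (cf k) s (s(k := f (s k)))"
    using assms by (elim recursiveE) blast
  let ?c = "\<lambda>k. Seq (unpack k) (Seq (Loop (k + 1) (Seq (Dec (k + 1)) (cf (k + 2)))) (transfer (k + 2) k))"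
  show ?thesis
  proof (rule recursiveI[where c = ?c])
    fix k and s :: "nat \<Rightarrow> nat"
    assume z: "\<forall>r>k. s r = 0"
    let ?a = "pi1 (s k)" and ?b = "pi2 (s k)"
    let ?S = "\<lambda>i. s(k := 0, k + 1 := ?a - i, k + 2 := (f ^^ i) ?b)"
    have 1: "exec (unpack k) s (?S 0)"
      by (rule exec_eq[OF exec_unpack]) (use z in auto)
    have 2: "exec (Loop (k + 1) (Seq (Dec (k + 1)) (cf (k + 2)))) (?S 0) (?S ?a)"
      by (rule exec_Loop_iterate[where S = ?S], simp,
          rule exec_Seq[OF exec_Dec exec_eq[OF cf]]) (use z in \<open>auto simp: fun_eq_iff\<close>)
    have 3: "exec (transfer (k + 2) k) (?S ?a) (s(k := (f ^^ ?a) ?b))"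
      by (rule exec_eq[OF exec_transfer]) (use z in \<open>auto simp: fun_eq_iff\<close>)
    show "exec (?c k) s (s(k := (f ^^ ?a) ?b))"
      by (rule exec_Seq[OF 1 exec_Seq[OF 2 3]])
  qed
qed

text \<open>Register \<open>k\<close> keeps \<open>x\<close>, register \<open>k + 1\<close> the
  candidate, and register \<open>k + 2\<close> the value of \<open>f\<close> at the pair, which is
  rebuilt from copies in each round. Solvability for every \<open>x\<close> makes the search
  total.\<close>

lemma recursive_Least_base:
  assumes "recursive f" "\<And>x. \<exists>y. f (prod_encode (x, y)) = 0"
  shows "recursive (\<lambda>x. LEAST y. f (prod_encode (x, y)) = 0)"
proof -
  obtain cf where cf: "\<And>k s. \<forall>r>k. s r = 0 \<Longrightarrow> exec (cf k) s (s(k := f (s k)))"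
    using assms by (elim recursiveE) blast
  let ?e = "\<lambda>k. Seq (copy k (k + 3) (k + 4)) (Seq (copy (k + 1) (k + 4) (k + 5))
     (Seq (pack (k + 2)) (cf (k + 2))))"
  let ?c = "\<lambda>k. Seq (?e k) (Seq (Loop (k + 2) (Seq (clear (k + 2)) (Seq (Inc (k + 1)) (?e k))))
     (Seq (clear k) (transfer (k + 1) k)))"
  show ?thesis
  proof (rule recursiveI[where c = ?c])
    fix k and s :: "nat \<Rightarrow> nat"
    assume z: "\<forall>r>k. s r = 0"
    define y where "y = (LEAST y. f (prod_encode (s k, y)) = 0)"
    let ?S = "\<lambda>i. s(k + 1 := i, k + 2 := f (prod_encode (s k, i)))"
    have e: "exec (?e k) (s(k + 1 := i)) (?S i)" for i
    proof -
      have 1: "exec (copy k (k + 3) (k + 4)) (s(k + 1 := i)) (s(k + 1 := i, k + 3 := s k))"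
        by (rule exec_eq[OF exec_copy]) (use z in auto)
      have 2: "exec (copy (k + 1) (k + 4) (k + 5)) (s(k + 1 := i, k + 3 := s k))
          (s(k + 1 := i, k + 3 := s k, k + 4 := i))"
        by (rule exec_eq[OF exec_copy]) (use z in auto)
      have 3: "exec (pack (k + 2)) (s(k + 1 := i, k + 3 := s k, k + 4 := i))
          (s(k + 1 := i, k + 2 := prod_encode (s k, i)))"
        by (rule exec_eq[OF exec_pack]) (use z in \<open>auto simp: fun_eq_iff\<close>)
      have 4: "exec (cf (k + 2)) (s(k + 1 := i, k + 2 := prod_encode (s k, i))) (?S i)"
        by (rule exec_eq[OF cf]) (use z in auto)
      show ?thesis
        by (rule exec_Seq[OF 1 exec_Seq[OF 2 exec_Seq[OF 3 4]]])
    qed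
    have s0: "s(k + 1 := 0) = s"
      using z by (auto simp: fun_eq_iff)
    have 1: "exec (?e k) s (?S 0)"
      using e[of 0] unfolding s0 .
    have 2: "exec (Loop (k + 2) (Seq (clear (k + 2)) (Seq (Inc (k + 1)) (?e k)))) (?S 0) (?S y)"
    proof (rule exec_Loop_iterate[where S = ?S])
      fix i assume "i < y"
      then show "?S i (k + 2) \<noteq> 0"
        using not_less_Least by (auto simp: y_def)
      have "(s(k + 1 := i, k + 2 := f (prod_encode (s k, i))))(k + 2 := 0, k + 1 := Suc i) = s(k + 1 := Suc i)"
        using z by (auto simp: fun_eq_iff)
      then show "exec (Seq (clear (k + 2)) (Seq (Inc (k + 1)) (?e k))) (?S i) (?S (Suc i))"
        by (intro exec_Seq[OF exec_clear] exec_Seq[OF exec_eq[OF exec_Inc] e]) (simp add: fun_upd_twist)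
    next
      show "?S y (k + 2) = 0"
        using LeastI_ex[OF assms(2)[of "s k"]] by (simp add: y_def)
    qed
    have 3: "exec (Seq (clear k) (transfer (k + 1) k)) (?S y) (s(k := y))"
      using LeastI_ex[OF assms(2)[of "s k"]]
      by (intro exec_Seq[OF exec_clear exec_eq[OF exec_transfer]]) (use z in \<open>auto simp: fun_eq_iff y_def\<close>)
    show "exec (?c k) s (s(k := y))"
      by (rule exec_Seq[OF 1 exec_Seq[OF 2 3]])
  qed
qed

text \<open>The input is first moved off register 0: \<open>cf 1\<close> works in place on register
  1, and tape 1 is the output tape.\<close>

theorem recursive_imp_TM:
  assumes "recursive f"
  shows "\<exists>M. plain_TM M \<and> (\<forall>n. plain_outputs M n (f n))"
proof -
  obtain cf where cf: "\<And>k s. \<forall>r>k. s r = 0 \<Longrightarrow> exec (cf k) s (s(k := f (s k)))"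
    using assms by (elim recursiveE) blast
  show ?thesis
  proof (rule compile_correct[where c = "Seq (transfer 0 1) (cf 1)"])
    fix n :: nat
    have "exec (transfer 0 1) ((\<lambda>_. 0)(0 := n)) ((\<lambda>_. 0)(1 := n))"
      by (rule exec_eq[OF exec_transfer]) auto
    moreover have "exec (cf 1) ((\<lambda>_. 0)(1 := n)) ((\<lambda>_. 0)(1 := f n))"
      by (rule exec_eq[OF cf]) auto
    ultimately show "\<exists>s'. exec (Seq (transfer 0 1) (cf 1)) ((\<lambda>_. 0)(0 := n)) s' \<and> s' 1 = f n"
      by (force intro: exec_Seq)
  qed
qed

subsection \<open>Closure properties\<close>

text \<open>Functions of several arguments are treated as functions of a coded tuple; this gives
  back composition in curried form.\<close>

lemma recursive_comp2:
  assumes "recursive (\<lambda>z. F (pi1 z) (pi2 z))" "recursive a" "recursive b"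
  shows "recursive (\<lambda>x. F (a x) (b x))"
  using recursive_comp[OF assms(1) recursive_prod_encode[OF assms(2,3)]] by simp

lemma recursive_comp3:
  assumes "recursive (\<lambda>z. F (pi1 z) (pi1 (pi2 z)) (pi2 (pi2 z)))"
    "recursive a" "recursive b" "recursive c"
  shows "recursive (\<lambda>x. F (a x) (b x) (c x))"
  using recursive_comp[OF assms(1) recursive_prod_encode[OF assms(2) recursive_prod_encode[OF assms(3,4)]]]
  by simp

lemma recursive_funpow:
  assumes h: "recursive (\<lambda>z. h (pi1 z) (pi2 z))" and "recursive n" "recursive s"
  shows "recursive (\<lambda>x. (h x ^^ n x) (s x))"
proof -
  \<comment> \<open>Iteration is available for functions of one number only, so the parameter
    \<open>x\<close> travels unchanged in the first component.\<close>
  define g where "g z = prod_encode (pi1 z, h (pi1 z) (pi2 z))" for z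
  have g: "recursive g"
    unfolding g_def by (intro recursive_prod_encode recursive_pi1 recursive_id h)
  have iter: "(g ^^ i) (prod_encode (x, y)) = prod_encode (x, (h x ^^ i) y)" for i x y
    by (induction i) (simp_all add: g_def)
  have "recursive (\<lambda>x. pi2 ((g ^^ pi1 (prod_encode (n x, prod_encode (x, s x))))
      (pi2 (prod_encode (n x, prod_encode (x, s x))))))"
    by (intro recursive_pi2 recursive_comp[OF recursive_iterate[OF g]] recursive_prod_encode assms recursive_id)
  then show ?thesis
    by (simp add: iter)
qed

lemma recursive_rec_nat:
  assumes "recursive (\<lambda>z. h (pi1 z) (pi1 (pi2 z)) (pi2 (pi2 z)))" "recursive n" "recursive s"
  shows "recursive (\<lambda>x. rec_nat (s x) (h x) (n x))"
proof -
  \<comment> \<open>The iterated pair holds the loop counter and the value reached so far.\<close>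
  define g where "g x w = prod_encode (Suc (pi1 w), h x (pi1 w) (pi2 w))" for x w
  have "recursive (\<lambda>z. g (pi1 z) (pi2 z))"
    unfolding g_def
    by (intro recursive_prod_encode recursive_Suc recursive_pi1 recursive_pi2 recursive_id assms)
  from recursive_funpow[OF this] assms
  have "recursive (\<lambda>x. pi2 ((g x ^^ n x) (prod_encode (0, s x))))"
    by (intro recursive_pi2) (simp add: recursive_prod_encode recursive_const)
  moreover have "(g x ^^ i) (prod_encode (0, y)) = prod_encode (i, rec_nat y (h x) i)" for x y i
    by (induction i) (simp_all add: g_def)
  ultimately show ?thesis by simp
qed

lemma recursive_add:
  assumes "recursive f" "recursive g"
  shows "recursive (\<lambda>x. f x + g x)"
proof -
  have "(Suc ^^ b) a = a + b" for a b
    by (induction b) simp_all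
  then show ?thesis
    using recursive_funpow[of "\<lambda>_. Suc" g f] assms by (simp add: recursive_Suc recursive_pi2 recursive_id add.commute)
qed

lemma recursive_pred:
  assumes "recursive f"
  shows "recursive (\<lambda>x. f x - 1)"
proof -
  have "rec_nat 0 (\<lambda>i _. i) n = n - 1" for n
    by (cases n) simp_all
  then show ?thesis
    using recursive_rec_nat[of "\<lambda>_ i _. i" f "\<lambda>_. 0"] assms
    by (simp add: recursive_pi1 recursive_pi2 recursive_id recursive_const)
qed

lemma recursive_diff:
  assumes "recursive f" "recursive g"
  shows "recursive (\<lambda>x. f x - g x)"
proof -
  have "((\<lambda>y. y - 1) ^^ b) a = a - b" for a b :: nat
    by (induction b) simp_all
  then show ?thesis
    using recursive_funpow[of "\<lambda>_ y. y - 1" g f] assms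
    by (simp add: recursive_pred[simplified] recursive_pi2 recursive_id)
qed

lemma recursive_mult:
  assumes "recursive f" "recursive g"
  shows "recursive (\<lambda>x. f x * g x)"
proof -
  have "((\<lambda>y. y + a) ^^ b) 0 = a * b" for a b :: nat
    by (induction b) simp_all
  then show ?thesis
    using recursive_funpow[of "\<lambda>x y. y + f x" g "\<lambda>_. 0"] assms
    by (simp add: recursive_add recursive_pi1 recursive_pi2 recursive_id recursive_const recursive_comp[of f])
qed

lemma recursive_power:
  assumes "recursive f" "recursive g"
  shows "recursive (\<lambda>x. f x ^ g x)"
proof -
  have "((\<lambda>y. y * a) ^^ b) 1 = a ^ b" for a b :: nat
    by (induction b) simp_all
  then show ?thesis
    using recursive_funpow[of "\<lambda>x y. y * f x" g "\<lambda>_. 1"] assms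
    by (simp add: recursive_mult recursive_pi1 recursive_pi2 recursive_id recursive_const recursive_comp[of f])
qed

lemma recursive_sum:
  assumes "recursive (\<lambda>z. f (pi1 z) (pi2 z))" "recursive n"
  shows "recursive (\<lambda>x. \<Sum>i<n x. f x i)"
proof -
  have "rec_nat 0 (\<lambda>i y. y + f x i) m = (\<Sum>i<m. f x i)" for x m
    by (induction m) simp_all
  then show ?thesis
    using recursive_rec_nat[of "\<lambda>x i y. y + f x i" n "\<lambda>_. 0"] assms
      recursive_comp2[OF assms(1) recursive_pi1[OF recursive_id] recursive_pi1[OF recursive_pi2[OF recursive_id]]]
    by (simp add: recursive_add recursive_pi2 recursive_id recursive_const)
qed

text \<open>The order is reversed because primitive recursion puts the newest entry in front of the
  list.\<close>

lemma recursive_list: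
  assumes "recursive (\<lambda>z. f (pi1 z) (pi2 z))" "recursive n"
  shows "recursive (\<lambda>x. list_encode (map (f x) (rev [0..<n x])))"
proof -
  have "rec_nat 0 (\<lambda>i y. Suc (prod_encode (f x i, y))) m = list_encode (map (f x) (rev [0..<m]))" for x m
    by (induction m) simp_all
  then show ?thesis
    using recursive_rec_nat[of "\<lambda>x i y. Suc (prod_encode (f x i, y))" n "\<lambda>_. 0"] assms
      recursive_comp2[OF assms(1) recursive_pi1[OF recursive_id] recursive_pi1[OF recursive_pi2[OF recursive_id]]]
    by (simp add: recursive_Suc recursive_prod_encode recursive_pi2 recursive_id recursive_const)
qed

text \<open>For lists of fixed length, in contrast to \<open>recursive_list\<close>: the entries may
  be unrelated functions, with no uniformity in \<open>i\<close>.\<close>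

lemma recursive_tuple:
  "(\<And>i. i \<in> set is \<Longrightarrow> recursive (f i)) \<Longrightarrow> recursive (\<lambda>x. list_encode (map (\<lambda>i. f i x) is))"
  by (induction "is") (simp_all add: recursive_const recursive_Suc recursive_prod_encode)

section \<open>Decidable predicates\<close>

definition decidable :: "(nat \<Rightarrow> bool) \<Rightarrow> bool" where
  "decidable P \<longleftrightarrow> recursive (\<lambda>x. of_bool (P x))"

lemma decidable_const: "decidable (\<lambda>x. b)"
  by (simp add: decidable_def recursive_const)

lemma decidable_not: "decidable P \<Longrightarrow> decidable (\<lambda>x. \<not> P x)"
proof -
  have "of_bool (\<not> b) = (1::nat) - of_bool b" for b
    by (cases b) simp_all
  then show "decidable P \<Longrightarrow> decidable (\<lambda>x. \<not> P x)"
    unfolding decidable_def by (simp only:) (intro recursive_diff recursive_const)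
qed

lemma decidable_conj: "decidable P \<Longrightarrow> decidable Q \<Longrightarrow> decidable (\<lambda>x. P x \<and> Q x)"
  unfolding decidable_def of_bool_conj by (rule recursive_mult)

lemma decidable_disj: "decidable P \<Longrightarrow> decidable Q \<Longrightarrow> decidable (\<lambda>x. P x \<or> Q x)"
  using decidable_not[OF decidable_conj[OF decidable_not decidable_not], of P Q] by simp

lemma decidable_le:
  assumes "recursive f" "recursive g"
  shows "decidable (\<lambda>x. f x \<le> g x)"
proof -
  have "of_bool (a \<le> b) = 1 - (a - b)" for a b :: nat
    by (cases "a \<le> b") simp_all
  then show ?thesis
    unfolding decidable_def by (simp only:) (intro recursive_diff recursive_const assms)
qed

lemma decidable_less: "recursive f \<Longrightarrow> recursive g \<Longrightarrow> decidable (\<lambda>x. f x < g x)"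
  using decidable_le[OF recursive_Suc] by (simp add: Suc_le_eq)

lemma decidable_eq: "recursive f \<Longrightarrow> recursive g \<Longrightarrow> decidable (\<lambda>x. f x = g x)"
  using decidable_conj[OF decidable_le decidable_le, of f g g f] by (simp add: eq_iff)

lemma decidable_Ball:
  assumes "decidable (\<lambda>z. P (pi1 z) (pi2 z))" "recursive n"
  shows "decidable (\<lambda>x. \<forall>i<n x. P x i)"
proof -
  have "(\<forall>i<m. P x i) \<longleftrightarrow> (\<Sum>i<m. of_bool (\<not> P x i)) = (0::nat)" for x m
    by auto
  moreover have "recursive (\<lambda>z. of_bool (\<not> P (pi1 z) (pi2 z)))"
    using decidable_not[OF assms(1)] by (simp add: decidable_def)
  ultimately show ?thesis
    using assms(2) by (simp only:) (intro decidable_eq recursive_sum recursive_const)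
qed

lemma recursive_if:
  assumes "decidable P" "recursive f" "recursive g"
  shows "recursive (\<lambda>x. if P x then f x else g x)"
proof -
  have "(if b then u else v) = of_bool b * u + of_bool (\<not> b) * v" for b and u v :: nat
    by simp
  then show ?thesis
    using assms decidable_not[OF assms(1)]
    by (simp only: decidable_def) (intro recursive_add recursive_mult)
qed

lemma recursive_max: "recursive f \<Longrightarrow> recursive g \<Longrightarrow> recursive (\<lambda>x. max (f x) (g x))"
  unfolding max_def by (intro recursive_if decidable_le)

lemma recursive_Least:
  assumes "decidable (\<lambda>z. P (pi1 z) (pi2 z))" "\<And>x. \<exists>y. P x y"
  shows "recursive (\<lambda>x. LEAST y. P x y)"
  using recursive_Least_base[of "\<lambda>z. of_bool (\<not> P (pi1 z) (pi2 z))"]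
    decidable_not[OF assms(1)] assms(2) by (simp add: decidable_def)

lemma recursive_div:
  assumes "recursive f" "recursive g"
  shows "recursive (\<lambda>x. f x div g x)"
proof -
  \<comment> \<open>The disjunct \<open>b = 0\<close> ends the search at 0, which is the value of a
    division by zero.\<close>
  have "(LEAST q. b = 0 \<or> a < b * Suc q) = a div b" for a b :: nat
  proof (rule Least_equality)
    show "b = 0 \<or> a < b * Suc (a div b)"
      using dividend_less_times_div[of b a] by (cases "b = 0") (simp_all add: algebra_simps)
    show "a div b \<le> q" if "b = 0 \<or> a < b * Suc q" for q
      using that less_mult_imp_div_less[of a "Suc q" b] by (auto simp: mult.commute)
  qed
  moreover have "\<exists>q. b = 0 \<or> a < b * Suc q" for a b :: nat
    using dividend_less_times_div[of b a]
    by (cases "b = 0", simp, intro exI[of _ "a div b"]) (simp add: algebra_simps)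
  ultimately show ?thesis
    using recursive_Least[of "\<lambda>x q. g x = 0 \<or> f x < g x * Suc q"] assms
    by (simp only:)
       (simp add: decidable_disj decidable_eq decidable_less recursive_mult recursive_Suc recursive_const
         recursive_pi1 recursive_pi2 recursive_id recursive_comp[of f] recursive_comp[of g] del: mult_Suc_right)
qed

lemma recursive_mod: "recursive f \<Longrightarrow> recursive g \<Longrightarrow> recursive (\<lambda>x. f x mod g x)"
  unfolding modulo_nat_def by (intro recursive_diff recursive_mult recursive_div)

text \<open>Finite tables enter the algorithm this way: the transition function of the given machine
  and the transitions of the subshift.\<close>

lemma recursive_finite_support:
  "finite D \<Longrightarrow> recursive (\<lambda>x. if x \<in> D then F x else 0)"
proof (induction rule: finite_induct)
  case (insert a D)
  have "(\<lambda>x. if x \<in> insert a D then F x else 0) =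
      (\<lambda>x. if x = a then F a else if x \<in> D then F x else 0)"
    by auto
  then show ?case
    by (simp only:) (intro recursive_if[OF _ recursive_const insert.IH] decidable_eq recursive_id recursive_const)
qed (simp add: recursive_const)

lemma decidable_finite: "finite D \<Longrightarrow> decidable (\<lambda>x. x \<in> D)"
  using recursive_finite_support[of D "\<lambda>_. 1"] by (simp add: decidable_def of_bool_def)

lemmas recursive_basic = recursive_id recursive_const recursive_Suc recursive_pi1 recursive_pi2
  recursive_prod_encode recursive_add recursive_diff recursive_mult recursive_power recursive_div
  recursive_mod recursive_if recursive_max decidable_const decidable_not decidable_conj
  decidable_disj decidable_le decidable_less decidable_eq

text \<open>A nonempty list has the code \<open>Suc (prod_encode (x, list_encode xs))\<close>, so
  \<open>pi2 (y - 1)\<close> is the tail and \<open>pi1 (y - 1)\<close> the head.\<close>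

definition nth_code :: "nat \<Rightarrow> nat \<Rightarrow> nat" where
  "nth_code i z = pi1 (((\<lambda>y. pi2 (y - 1)) ^^ i) z - 1)"

lemma nth_code_list_encode: "i < length xs \<Longrightarrow> nth_code i (list_encode xs) = xs ! i"
proof (induction i arbitrary: xs)
  case 0
  then show ?case by (cases xs) (simp_all add: nth_code_def)
next
  case (Suc i)
  then show ?case by (cases xs) (simp_all add: nth_code_def funpow_Suc_right del: funpow.simps)
qed

lemma recursive_nth_code:
  assumes "recursive f" "recursive g"
  shows "recursive (\<lambda>x. nth_code (f x) (g x))"
  unfolding nth_code_def by (intro recursive_basic recursive_funpow assms)

lemma nth_code_list_decode: "i < length (list_decode z) \<Longrightarrow> list_decode z ! i = nth_code i z"
  using nth_code_list_encode[of i "list_decode z"] by simp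

subsection \<open>Digits\<close>

text \<open>Serves two purposes: tape contents in the base of the tape alphabet, where the zeros
  beyond the written part are blanks, and words in base \<open>d\<close>.\<close>

definition digit :: "nat \<Rightarrow> nat \<Rightarrow> nat \<Rightarrow> nat" where
  "digit b e i = e div b ^ i mod b"

lemma recursive_digit:
  assumes "recursive b" "recursive e" "recursive i"
  shows "recursive (\<lambda>x. digit (b x) (e x) (i x))"
  unfolding digit_def by (intro recursive_basic assms)

lemma digit_less: "0 < b \<Longrightarrow> digit b e i < b"
  by (simp add: digit_def)

lemma digit_0 [simp]: "digit b 0 i = 0"
  by (simp add: digit_def)

lemma digit_ge: "2 \<le> b \<Longrightarrow> e \<le> i \<Longrightarrow> digit b e i = 0"
proof -
  assume "2 \<le> b" "e \<le> i"
  then have "e < b ^ i"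
    using less_exp[of i] power_mono[of 2 b i] by linarith
  then show ?thesis by (simp add: digit_def)
qed

lemma digit_Suc: "digit b e (Suc i) = digit b (e div b) i"
  by (simp add: digit_def div_mult2_eq)

lemma digit_cons: "0 < b \<Longrightarrow> c < b \<Longrightarrow> digit b (c + b * e) j = (case j of 0 \<Rightarrow> c | Suc j' \<Rightarrow> digit b e j')"
  by (cases j) (simp_all add: digit_Suc, simp add: digit_def)

text \<open>Lets a bounded search over numbers run through all words of length \<open>n\<close>,
  also over an alphabet with one letter.\<close>

lemma digits_exist:
  assumes "0 < b" "\<And>j. c j < b"
  shows "\<exists>e < b ^ n. \<forall>j<n. digit b e j = c j"
  using assms(2)
proof (induction n arbitrary: c)
  case (Suc n)
  obtain e where e: "e < b ^ n" "\<forall>j<n. digit b e j = c (Suc j)"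
    using Suc.IH[of "\<lambda>j. c (Suc j)"] Suc.prems by blast
  have "c 0 + b * e < b * Suc e"
    using Suc.prems[of 0] by simp
  also have "\<dots> \<le> b * b ^ n"
    using e(1) by (intro mult_le_mono2) simp
  finally have "c 0 + b * e < b ^ Suc n"
    by simp
  moreover have "\<forall>j<Suc n. digit b (c 0 + b * e) j = c j"
    using e(2) Suc.prems[of 0] assms(1) by (auto simp: digit_cons split: nat.split)
  ultimately show ?case by blast
qed simp

text \<open>Addition comes before subtraction, so that the truncated difference is exact: the
  subtracted term is at most \<open>e\<close>.\<close>

definition set_digit :: "nat \<Rightarrow> nat \<Rightarrow> nat \<Rightarrow> nat \<Rightarrow> nat" where
  "set_digit b e i c = e + c * b ^ i - digit b e i * b ^ i"

lemma recursive_set_digit: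
  assumes "recursive b" "recursive e" "recursive i" "recursive c"
  shows "recursive (\<lambda>x. set_digit (b x) (e x) (i x) (c x))"
  unfolding set_digit_def by (intro recursive_basic recursive_digit assms)

lemma set_digit_Suc:
  assumes "0 < b"
  shows "set_digit b e (Suc i) c = e mod b + b * set_digit b (e div b) i c"
proof -
  have "digit b (e div b) i * b ^ i \<le> e div b"
    unfolding digit_def by (metis div_times_less_eq_dividend le_trans mod_less_eq_dividend mult_le_mono1)
  moreover have "e = e mod b + b * (e div b)"
    by simp
  ultimately show ?thesis
    unfolding set_digit_def digit_Suc power_Suc
    by (smt (verit) add.assoc diff_add_assoc diff_mult_distrib2 distrib_left le_add1 le_trans mult.left_commute mult_le_mono2)
qed

lemma digit_set_digit:
  assumes "0 < b" "c < b"
  shows "digit b (set_digit b e i c) j = (if j = i then c else digit b e j)"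
proof (induction i arbitrary: e j)
  case 0
  have "set_digit b e 0 c = c + b * (e div b)"
    unfolding set_digit_def digit_def by (simp add: minus_mod_eq_mult_div[symmetric] mult.commute)
  moreover have "digit b e j = digit b (e div b) (j - 1)" if "j \<noteq> 0"
    using that by (cases j) (simp_all add: digit_Suc)
  ultimately show ?case
    using assms by (simp add: digit_cons split: nat.split)
next
  case (Suc i)
  show ?case
    using assms Suc.IH by (auto simp: set_digit_Suc digit_cons digit_Suc split: nat.split) (simp add: digit_def)
qed

section \<open>Recursive simulation of oracle machines\<close>

definition move_num :: "move \<Rightarrow> nat" where
  "move_num mv = (case mv of Left \<Rightarrow> 0 | Stay \<Rightarrow> 1 | Right \<Rightarrow> 2)"

definition move_head_num :: "nat \<Rightarrow> nat \<Rightarrow> nat" where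
  "move_head_num m h = (if m = 0 then h - 1 else if m = 1 then h else Suc h)"

lemma move_head_num: "move_head_num (move_num mv) h = move_head mv h"
  by (cases mv) (simp_all add: move_head_num_def move_num_def)

definition unary_code :: "nat \<Rightarrow> nat \<Rightarrow> nat" where
  "unary_code b n = rec_nat (set_digit b 0 0 1) (\<lambda>i e. set_digit b e (Suc i) 2) n"

lemma recursive_unary_code:
  assumes "recursive f"
  shows "recursive (\<lambda>x. unary_code b (f x))"
  unfolding unary_code_def
  by (intro recursive_rec_nat[where h = "\<lambda>_ i e. set_digit b e (Suc i) 2"] recursive_set_digit
      recursive_basic assms)

lemma digit_unary_code:
  assumes "3 \<le> b"
  shows "digit b (unary_code b n) i = unary n i"
proof (induction n)
  case 0
  then show ?case
    using assms by (simp add: unary_code_def digit_set_digit unary_def)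
next
  case (Suc n)
  then show ?case
    using assms by (simp add: unary_code_def digit_set_digit) (auto simp: unary_def)
qed

definition unary_value_code :: "nat \<Rightarrow> nat \<Rightarrow> nat" where
  "unary_value_code b e = (LEAST k. digit b e (Suc k) \<noteq> 2)"

lemma recursive_unary_value_code:
  assumes "2 \<le> b" "recursive f"
  shows "recursive (\<lambda>x. unary_value_code b (f x))"
proof -
  have "\<exists>k. digit b e (Suc k) \<noteq> 2" for e
    using digit_ge[OF assms(1), of e "Suc e"] by (intro exI[of _ e]) simp
  then have "recursive (\<lambda>e. unary_value_code b e)"
    unfolding unary_value_code_def
    by (intro recursive_Least recursive_basic recursive_digit)
  then show ?thesis
    using assms(2) by (rule recursive_comp)
qed

definition rep_tape :: "nat \<Rightarrow> nat \<Rightarrow> tape \<Rightarrow> bool" where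
  "rep_tape b w = (\<lambda>(h, t). pi1 w = h \<and> (\<forall>i. digit b (pi2 w) i = t i))"

text \<open>
  A configuration is coded by its state, a bound for the queries made so far, and the list of its
  tapes. A tape is coded by its head position and by its contents as a number to the base
  \<open>num_symbols M\<close>.
\<close>

definition rep :: "tm \<Rightarrow> nat \<Rightarrow> config \<Rightarrow> bool" where
  "rep M z = (\<lambda>(q, ts). pi1 z = q \<and> q < num_states M \<and> length ts = num_tapes M \<and>
     (\<forall>i<num_tapes M. rep_tape (num_symbols M) (nth_code i (pi2 (pi2 z))) (ts ! i)))"

definition table_dom :: "tm \<Rightarrow> nat set" where
  "table_dom M = (\<lambda>(q, as). prod_encode (q, list_encode as)) `
     ({..<num_states M} \<times> {as. set as \<subseteq> {..<num_symbols M} \<and> length as = num_tapes M})"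

text \<open>Cutting the values off outside a finite domain turns an arbitrary transition function
  into a finite table, hence into a recursive function.\<close>

definition table :: "tm \<Rightarrow> nat \<Rightarrow> nat" where
  "table M x = (if x \<in> table_dom M then
     (let (q, as) = trans M (pi1 x) (list_decode (pi2 x))
      in prod_encode (q, list_encode (map (\<lambda>(s, mv). prod_encode (s, move_num mv)) as))) else 0)"

lemma recursive_table: "recursive f \<Longrightarrow> recursive (\<lambda>x. table M (f x))"
proof -
  have "finite (table_dom M)"
    unfolding table_dom_def by (intro finite_imageI finite_cartesian_product finite_lists_length_eq) auto
  then have "recursive (table M)"
    unfolding table_def[abs_def] by (rule recursive_finite_support)
  then show "recursive f \<Longrightarrow> recursive (\<lambda>x. table M (f x))"
    by (rule recursive_comp)
qed

definition is_query :: "tm \<Rightarrow> nat \<Rightarrow> bool" where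
  "is_query M q \<longleftrightarrow> (\<exists>r. query_states M = Some (q, r))"

definition answer_state :: "tm \<Rightarrow> nat" where
  "answer_state M = (case query_states M of None \<Rightarrow> 0 | Some (q, r) \<Rightarrow> r)"

lemma decidable_is_query: "recursive f \<Longrightarrow> decidable (\<lambda>x. is_query M (f x))"
proof -
  have "is_query M q \<longleftrightarrow> query_states M \<noteq> None \<and> q = fst (the (query_states M))" for q
    by (auto simp: is_query_def)
  then show "recursive f \<Longrightarrow> decidable (\<lambda>x. is_query M (f x))"
    by (simp only:) (intro recursive_basic)
qed

definition query_code :: "tm \<Rightarrow> nat \<Rightarrow> nat" where
  "query_code M z = unary_value_code (num_symbols M) (pi2 (nth_code 2 (pi2 (pi2 z))))"

text \<open>The \<open>Suc\<close> makes the recorded bound strict: all positions asked so far lie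
  below it.\<close>

definition query_step :: "tm \<Rightarrow> (nat \<Rightarrow> nat) \<Rightarrow> nat \<Rightarrow> nat" where
  "query_step M \<phi> z = prod_encode (answer_state M,
     prod_encode (max (pi1 (pi2 z)) (Suc (query_code M z)),
       list_encode (map (\<lambda>i. if i = 2 then prod_encode (0, unary_code (num_symbols M) (\<phi> (query_code M z)))
                            else nth_code i (pi2 (pi2 z))) [0..<num_tapes M])))"

definition scan_code :: "tm \<Rightarrow> nat \<Rightarrow> nat" where
  "scan_code M z = table M (prod_encode (pi1 z, list_encode
     (map (\<lambda>i. digit (num_symbols M) (pi2 (nth_code i (pi2 (pi2 z)))) (pi1 (nth_code i (pi2 (pi2 z)))))
        [0..<num_tapes M])))"

definition act_code :: "nat \<Rightarrow> nat \<Rightarrow> nat \<Rightarrow> nat" where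
  "act_code b a w = prod_encode (move_head_num (pi2 a) (pi1 w), set_digit b (pi2 w) (pi1 w) (pi1 a))"

definition ordinary_step_code :: "tm \<Rightarrow> nat \<Rightarrow> nat" where
  "ordinary_step_code M z = prod_encode (pi1 (scan_code M z), prod_encode (pi1 (pi2 z),
     list_encode (map (\<lambda>i. act_code (num_symbols M) (nth_code i (pi2 (scan_code M z))) (nth_code i (pi2 (pi2 z))))
       [0..<num_tapes M])))"

definition step_code :: "tm \<Rightarrow> (nat \<Rightarrow> nat) \<Rightarrow> nat \<Rightarrow> nat" where
  "step_code M \<phi> z = (if pi1 z = halt_state M then z
     else if is_query M (pi1 z) then query_step M \<phi> z else ordinary_step_code M z)"

lemma rep_tape_act:
  assumes "rep_tape b w (h, t)" "0 < b" "s < b"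
  shows "rep_tape b (act_code b (prod_encode (s, move_num mv)) w) (act (s, mv) (h, t))"
  using assms by (simp add: rep_tape_def act_code_def act_apply move_head_num digit_set_digit)

lemma rep_step:
  assumes M: "oracle_TM M" and z: "rep M z (q, ts)"
  shows "rep M (step_code M \<phi> z) (step M \<phi> (q, ts))"
proof -
  let ?b = "num_symbols M" and ?T = "num_tapes M" and ?z = "pi2 (pi2 z)"
  have b: "3 \<le> ?b" and T: "3 \<le> ?T"
    using M by (simp_all add: oracle_TM_def)
  have q: "pi1 z = q" "q < num_states M" "length ts = ?T"
    and tape: "\<And>i. i < ?T \<Longrightarrow> rep_tape ?b (nth_code i ?z) (ts ! i)"
    using z by (simp_all add: rep_def)
  have head: "pi1 (nth_code i ?z) = fst (ts ! i)" and dig: "digit ?b (pi2 (nth_code i ?z)) j = snd (ts ! i) j"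
    if "i < ?T" for i j
    using tape[OF that] by (simp_all add: rep_tape_def split: prod.splits)
  consider (halt) "q = halt_state M" | (query) r where "q \<noteq> halt_state M" "query_states M = Some (q, r)"
    | (ordinary) "q \<noteq> halt_state M" "\<not> is_query M q"
    by (auto simp: is_query_def)
  then show ?thesis
  proof cases
    case halt
    then show ?thesis using z q by (simp add: step_code_def step_def)
  next
    case query
    have v: "query_code M z = unary_value (snd (ts ! 2))"
      using T by (simp add: query_code_def unary_value_code_def unary_value_def dig)
    have "r < num_states M"
      using M query by (auto simp: oracle_TM_def)
    then show ?thesis
      using query q T b tape
      by (auto simp: step_code_def step_def is_query_def query_step_def rep_def answer_state_def v
          nth_code_list_encode rep_tape_def digit_unary_code nth_list_update)
  next
    case ordinary
    define as where "as = scan ts"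
    obtain q' acts where tr: "trans M q as = (q', acts)"
      by (cases "trans M q as")
    \<comment> \<open>The lookup stays inside the table, because digits to the base
      \<open>num_symbols M\<close> are symbols in range.\<close>
    have as: "length as = ?T" "set as \<subseteq> {..<?b}"
    proof -
      show "length as = ?T" by (simp add: as_def q)
      show "set as \<subseteq> {..<?b}"
      proof
        fix a assume "a \<in> set as"
        then obtain i where i: "i < ?T" "a = as ! i"
          using q(3) by (auto simp: as_def in_set_conv_nth)
        then have "a = digit ?b (pi2 (nth_code i ?z)) (fst (ts ! i))"
          using q(3) by (simp add: as_def scan_def dig split_beta)
        then show "a \<in> {..<?b}" using b by (simp add: digit_less)
      qed
    qed
    have "fst (trans M q as) < num_states M \<and> length (snd (trans M q as)) = ?T \<and>
        fst ` set (snd (trans M q as)) \<subseteq> {..<?b}"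
      using M q as unfolding oracle_TM_def by blast
    then have q': "q' < num_states M" and acts: "length acts = ?T" "fst ` set acts \<subseteq> {..<?b}"
      by (simp_all add: tr)
    have "map (\<lambda>i. digit ?b (pi2 (nth_code i ?z)) (pi1 (nth_code i ?z))) [0..<?T] = as"
      by (rule nth_equalityI) (use q(3) in \<open>auto simp: as_def scan_def dig head split_beta\<close>)
    moreover have "prod_encode (q, list_encode as) \<in> table_dom M"
      using as q(2) by (force simp: table_dom_def)
    ultimately have sc: "scan_code M z =
        prod_encode (q', list_encode (map (\<lambda>(s, mv). prod_encode (s, move_num mv)) acts))"
      by (simp add: scan_code_def table_def q(1) tr)
    have tapes: "rep_tape ?b (act_code ?b (nth_code i (pi2 (scan_code M z))) (nth_code i ?z)) (act (acts ! i) (ts ! i))"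
      if i: "i < ?T" for i
    proof -
      obtain s mv h t where eq: "acts ! i = (s, mv)" "ts ! i = (h, t)"
        by fastforce
      have "acts ! i \<in> set acts"
        using i acts by simp
      then have "s < ?b"
        using acts(2) eq by force
      then show ?thesis
        using rep_tape_act[of ?b "nth_code i ?z" h t s mv] tape[OF i] b i acts(1)
        by (simp add: sc nth_code_list_encode eq)
    qed
    have "step M \<phi> (q, ts) = (q', map2 act acts ts)"
      using ordinary
      by (auto simp: step_def ordinary_step_def is_query_def tr as_def[unfolded scan_def, symmetric]
          split: option.split)
    moreover have "step_code M \<phi> z = ordinary_step_code M z"
      using ordinary q by (simp add: step_code_def)
    ultimately show ?thesis
      using tapes q' q(3) acts(1)
      by (simp add: rep_def ordinary_step_code_def nth_code_list_encode) (simp add: sc)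
  qed
qed

definition init_code :: "tm \<Rightarrow> nat \<Rightarrow> nat" where
  "init_code M n = prod_encode (start_state M, prod_encode (0,
     list_encode (map (\<lambda>i. prod_encode (0, unary_code (num_symbols M) (if i = 0 then n else 0)))
       [0..<num_tapes M])))"

lemma rep_init:
  assumes "oracle_TM M"
  shows "rep M (init_code M n) (initial_config M n)"
  using assms
  by (auto simp: oracle_TM_def rep_def init_code_def initial_config_def rep_tape_def nth_code_list_encode
      digit_unary_code nth_Cons')

definition run_code :: "tm \<Rightarrow> (nat \<Rightarrow> nat) \<Rightarrow> nat \<Rightarrow> nat \<Rightarrow> nat" where
  "run_code M \<phi> n s = (step_code M \<phi> ^^ s) (init_code M n)"

lemma rep_run:
  assumes "oracle_TM M"
  shows "rep M (run_code M \<phi> n s) ((step M \<phi> ^^ s) (initial_config M n))"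
  unfolding run_code_def
proof (induction s)
  case 0
  show ?case using rep_init[OF assms] by simp
next
  case (Suc s)
  then show ?case
    using rep_step[OF assms] by (cases "(step M \<phi> ^^ s) (initial_config M n)") simp
qed

section \<open>Halting runs and their use of the oracle\<close>

definition halting :: "tm \<Rightarrow> (nat \<Rightarrow> nat) \<Rightarrow> nat \<Rightarrow> bool" where
  "halting M \<phi> n \<longleftrightarrow> (\<exists>s. pi1 (run_code M \<phi> n s) = halt_state M)"

definition final_code :: "tm \<Rightarrow> (nat \<Rightarrow> nat) \<Rightarrow> nat \<Rightarrow> nat" where
  "final_code M \<phi> n = run_code M \<phi> n (LEAST s. pi1 (run_code M \<phi> n s) = halt_state M)"

definition output_code :: "tm \<Rightarrow> (nat \<Rightarrow> nat) \<Rightarrow> nat \<Rightarrow> nat" where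
  "output_code M \<phi> n = unary_value_code (num_symbols M) (pi2 (nth_code 1 (pi2 (pi2 (final_code M \<phi> n)))))"

definition query_bound :: "tm \<Rightarrow> (nat \<Rightarrow> nat) \<Rightarrow> nat \<Rightarrow> nat" where
  "query_bound M \<phi> n = pi1 (pi2 (final_code M \<phi> n))"

lemma run_code_halted:
  assumes "pi1 (run_code M \<phi> n s) = halt_state M" "s \<le> s'"
  shows "run_code M \<phi> n s' = run_code M \<phi> n s"
  using assms(2)
  by (induction s' rule: dec_induct) (use assms(1) in \<open>simp_all add: run_code_def step_code_def\<close>)

text \<open>A halted configuration is repeated forever, so the output at any halting time is the
  output at the first one.\<close>

lemma outputs_imp_output_code:
  assumes "oracle_TM M" "outputs M \<phi> n c"
  shows "halting M \<phi> n" "output_code M \<phi> n = c"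
proof -
  obtain s ts where s: "(step M \<phi> ^^ s) (initial_config M n) = (halt_state M, ts)"
    and c: "c = unary_value (snd (ts ! 1))"
    using assms(2) by (auto simp: outputs_def)
  have r: "rep M (run_code M \<phi> n s) (halt_state M, ts)"
    using rep_run[OF assms(1), of \<phi> n s] by (simp add: s)
  then have h: "pi1 (run_code M \<phi> n s) = halt_state M"
    by (simp add: rep_def)
  then show "halting M \<phi> n"
    by (auto simp: halting_def)
  have "final_code M \<phi> n = run_code M \<phi> n s"
    unfolding final_code_def
    by (rule run_code_halted[symmetric])
       (use h LeastI[of "\<lambda>s. pi1 (run_code M \<phi> n s) = halt_state M"] Least_le in auto)
  moreover have "1 < num_tapes M"
    using assms(1) by (simp add: oracle_TM_def)
  moreover from this have "rep_tape (num_symbols M) (nth_code 1 (pi2 (pi2 (run_code M \<phi> n s)))) (ts ! 1)"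
    using r by (simp add: rep_def)
  ultimately show "output_code M \<phi> n = c"
    by (simp add: output_code_def rep_tape_def c unary_value_code_def unary_value_def split_beta)
qed

lemma query_bound_step_code: "pi1 (pi2 z) \<le> pi1 (pi2 (step_code M \<phi> z))"
  by (simp add: step_code_def query_step_def ordinary_step_code_def)

text \<open>The use principle: the recorded bound only grows along a run, so every answer given
  before the halt comes from a position below the final bound. Equality of the final codes includes
  equality of output and query bound.\<close>

lemma final_code_cong:
  assumes "halting M \<phi> n" and agree: "\<And>j. j < query_bound M \<phi> n \<Longrightarrow> \<phi>' j = \<phi> j"
  shows "halting M \<phi>' n" "final_code M \<phi>' n = final_code M \<phi> n"
proof -
  let ?H = "\<lambda>\<phi> s. pi1 (run_code M \<phi> n s) = halt_state M"
  define s0 where "s0 = (LEAST s. ?H \<phi> s)"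
  have H: "?H \<phi> s0"
    using assms(1) unfolding s0_def halting_def by (rule LeastI_ex)
  have mono: "pi1 (pi2 (run_code M \<phi> n s)) \<le> pi1 (pi2 (run_code M \<phi> n s'))" if "s \<le> s'" for s s'
    using that
    by (induction s' rule: dec_induct)
       (auto simp: run_code_def intro: order_trans query_bound_step_code)
  have eq: "run_code M \<phi>' n s = run_code M \<phi> n s" if "s \<le> s0" for s
    using that
  proof (induction s)
    case 0
    show ?case by (simp add: run_code_def)
  next
    case (Suc s)
    let ?z = "run_code M \<phi> n s"
    have suc: "run_code M \<phi> n (Suc s) = step_code M \<phi> ?z" "run_code M \<phi>' n (Suc s) = step_code M \<phi>' ?z"
      using Suc by (simp_all add: run_code_def)
    have "\<phi>' (query_code M ?z) = \<phi> (query_code M ?z)" if "is_query M (pi1 ?z)" "pi1 ?z \<noteq> halt_state M"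
    proof -
      have "Suc (query_code M ?z) \<le> pi1 (pi2 (run_code M \<phi> n (Suc s)))"
        using that by (simp add: suc step_code_def query_step_def)
      also have "\<dots> \<le> query_bound M \<phi> n"
        unfolding query_bound_def final_code_def s0_def[symmetric] by (rule mono[OF Suc.prems])
      finally show ?thesis by (intro agree) simp
    qed
    then show ?case
      by (auto simp: suc step_code_def query_step_def cong: if_cong)
  qed
  then have H': "?H \<phi>' s0"
    using H by simp
  then show "halting M \<phi>' n"
    by (auto simp: halting_def)
  have "(LEAST s. ?H \<phi>' s) = s0"
  proof (rule Least_equality)
    fix s assume s: "?H \<phi>' s"
    show "s0 \<le> s"
    proof (rule ccontr)
      assume "\<not> s0 \<le> s"
      then have "s < s0" "?H \<phi> s" using s eq[of s] by simp_all
      then show False unfolding s0_def using not_less_Least by blast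
    qed
  qed (rule H')
  then show "final_code M \<phi>' n = final_code M \<phi> n"
    by (simp add: final_code_def s0_def[symmetric] eq)
qed

text \<open>A whole family of oracles \<open>\<phi> e\<close>, indexed by numbers, is simulated
  uniformly. Halting is required for every index because the search for the halting time has to be
  total.\<close>

lemma recursive_final_code:
  assumes M: "oracle_TM M" and orc: "recursive (\<lambda>z. \<phi> (pi1 z) (pi2 z))"
    and halt: "\<And>e n. halting M (\<phi> e) n" and "recursive f" "recursive g"
  shows "recursive (\<lambda>x. final_code M (\<phi> (f x)) (g x))"
proof -
  have b: "2 \<le> num_symbols M"
    using M by (simp add: oracle_TM_def)
  have query: "recursive (\<lambda>x. query_code M (h x))" if "recursive h" for h
    unfolding query_code_def by (intro recursive_unary_value_code recursive_basic recursive_nth_code b that)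
  have scan: "recursive (\<lambda>x. scan_code M (h x))" if "recursive h" for h
    unfolding scan_code_def
    by (intro recursive_table recursive_tuple recursive_digit recursive_basic recursive_nth_code that)
  have st: "recursive (\<lambda>x. step_code M (\<phi> (e x)) (h x))" if "recursive e" "recursive h" for e h
    unfolding step_code_def query_step_def ordinary_step_code_def act_code_def move_head_num_def
    by (intro recursive_basic decidable_is_query recursive_tuple recursive_unary_code
        recursive_comp2[OF orc] query scan recursive_set_digit recursive_nth_code that)
  have init: "recursive (\<lambda>x. init_code M (h x))" if "recursive h" for h
    unfolding init_code_def by (intro recursive_basic recursive_tuple recursive_unary_code that)
  have run: "recursive (\<lambda>x. run_code M (\<phi> (e x)) (h x) (s x))" if "recursive e" "recursive h" "recursive s" for e h s
  proof -
    have "recursive (\<lambda>z. step_code M (\<phi> (e (pi1 z))) (pi2 z))"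
      by (intro st recursive_comp[OF that(1)] recursive_basic)
    from recursive_funpow[OF this that(3) init[OF that(2)]] show ?thesis
      unfolding run_code_def .
  qed
  have "recursive (\<lambda>x. LEAST s. pi1 (run_code M (\<phi> (f x)) (g x) s) = halt_state M)"
    by (rule recursive_Least)
       (intro recursive_basic run recursive_comp[OF assms(4)] recursive_comp[OF assms(5)],
        use halt in \<open>simp add: halting_def\<close>)
  then show ?thesis
    unfolding final_code_def by (intro run assms)
qed

lemma recursive_output_code:
  assumes "oracle_TM M" "recursive (\<lambda>z. \<phi> (pi1 z) (pi2 z))" "\<And>e n. halting M (\<phi> e) n"
    "recursive f" "recursive g"
  shows "recursive (\<lambda>x. output_code M (\<phi> (f x)) (g x))"
proof -
  have "2 \<le> num_symbols M"
    using assms(1) by (simp add: oracle_TM_def)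
  then show ?thesis
    unfolding output_code_def
    by (intro recursive_unary_value_code recursive_basic recursive_nth_code recursive_final_code assms)
qed

lemma recursive_query_bound:
  assumes "oracle_TM M" "recursive (\<lambda>z. \<phi> (pi1 z) (pi2 z))" "\<And>e n. halting M (\<phi> e) n"
    "recursive f" "recursive g"
  shows "recursive (\<lambda>x. query_bound M (\<phi> (f x)) (g x))"
  unfolding query_bound_def by (intro recursive_basic recursive_final_code assms)

section \<open>The space of a subshift\<close>

definition agree :: "nat \<Rightarrow> (nat \<Rightarrow> nat) \<Rightarrow> (nat \<Rightarrow> nat) \<Rightarrow> bool" where
  "agree n x y \<longleftrightarrow> (\<forall>j<n. x j = y j)"

lemma agree_refl [simp]: "agree n x x"
  by (simp add: agree_def)

lemma agree_sym: "agree n x y \<Longrightarrow> agree n y x"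
  by (simp add: agree_def)

lemma agree_trans: "agree n x y \<Longrightarrow> agree n y z \<Longrightarrow> agree n x z"
  by (simp add: agree_def)

text \<open>Counting the exponent from 1 makes the open ball of radius \<open>\<theta> ^ n\<close>
  exactly the cylinder of the points that agree in \<open>n\<close> letters.\<close>

lemma dist_theta_less:
  assumes "0 < \<theta>" "\<theta> < 1"
  shows "dist_theta \<theta> x y < \<theta> ^ n \<longleftrightarrow> agree n x y"
proof (cases "x = y")
  case False
  define k where "k = (LEAST k. x k \<noteq> y k)"
  have k: "x k \<noteq> y k"
  proof -
    obtain j where "x j \<noteq> y j" using False by blast
    then show ?thesis unfolding k_def by (rule LeastI)
  qed
  have less: "x j = y j" if "j < k" for j
    using that not_less_Least unfolding k_def by blast
  have "dist_theta \<theta> x y < \<theta> ^ n \<longleftrightarrow> n < Suc k"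
    using assms False by (simp add: dist_theta_def k_def power_strict_decreasing_iff del: power_Suc)
  also have "\<dots> \<longleftrightarrow> agree n x y"
    using k less by (meson agree_def less_Suc_eq_le less_le_trans not_le)
  finally show ?thesis .
qed (use assms in \<open>simp add: dist_theta_def\<close>)

lemma Metric_space_dist_theta:
  assumes "0 < \<theta>" "\<theta> < 1"
  shows "Metric_space X (dist_theta \<theta>)"
proof
  fix x y z :: "nat \<Rightarrow> nat"
  show nonneg: "0 \<le> dist_theta \<theta> x y" for x y
    using assms by (simp add: dist_theta_def)
  show "dist_theta \<theta> x y = dist_theta \<theta> y x"
    by (auto simp: dist_theta_def eq_commute)
  show "dist_theta \<theta> x y = 0 \<longleftrightarrow> x = y"
    using assms by (simp add: dist_theta_def)
  show "dist_theta \<theta> x z \<le> dist_theta \<theta> x y + dist_theta \<theta> y z"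
  proof (cases "x = z")
    case False
    \<comment> \<open>The distance is even an ultrametric: agreement in \<open>n\<close> letters is
      transitive, so one of the two distances on the right is at least
      \<open>\<theta> ^ n\<close>.\<close>
    define n where "n = Suc (LEAST k. x k \<noteq> z k)"
    have "dist_theta \<theta> x z = \<theta> ^ n"
      using False by (simp add: dist_theta_def n_def)
    moreover from this have "\<not> agree n x z"
      using dist_theta_less[OF assms, of x z n] by simp
    then have "\<not> agree n x y \<or> \<not> agree n y z"
      using agree_trans by blast
    ultimately show ?thesis
      using dist_theta_less[OF assms, of x y n] dist_theta_less[OF assms, of y z n] nonneg[of x y] nonneg[of y z]
      by linarith
  next
    case True
    then show ?thesis
      using nonneg[of x y] nonneg[of y z] by (simp add: dist_theta_def)
  qed
qed

text \<open>Describes the product topology by initial segments, the form in which it can be compared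
  with the metric.\<close>

lemma open_iff_agree: "open U \<longleftrightarrow> (\<forall>x\<in>U. \<exists>n. \<forall>y. agree n y x \<longrightarrow> y \<in> U)"
  for U :: "(nat \<Rightarrow> nat) set"
proof
  assume U: "open U"
  show "\<forall>x\<in>U. \<exists>n. \<forall>y. agree n y x \<longrightarrow> y \<in> U"
  proof
    fix x assume "x \<in> U"
    from product_topology_open_contains_basis[OF U[unfolded open_fun_def] this]
    obtain V where V: "x \<in> (\<Pi>\<^sub>E i\<in>UNIV. V i)" "finite {i. V i \<noteq> (UNIV :: nat set)}" "(\<Pi>\<^sub>E i\<in>UNIV. V i) \<subseteq> U"
      unfolding topspace_euclidean by blast
    obtain n where n: "{i. V i \<noteq> UNIV} \<subseteq> {..<n}"
      using V(2) finite_nat_iff_bounded by blast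
    have "y \<in> U" if "agree n y x" for y
    proof -
      have "y i \<in> V i" for i
        using V(1) n that by (cases "V i = UNIV") (auto simp: agree_def PiE_def Pi_def)
      then show ?thesis using V(3) by auto
    qed
    then show "\<exists>n. \<forall>y. agree n y x \<longrightarrow> y \<in> U" by blast
  qed
next
  assume R: "\<forall>x\<in>U. \<exists>n. \<forall>y. agree n y x \<longrightarrow> y \<in> U"
  have cyl: "open {y. agree n y x}" for n and x :: "nat \<Rightarrow> nat"
  proof -
    have "open ((\<lambda>y :: nat \<Rightarrow> nat. y j) -` {x j})" for j
      by (rule open_vimage[OF open_discrete continuous_on_product_coordinates])
    moreover have "{y. agree n y x} = (\<Inter>j\<in>{..<n}. (\<lambda>y. y j) -` {x j})"
      by (auto simp: agree_def)
    ultimately show ?thesis by (simp add: open_INT)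
  qed
  have sub: "\<exists>T. open T \<and> x \<in> T \<and> T \<subseteq> U" if xU: "x \<in> U" for x
  proof -
    obtain n where "\<forall>y. agree n y x \<longrightarrow> y \<in> U" using bspec[OF R xU] ..
    then have "{y. agree n y x} \<subseteq> U" by blast
    with cyl[of n x] agree_refl show ?thesis by blast
  qed
  show "open U" by (subst open_subopen) (use sub in blast)
qed

lemma open_agree: "open {y. agree n y x}"
  unfolding open_iff_agree by (auto intro: agree_trans)

text \<open>Replaces the metric by the subspace topology of the product, where compactness is
  Tychonoff's theorem and continuity can be checked by coordinates.\<close>

lemma sft_top_eq:
  assumes "0 < \<theta>" "\<theta> < 1"
  shows "sft_top \<theta> d A = top_of_set (sft d A)"
proof (rule topology_eq[THEN iffD2], intro allI)
  fix U
  let ?X = "sft d A"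
  interpret Metric_space ?X "dist_theta \<theta>"
    using assms by (rule Metric_space_dist_theta)
  have "openin mtopology U \<longleftrightarrow> U \<subseteq> ?X \<and> (\<forall>x\<in>U. \<exists>n. \<forall>y\<in>?X. agree n y x \<longrightarrow> y \<in> U)"
  proof -
    have "(\<exists>r>0. mball x r \<subseteq> U) \<longleftrightarrow> (\<exists>n. \<forall>y\<in>?X. agree n y x \<longrightarrow> y \<in> U)" if "x \<in> ?X" for x
    proof
      assume "\<exists>r>0. mball x r \<subseteq> U"
      then obtain r where r: "r > 0" "mball x r \<subseteq> U" by blast
      obtain n where n: "\<theta> ^ n < r"
        using real_arch_pow_inv[OF r(1) assms(2)] by blast
      have "y \<in> U" if "y \<in> ?X" "agree n y x" for y
        using r(2) n that \<open>x \<in> ?X\<close> dist_theta_less[OF assms, of x y n] agree_sym[OF that(2)]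
        by (auto simp: mball_def)
      then show "\<exists>n. \<forall>y\<in>?X. agree n y x \<longrightarrow> y \<in> U" by blast
    next
      assume "\<exists>n. \<forall>y\<in>?X. agree n y x \<longrightarrow> y \<in> U"
      then obtain n where "\<forall>y\<in>?X. agree n y x \<longrightarrow> y \<in> U" by blast
      then show "\<exists>r>0. mball x r \<subseteq> U"
        using assms dist_theta_less[OF assms, of x _ n] agree_sym
        by (intro exI[of _ "\<theta> ^ n"]) (auto simp: mball_def)
    qed
    then show ?thesis
      unfolding openin_mtopology by blast
  qed
  also have "\<dots> \<longleftrightarrow> openin (top_of_set ?X) U"
  proof
    assume R: "U \<subseteq> ?X \<and> (\<forall>x\<in>U. \<exists>n. \<forall>y\<in>?X. agree n y x \<longrightarrow> y \<in> U)"
    show "openin (top_of_set ?X) U"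
      unfolding openin_open
    proof (intro exI conjI)
      show "open {y. \<exists>x\<in>U. \<exists>n. (\<forall>y\<in>?X. agree n y x \<longrightarrow> y \<in> U) \<and> agree n y x}"
        unfolding open_iff_agree
      proof
        fix z assume "z \<in> {y. \<exists>x\<in>U. \<exists>n. (\<forall>y\<in>?X. agree n y x \<longrightarrow> y \<in> U) \<and> agree n y x}"
        then obtain x n where x: "x \<in> U" "\<forall>y\<in>?X. agree n y x \<longrightarrow> y \<in> U" "agree n z x"
          by blast
        then show "\<exists>m. \<forall>y. agree m y z \<longrightarrow>
            y \<in> {y. \<exists>x\<in>U. \<exists>n. (\<forall>y\<in>?X. agree n y x \<longrightarrow> y \<in> U) \<and> agree n y x}"
          using agree_trans[OF _ x(3)] by (intro exI[of _ n]) blast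
      qed
      show "U = ?X \<inter> {y. \<exists>x\<in>U. \<exists>n. (\<forall>y\<in>?X. agree n y x \<longrightarrow> y \<in> U) \<and> agree n y x}"
        using R agree_refl by blast
    qed
  next
    assume "openin (top_of_set ?X) U"
    then obtain T where "open T" "U = ?X \<inter> T"
      by (auto simp: openin_open)
    then show "U \<subseteq> ?X \<and> (\<forall>x\<in>U. \<exists>n. \<forall>y\<in>?X. agree n y x \<longrightarrow> y \<in> U)"
      unfolding open_iff_agree by blast
  qed
  finally show "openin (sft_top \<theta> d A) U \<longleftrightarrow> openin (top_of_set ?X) U"
    by (simp add: sft_top_def)
qed

lemma compact_sft: "compact (sft d A)"
proof -
  have "compactin (product_topology (\<lambda>_. euclidean) UNIV) (\<Pi>\<^sub>E i\<in>(UNIV :: nat set). {..<d})"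
    unfolding compactin_PiE by (simp add: finite_imp_compact)
  then have "compact (\<Pi>\<^sub>E i\<in>(UNIV :: nat set). {..<d})"
    by (simp add: euclidean_product_topology)
  moreover have "closed (sft d A)"
    unfolding closed_def open_iff_agree
  proof
    fix x assume "x \<in> - sft d A"
    then obtain k where k: "\<not> x k < d \<or> A (x k) (x (Suc k)) \<noteq> 1"
      by (auto simp: sft_def)
    have "y \<in> - sft d A" if "agree (Suc (Suc k)) y x" for y
    proof -
      have "y k = x k" "y (Suc k) = x (Suc k)"
        using that by (simp_all add: agree_def)
      with k have "\<not> y k < d \<or> A (y k) (y (Suc k)) \<noteq> 1" by simp
      then show ?thesis by (auto simp: sft_def)
    qed
    then show "\<exists>n. \<forall>y. agree n y x \<longrightarrow> y \<in> - sft d A" by blast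
  qed
  moreover have "sft d A \<subseteq> (\<Pi>\<^sub>E i\<in>UNIV. {..<d})"
    by (auto simp: sft_def)
  ultimately show ?thesis
    by (metis compact_Int_closed inf.absorb_iff2)
qed

lemma continuous_on_locally_constant:
  assumes "\<And>x y. x \<in> X \<Longrightarrow> y \<in> X \<Longrightarrow> agree n x y \<Longrightarrow> F x = F y"
  shows "continuous_on X F"
  unfolding continuous_on_topological
proof (intro ballI allI impI)
  fix x B assume x: "x \<in> X" "open B" "F x \<in> B"
  have "F y \<in> B" if "y \<in> X" "agree n y x" for y
    using assms[OF that(1) x(1) that(2)] x(3) by simp
  then show "\<exists>T. open T \<and> x \<in> T \<and> (\<forall>y\<in>X. y \<in> T \<longrightarrow> F y \<in> B)"
    using open_agree[of n x] by (intro exI[of _ "{y. agree n y x}"]) simp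
qed

lemma shift_in_sft: "x \<in> sft d A \<Longrightarrow> shift x \<in> sft d A"
  by (simp add: sft_def shift_def)

lemma funpow_shift: "(shift ^^ n) x = (\<lambda>k. x (k + n))"
  by (induction n arbitrary: x) (simp_all add: shift_def fun_eq_iff)

lemma funpow_shift_in_sft: "x \<in> sft d A \<Longrightarrow> (shift ^^ n) x \<in> sft d A"
  by (simp add: sft_def funpow_shift)

lemma continuous_on_shift: "continuous_on S shift"
  unfolding shift_def[abs_def]
  by (intro continuous_on_coordinatewise_then_product continuous_on_product_coordinates
      continuous_on_subset[OF _ subset_UNIV])

lemma continuous_on_compose_shift:
  "continuous_on (sft d A) F \<Longrightarrow> continuous_on (sft d A) (\<lambda>x. F (shift x))"
  by (rule continuous_on_compose2[OF _ continuous_on_shift]) (auto intro: shift_in_sft)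

lemma continuous_on_compose_funpow_shift:
  "continuous_on (sft d A) F \<Longrightarrow> continuous_on (sft d A) (\<lambda>x. F ((shift ^^ n) x))"
proof (induction n)
  case (Suc n)
  then show ?case
    using continuous_on_compose_shift[of d A "\<lambda>x. F ((shift ^^ n) x)"] by (simp add: funpow_swap1)
qed simp

section \<open>Cylinder sets\<close>

definition cyl :: "nat \<Rightarrow> (nat \<Rightarrow> nat \<Rightarrow> nat) \<Rightarrow> nat list \<Rightarrow> (nat \<Rightarrow> nat) set" where
  "cyl d A l = {y \<in> sft d A. \<forall>j<length l. y j = l ! j}"

lemma openin_cyl: "openin (top_of_set (sft d A)) (cyl d A l)"
proof -
  have "cyl d A l = sft d A \<inter> {y. agree (length l) y (\<lambda>j. l ! j)}"
    by (auto simp: cyl_def agree_def)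
  then show ?thesis using open_agree openin_open by blast
qed

lemma Int_stable_cyl: "Int_stable (range (cyl d A))"
proof -
  have le: "cyl d A l \<inter> cyl d A l' \<in> range (cyl d A)" if len: "length l \<le> length l'" for l l'
  proof (cases "take (length l) l' = l")
    case True
    then have "l' ! j = l ! j" if "j < length l" for j
      using that by (metis nth_take)
    with len have "cyl d A l \<inter> cyl d A l' = cyl d A l'"
      by (auto simp: cyl_def)
    then show ?thesis by simp
  next
    case False
    have "\<exists>j<length l. l ! j \<noteq> l' ! j"
    proof (rule ccontr)
      assume "\<not> (\<exists>j<length l. l ! j \<noteq> l' ! j)"
      then have "take (length l) l' = l"
        by (intro nth_equalityI) (use len in auto)
      with False show False ..
    qed
    \<comment> \<open>The letter \<open>d\<close> is outside the alphabet, so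
      \<open>cyl d A [d]\<close> presents the empty set as a cylinder.\<close>
    then have "cyl d A l \<inter> cyl d A l' = cyl d A [d]"
      using len by (auto simp: cyl_def sft_def)
    then show ?thesis by simp
  qed
  have "cyl d A l \<inter> cyl d A l' \<in> range (cyl d A)" for l l'
    using le[of l l'] le[of l' l] by (cases "length l \<le> length l'") (simp_all add: Int_commute)
  then show ?thesis
    unfolding Int_stable_def by blast
qed

text \<open>There are only countably many finite words, so an open set is a countable union of
  cylinders.\<close>

lemma sigma_sets_cyl:
  "sigma_sets (sft d A) {U. openin (top_of_set (sft d A)) U} = sigma_sets (sft d A) (range (cyl d A))"
proof (rule sigma_sets_eqI)
  fix U assume "U \<in> {U. openin (top_of_set (sft d A)) U}"
  then obtain T where T: "open T" "U = sft d A \<inter> T"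
    by (auto simp: openin_open)
  have "U = (\<Union>l\<in>{l. cyl d A l \<subseteq> U}. cyl d A l)"
  proof
    show "U \<subseteq> (\<Union>l\<in>{l. cyl d A l \<subseteq> U}. cyl d A l)"
    proof
      fix x assume x: "x \<in> U"
      then obtain n where n: "\<forall>y. agree n y x \<longrightarrow> y \<in> T"
        using T unfolding open_iff_agree by blast
      then have "cyl d A (map x [0..<n]) \<subseteq> U" "x \<in> cyl d A (map x [0..<n])"
        using T x by (auto simp: cyl_def agree_def)
      then show "x \<in> (\<Union>l\<in>{l. cyl d A l \<subseteq> U}. cyl d A l)" by blast
    qed
  qed blast
  moreover have "(\<Union>l\<in>{l. cyl d A l \<subseteq> U}. cyl d A l) \<in> sigma_sets (sft d A) (range (cyl d A))"
    by (rule sigma_sets_UNION) (auto intro: countable_subset)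
  ultimately show "U \<in> sigma_sets (sft d A) (range (cyl d A))" by simp
qed (auto intro: openin_cyl)

section \<open>Invariant measures\<close>

locale subshift =
  fixes \<theta> :: real and d :: nat and A :: "nat \<Rightarrow> nat \<Rightarrow> nat"
  assumes theta: "0 < \<theta>" "\<theta> < 1"
begin

abbreviation "X \<equiv> sft d A"
abbreviation "opens \<equiv> {U. openin (top_of_set X) U}"
abbreviation "XM \<equiv> sigma X opens"

lemma opens_subset: "opens \<subseteq> Pow X"
  by (auto dest: openin_imp_subset)

lemma space_XM: "space XM = X"
  using opens_subset by (rule space_measure_of)

lemma sets_XM: "sets XM = sigma_sets X opens"
  using opens_subset by (rule sets_measure_of)

lemma invariant_measures_iff:
  "\<mu> \<in> invariant_measures \<theta> d A \<longleftrightarrow> prob_space \<mu> \<and> sets \<mu> = sets XM \<and>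
     (\<forall>B\<in>sets XM. emeasure \<mu> (shift -` B \<inter> X) = emeasure \<mu> B)"
proof -
  have "space \<mu> = X" if "sets \<mu> = sets XM"
    using sets_eq_imp_space_eq[OF that] space_XM by simp
  then show ?thesis
    by (auto simp: invariant_measures_def sft_top_eq[OF theta] sets_XM)
qed

lemma measurable_continuous:
  assumes "sets \<mu> = sets XM" "continuous_on X F"
  shows "F \<in> borel_measurable \<mu>"
proof (rule borel_measurableI)
  fix S :: "'a set" assume "open S"
  with assms(2) have "X \<inter> F -` S \<in> opens"
    using continuous_openin_preimage_gen by blast
  then show "F -` S \<inter> space \<mu> \<in> sets \<mu>"
    using sets_eq_imp_space_eq[OF assms(1)] by (auto simp: assms(1) sets_XM space_XM Int_commute)
qed

lemma measurable_into_XM: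
  assumes "f \<in> space M \<rightarrow> X" "\<And>T. open T \<Longrightarrow> f -` T \<inter> space M \<in> sets M"
  shows "f \<in> M \<rightarrow>\<^sub>M XM"
proof (rule measurable_measure_of[OF opens_subset assms(1)])
  fix U assume "U \<in> opens"
  then obtain T where "open T" "U = X \<inter> T"
    by (auto simp: openin_open)
  moreover from this have "f -` U \<inter> space M = f -` T \<inter> space M"
    using assms(1) by auto
  ultimately show "f -` U \<inter> space M \<in> sets M"
    using assms(2) by simp
qed

lemma measurable_shift: "shift \<in> XM \<rightarrow>\<^sub>M XM"
proof (rule measurable_into_XM)
  fix T :: "(nat \<Rightarrow> nat) set" assume "open T"
  then have "X \<inter> shift -` T \<in> opens"
    using continuous_openin_preimage_gen[OF continuous_on_shift] by blast
  then show "shift -` T \<inter> space XM \<in> sets XM"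
    by (auto simp: sets_XM space_XM Int_commute)
qed (auto simp: space_XM shift_in_sft)

lemma invariant_distr:
  assumes "\<mu> \<in> invariant_measures \<theta> d A"
  shows "distr \<mu> XM shift = \<mu>"
proof (rule measure_eqI)
  have s: "sets \<mu> = sets XM" and sp: "space \<mu> = X"
    using assms sets_eq_imp_space_eq[of \<mu> XM] by (auto simp: invariant_measures_iff space_XM)
  show "sets (distr \<mu> XM shift) = sets \<mu>"
    by (simp add: s)
  fix B assume "B \<in> sets (distr \<mu> XM shift)"
  then show "emeasure (distr \<mu> XM shift) B = emeasure \<mu> B"
    using assms measurable_shift
    by (simp add: emeasure_distr sp measurable_cong_sets[OF s refl] invariant_measures_iff)
qed

lemma integral_shift:
  fixes F :: "_ \<Rightarrow> real"
  assumes "\<mu> \<in> invariant_measures \<theta> d A" "continuous_on X F"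
  shows "(\<integral>x. F (shift x) \<partial>\<mu>) = (\<integral>x. F x \<partial>\<mu>)"
proof -
  have s: "sets \<mu> = sets XM"
    using assms(1) by (simp add: invariant_measures_iff)
  have "(\<integral>x. F x \<partial>distr \<mu> XM shift) = (\<integral>x. F (shift x) \<partial>\<mu>)"
    using measurable_shift measurable_continuous[OF refl assms(2)]
    by (intro integral_distr) (simp_all add: measurable_cong_sets[OF s refl])
  then show ?thesis
    by (simp add: invariant_distr[OF assms(1)])
qed

lemma integral_funpow_shift:
  fixes F :: "_ \<Rightarrow> real"
  assumes "\<mu> \<in> invariant_measures \<theta> d A" "continuous_on X F"
  shows "(\<integral>x. F ((shift ^^ n) x) \<partial>\<mu>) = (\<integral>x. F x \<partial>\<mu>)"
proof (induction n)
  case (Suc n)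
  then show ?case
    using integral_shift[OF assms(1) continuous_on_compose_funpow_shift[OF assms(2)], of n]
    by (simp add: funpow_swap1)
qed simp

lemma bounded_continuous:
  fixes F :: "_ \<Rightarrow> 'b::real_normed_vector"
  assumes "continuous_on X F"
  obtains B where "\<And>x. x \<in> X \<Longrightarrow> norm (F x) \<le> B" "B > 0"
  using compact_imp_bounded[OF compact_continuous_image[OF assms compact_sft]]
  by (auto simp: bounded_pos)

lemma integrable_continuous:
  fixes F :: "_ \<Rightarrow> real"
  assumes "prob_space \<mu>" "sets \<mu> = sets XM" "continuous_on X F"
  shows "integrable \<mu> F"
proof -
  interpret prob_space \<mu> by fact
  obtain B where "\<And>x. x \<in> X \<Longrightarrow> norm (F x) \<le> B"
    using bounded_continuous[OF assms(3)] by blast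
  then show ?thesis
    using sets_eq_imp_space_eq[OF assms(2)]
    by (intro integrable_const_bound[of _ B] AE_I2 measurable_continuous assms) (simp add: space_XM)
qed

end

subsection \<open>Weak compactness\<close>

definition kappa :: "nat \<Rightarrow> (nat \<Rightarrow> nat) \<Rightarrow> real" where
  "kappa d x = (\<Sum>k. real (x k) * (1 / (real d + 1)) ^ Suc k)"

text \<open>
  In base \<open>d + 1\<close> the largest digit does not occur in points of the subshift, so expansions are
  unique and \<open>kappa d\<close> embeds the subshift into the reals.
\<close>

lemma kappa_aux:
  assumes "x \<in> sft d A"
  shows "summable (\<lambda>k. real (x k) * (1 / (real d + 1)) ^ Suc k)" (is "summable ?f")
    and "0 \<le> kappa d x" and "kappa d x < 1"
proof -
  let ?q = "1 / (real d + 1)"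
  have d: "0 < d" and x: "x k \<le> d - 1" for k
    using assms by (auto simp: sft_def dest: spec[of _ k])
  have q: "0 < ?q" "?q < 1"
    using d by simp_all
  have le: "?f k \<le> (real d - 1) * ?q * ?q ^ k" for k
    using x[of k] d by (auto intro!: divide_right_mono simp: of_nat_diff)
  have sums: "(\<lambda>k. (real d - 1) * ?q * ?q ^ k) sums ((real d - 1) * ?q * (1 / (1 - ?q)))"
    using q by (intro sums_mult geometric_sums) simp
  have nonneg: "0 \<le> ?f k" for k by simp
  show summable: "summable ?f"
    using nonneg le by (intro summable_comparison_test'[OF sums_summable[OF sums], of 0]) (metis real_norm_def abs_of_nonneg)
  show "0 \<le> kappa d x"
    unfolding kappa_def by (rule suminf_nonneg[OF summable nonneg])
  have "kappa d x \<le> (real d - 1) * ?q * (1 / (1 - ?q))"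
    unfolding kappa_def using suminf_le[OF le summable sums_summable[OF sums]] sums_unique[OF sums] by simp
  also have "1 - ?q = real d * ?q"
    using d by (simp add: field_simps)
  also have "(real d - 1) * ?q * (1 / (real d * ?q)) = (real d - 1) / real d"
    by simp
  also have "\<dots> < 1" using d by simp
  finally show "kappa d x < 1" .
qed

lemma kappa_shift:
  assumes "x \<in> sft d A"
  shows "kappa d (shift x) = (real d + 1) * kappa d x - real (x 0)"
proof -
  let ?f = "\<lambda>x k. real (x k) * (1 / (real d + 1)) ^ Suc k"
  have "(\<Sum>k. ?f x (Suc k)) = kappa d x - ?f x 0"
    unfolding kappa_def by (rule suminf_split_head[OF kappa_aux(1)[OF assms]])
  moreover have "?f x (Suc k) = 1 / (real d + 1) * ?f (shift x) k" for k
    by (simp add: shift_def)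
  then have "(\<Sum>k. ?f x (Suc k)) = 1 / (real d + 1) * kappa d (shift x)"
    unfolding kappa_def using suminf_mult[OF kappa_aux(1)[OF shift_in_sft[OF assms]], of "1 / (real d + 1)"] by simp
  ultimately show ?thesis
    by (simp add: field_simps)
qed

lemma inj_on_kappa: "inj_on (kappa d) (sft d A)"
proof (rule inj_onI)
  have head: "x 0 = y 0" if "x \<in> sft d A" "y \<in> sft d A" "kappa d x = kappa d y" for x y
  proof -
    have "\<lfloor>(real d + 1) * kappa d z\<rfloor> = int (z 0)" if "z \<in> sft d A" for z
      using kappa_shift[OF that] kappa_aux(2,3)[OF shift_in_sft[OF that]]
      by (intro floor_unique) simp_all
    from this[OF that(1)] this[OF that(2)] that(3) show ?thesis by simp
  qed
  fix x y assume xy: "x \<in> sft d A" "y \<in> sft d A" "kappa d x = kappa d y"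
  from xy have "x k = y k" for k
  proof (induction k arbitrary: x y)
    case (Suc k)
    have "kappa d (shift x) = kappa d (shift y)"
      unfolding kappa_shift[OF Suc.prems(1)] kappa_shift[OF Suc.prems(2)]
      using head[OF Suc.prems] Suc.prems(3) by simp
    then have "shift x k = shift y k"
      using Suc.IH shift_in_sft Suc.prems(1,2) by blast
    then show ?case by (simp add: shift_def)
  qed (rule head)
  then show "x = y" by blast
qed

lemma continuous_on_kappa: "continuous_on (sft d A) (kappa d)"
proof (cases "d = 0")
  case True
  then show ?thesis by (simp add: sft_def)
next
  case False
  let ?q = "1 / (real d + 1)"
  have "uniform_limit (sft d A) (\<lambda>n x. \<Sum>k<n. real (x k) * ?q ^ Suc k) (\<lambda>x. \<Sum>k. real (x k) * ?q ^ Suc k) sequentially"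
  proof (rule Weierstrass_m_test)
    show "norm (real (x k) * ?q ^ Suc k) \<le> real d * ?q ^ Suc k" if "x \<in> sft d A" for x k
      using that less_imp_le[of "x k" d] by (auto simp: sft_def intro!: divide_right_mono)
    show "summable (\<lambda>k. real d * ?q ^ Suc k)"
      using False by (intro summable_mult summable_Suc_iff[THEN iffD2] summable_geometric) simp
  qed
  then show ?thesis
    unfolding kappa_def
  proof (rule uniform_limit_theorem[rotated])
    have "continuous_on (sft d A) (\<lambda>x. \<Sum>k<n. real (x k) * ?q ^ Suc k)" for n
      by (rule continuous_on_locally_constant[of _ n]) (simp add: agree_def)
    then show "\<forall>\<^sub>F n in sequentially. continuous_on (sft d A) (\<lambda>x. \<Sum>k<n. real (x k) * ?q ^ Suc k)"
      by simp
  qed simp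
qed

context subshift
begin

lemma cyl_in_sets: "cyl d A l \<in> sets XM"
  by (simp add: sets_XM openin_cyl sigma_sets.Basic)

lemma measure_eqI_cyl:
  assumes "prob_space M" "sets M = sets XM" "sets N = sets XM"
    "\<And>l. emeasure M (cyl d A l) = emeasure N (cyl d A l)"
  shows "M = N"
proof (rule measure_eqI_generator_eq[OF Int_stable_cyl])
  show "range (cyl d A) \<subseteq> Pow X"
    by (auto simp: cyl_def)
  show "sets M = sigma_sets X (range (cyl d A))" "sets N = sigma_sets X (range (cyl d A))"
    using assms by (simp_all add: sets_XM sigma_sets_cyl)
  have "cyl d A [] = X"
    by (simp add: cyl_def)
  then show "range (\<lambda>_ :: nat. X) \<subseteq> range (cyl d A)"
    by blast
  show "emeasure M X \<noteq> \<infinity>"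
    using prob_space.emeasure_space_1[OF assms(1)] sets_eq_imp_space_eq[OF assms(2)] by (simp add: space_XM)
qed (use assms(4) in auto)

text \<open>
  The invariant measures are transported to the reals by \<^const>\<open>kappa\<close>, where Helly's selection
  theorem applies. The limit lives on the compact image of the subshift and is transported back.
\<close>

lemma invariant_measures_subsequence:
  fixes \<mu> :: "nat \<Rightarrow> (nat \<Rightarrow> nat) measure"
  assumes "\<And>n. \<mu> n \<in> invariant_measures \<theta> d A"
  obtains r \<nu> where "strict_mono r" "\<nu> \<in> invariant_measures \<theta> d A"
    "\<And>F :: _ \<Rightarrow> real. continuous_on X F \<Longrightarrow> (\<lambda>n. \<integral>x. F x \<partial>\<mu> (r n)) \<longlonglongrightarrow> (\<integral>x. F x \<partial>\<nu>)"
proof -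
  have pr: "prob_space (\<mu> n)" and sets: "sets (\<mu> n) = sets XM" and sp: "space (\<mu> n) = X" for n
    using assms[of n] sets_eq_imp_space_eq[of "\<mu> n" XM] by (auto simp: invariant_measures_iff space_XM)
  have ne: "X \<noteq> {}"
    using prob_space.not_empty[OF pr] sp by metis
  then obtain x0 where x0: "x0 \<in> X" by blast
  define K where "K = kappa d ` X"
  \<comment> \<open>Off \<open>K\<close> the inverse takes a fixed point of the subshift as default,
    so that \<open>g\<close> maps into \<open>X\<close> everywhere; by \<open>AE_K\<close> the limit
    measure lives on \<open>K\<close>.\<close>
  define g where "g t = (if t \<in> K then the_inv_into X (kappa d) t else x0)" for t
  have compact_K: "compact K"
    unfolding K_def by (intro compact_continuous_image continuous_on_kappa compact_sft)
  then have closed_K: "closed K" by (rule compact_imp_closed)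
  have g_kappa: "g (kappa d x) = x" if "x \<in> X" for x
    using that by (simp add: g_def K_def the_inv_into_f_f inj_on_kappa)
  have g_X: "g t \<in> X" for t
    using g_kappa x0 by (cases "t \<in> K") (auto simp: g_def K_def the_inv_into_f_f inj_on_kappa)
  have cont_g: "continuous_on K g"
    unfolding K_def by (rule continuous_on_inv[OF continuous_on_kappa compact_sft]) (simp add: g_kappa)
  have meas_kappa: "kappa d \<in> borel_measurable (\<mu> n)" for n
    by (rule measurable_continuous[OF sets continuous_on_kappa])
  define \<nu> where "\<nu> n = distr (\<mu> n) borel (kappa d)" for n
  have distr_\<nu>: "real_distribution (\<nu> n)" for n
    unfolding \<nu>_def by (rule prob_space.real_distribution_distr[OF pr meas_kappa])
  have int_\<nu>: "(\<integral>t. h t \<partial>\<nu> n) = (\<integral>x. h (kappa d x) \<partial>\<mu> n)" if "h \<in> borel_measurable borel" for h :: "real \<Rightarrow> real" and n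
    unfolding \<nu>_def by (rule integral_distr[OF meas_kappa that])
  have "tight \<nu>"
    unfolding tight_def
  proof (intro conjI allI impI)
    fix e :: real assume "0 < e"
    have "measure (\<nu> n) {-1<..1} = 1" for n
    proof -
      have "kappa d -` {-1<..1} \<inter> space (\<mu> n) = space (\<mu> n)"
        using kappa_aux(2,3) less_imp_le by (fastforce simp: sp)
      then show ?thesis
        unfolding \<nu>_def using meas_kappa prob_space.prob_space[OF pr] by (simp add: measure_distr)
    qed
    then show "\<exists>a b. a < b \<and> (\<forall>n. 1 - e < measure (\<nu> n) {a<..b})"
      using \<open>0 < e\<close> by (intro exI[of _ "-1"] exI[of _ 1]) simp
  qed (rule distr_\<nu>)
  from tight_imp_convergent_subsubsequence[OF this strict_mono_id]
  obtain r N where r: "strict_mono r" and N: "real_distribution N" and conv: "weak_conv_m (\<lambda>n. \<nu> (r n)) N"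
    by (auto simp: comp_def id_def)
  interpret N: real_distribution N by fact
  have lim: "(\<lambda>n. \<integral>t. h t \<partial>\<nu> (r n)) \<longlonglongrightarrow> (\<integral>t. h t \<partial>N)"
    if "continuous_on UNIV h" "\<And>t. norm (h t) \<le> B" for h :: "real \<Rightarrow> real" and B
    using that by (intro weak_conv_imp_integral_bdd_continuous_conv[OF distr_\<nu> N conv])
      (auto simp: continuous_on_eq_continuous_at)
  \<comment> \<open>The truncated distance to \<open>K\<close> is bounded, continuous and zero
    exactly on \<open>K\<close>. Its integrals vanish along the sequence, hence in the
    limit.\<close>
  have AE_K: "AE t in N. t \<in> K"
  proof -
    let ?h = "\<lambda>t. min 1 (infdist t K)"
    have cont: "continuous_on UNIV ?h"
      by (intro continuous_intros)
    have meas: "?h \<in> borel_measurable borel"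
      using cont by (rule borel_measurable_continuous_onI)
    have bd: "norm (?h t) \<le> 1" for t
      by (simp add: infdist_nonneg)
    have "(\<integral>t. ?h t \<partial>\<nu> n) = 0" for n
    proof -
      have "(\<integral>t. ?h t \<partial>\<nu> n) = (\<integral>x. ?h (kappa d x) \<partial>\<mu> n)"
        by (rule int_\<nu>[OF meas])
      also have "\<dots> = (\<integral>x. 0 \<partial>\<mu> n)"
        by (rule Bochner_Integration.integral_cong) (auto simp: sp K_def)
      finally show ?thesis by simp
    qed
    with lim[OF cont bd] have "(\<integral>t. ?h t \<partial>N) = 0"
      by (simp add: LIMSEQ_const_iff)
    moreover have "integrable N ?h"
      using meas bd by (intro N.integrable_const_bound[of _ 1]) auto
    ultimately have "AE t in N. ?h t = 0"
      by (subst integral_nonneg_eq_0_iff_AE[symmetric]) (auto simp: infdist_nonneg)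
    moreover have "K \<noteq> {}" using ne by (simp add: K_def)
    ultimately show ?thesis
      by (auto simp: in_closed_iff_infdist_zero[OF closed_K] min_def split: if_splits)
  qed
  have meas_g: "g \<in> N \<rightarrow>\<^sub>M XM"
  proof (rule measurable_into_XM)
    fix T :: "(nat \<Rightarrow> nat) set" assume "open T"
    then obtain W where W: "open W" "K \<inter> g -` T = K \<inter> W"
      using continuous_openin_preimage_gen[OF cont_g] by (auto simp: openin_open)
    have "g t \<in> T \<longleftrightarrow> t \<in> W" if "t \<in> K" for t
      using W(2) that by blast
    moreover have "g t = x0" if "t \<notin> K" for t
      using that by (simp add: g_def)
    ultimately have "g -` T \<inter> space N = (K \<inter> W) \<union> (if x0 \<in> T then - K else {})"
      by auto
    then show "g -` T \<inter> space N \<in> sets N"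
      using W(1) closed_K by (auto intro!: sets.Un sets.Int borel_open borel_closed)
  qed (auto simp: g_X)
  define M where "M = distr N XM g"
  have pr_M: "prob_space M" and sets_M: "sets M = sets XM" and sp_M: "space M = X"
    unfolding M_def using meas_g by (simp_all add: N.prob_space_distr space_XM)
  have lim_M: "(\<lambda>n. \<integral>x. F x \<partial>\<mu> (r n)) \<longlonglongrightarrow> (\<integral>x. F x \<partial>M)" if F: "continuous_on X F" for F :: "_ \<Rightarrow> real"
  proof -
    obtain B where B: "\<And>x. x \<in> X \<Longrightarrow> norm (F x) \<le> B" "B > 0"
      using bounded_continuous[OF F] by blast
    have "continuous_on K (\<lambda>t. F (g t))"
      by (rule continuous_on_compose2[OF F cont_g]) (auto simp: g_X)
    \<comment> \<open>Weak convergence tests functions on the whole line, so the potential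
      transported to \<open>K\<close> is extended by Tietze's theorem with the same bound.\<close>
    then obtain h where h: "continuous_on UNIV h" "\<And>t. t \<in> K \<Longrightarrow> h t = F (g t)" "\<And>t. norm (h t) \<le> B"
      using closed_K B g_X by (elim Tietze[of K "\<lambda>t. F (g t)" UNIV B]) (auto simp: less_imp_le)
    have meas_h: "h \<in> borel_measurable borel"
      using h(1) by (rule borel_measurable_continuous_onI)
    have "(\<integral>x. F x \<partial>M) = (\<integral>t. F (g t) \<partial>N)"
      unfolding M_def by (rule integral_distr[OF meas_g measurable_continuous[OF refl F]])
    also have "\<dots> = (\<integral>t. h t \<partial>N)"
    proof (rule integral_cong_AE)
      show "(\<lambda>t. F (g t)) \<in> borel_measurable N"
        by (rule measurable_compose[OF meas_g measurable_continuous[OF refl F]])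
      show "h \<in> borel_measurable N" using meas_h by simp
      show "AE t in N. F (g t) = h t" using AE_K by eventually_elim (simp add: h)
    qed
    finally have "(\<integral>x. F x \<partial>M) = (\<integral>t. h t \<partial>N)" .
    moreover have "(\<integral>t. h t \<partial>\<nu> n) = (\<integral>x. F x \<partial>\<mu> n)" for n
      unfolding int_\<nu>[OF meas_h]
      by (rule Bochner_Integration.integral_cong) (auto simp: sp h(2) g_kappa K_def)
    ultimately show ?thesis
      using lim[OF h(1,3)] by simp
  qed
  have meas_shift: "shift \<in> M \<rightarrow>\<^sub>M XM"
    using measurable_shift by (simp add: measurable_cong_sets[OF sets_M refl])
  \<comment> \<open>Indicators of cylinders are continuous, so invariance on cylinders passes to the
    limit; these determine the measure.\<close>
  have "distr M XM shift = M"
  proof (rule measure_eqI_cyl)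
    show "prob_space (distr M XM shift)"
      by (rule prob_space.prob_space_distr[OF pr_M meas_shift])
    fix l
    let ?F = "indicator (cyl d A l) :: _ \<Rightarrow> real"
    have F: "continuous_on X ?F"
      by (rule continuous_on_locally_constant[of _ "length l"]) (auto simp: cyl_def agree_def indicator_def)
    have "(\<lambda>n. \<integral>x. ?F x \<partial>\<mu> (r n)) \<longlonglongrightarrow> (\<integral>x. ?F (shift x) \<partial>M)"
      using lim_M[OF continuous_on_compose_shift[OF F]] by (simp add: integral_shift[OF assms F])
    with lim_M[OF F] have "(\<integral>x. ?F (shift x) \<partial>M) = (\<integral>x. ?F x \<partial>M)"
      by (rule LIMSEQ_unique[rotated])
    moreover have "(\<integral>x. ?F (shift x) \<partial>M) = (\<integral>x. ?F x \<partial>distr M XM shift)"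
      by (rule integral_distr[symmetric, OF meas_shift measurable_continuous[OF refl F]])
    ultimately have "measure (distr M XM shift) (cyl d A l) = measure M (cyl d A l)"
      using cyl_in_sets[of l] sets.sets_into_space[OF cyl_in_sets[of l]]
      by (simp add: sets_M sp_M space_XM Int_absorb2)
    then show "emeasure (distr M XM shift) (cyl d A l) = emeasure M (cyl d A l)"
      using pr_M \<open>prob_space (distr M XM shift)\<close>
      by (simp add: finite_measure.emeasure_eq_measure prob_space.finite_measure)
  qed (simp_all add: sets_M)
  then have "emeasure M (shift -` B \<inter> X) = emeasure M B" if "B \<in> sets XM" for B
    using emeasure_distr[OF meas_shift that] by (simp add: sp_M)
  then have "M \<in> invariant_measures \<theta> d A"
    using pr_M sets_M by (simp add: invariant_measures_iff)
  from that[OF r this lim_M] show thesis .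
qed

lemma compact_Rot:
  fixes \<Phi> :: "(nat \<Rightarrow> nat) \<Rightarrow> real ^ 'm::finite"
  assumes "continuous_on X \<Phi>"
  shows "compact (Rot \<theta> d A \<Phi>)"
  unfolding compact_def
proof (intro allI impI)
  fix f :: "nat \<Rightarrow> real ^ 'm" assume "\<forall>n. f n \<in> Rot \<theta> d A \<Phi>"
  then obtain \<mu> where \<mu>: "\<And>n. \<mu> n \<in> invariant_measures \<theta> d A" "\<And>n. f n = rv \<Phi> (\<mu> n)"
    unfolding Rot_def image_iff by metis
  obtain r \<nu> where r: "strict_mono r" "\<nu> \<in> invariant_measures \<theta> d A"
    "\<And>F :: _ \<Rightarrow> real. continuous_on X F \<Longrightarrow> (\<lambda>n. \<integral>x. F x \<partial>\<mu> (r n)) \<longlonglongrightarrow> (\<integral>x. F x \<partial>\<nu>)"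
    by (rule invariant_measures_subsequence[OF \<mu>(1)]) (rule that, assumption+)
  have "(\<lambda>n. rv \<Phi> (\<mu> (r n)) $ i) \<longlonglongrightarrow> rv \<Phi> \<nu> $ i" for i
    unfolding rv_def using r(3)[of "\<lambda>x. \<Phi> x $ i"] assms by (simp add: continuous_on_component)
  then have "(f \<circ> r) \<longlonglongrightarrow> rv \<Phi> \<nu>"
    by (intro vec_tendstoI) (simp add: \<mu>(2) comp_def)
  moreover have "rv \<Phi> \<nu> \<in> Rot \<theta> d A \<Phi>"
    using r(2) by (simp add: Rot_def)
  ultimately show "\<exists>l\<in>Rot \<theta> d A \<Phi>. \<exists>r. strict_mono r \<and> (f \<circ> r) \<longlonglongrightarrow> l"
    using r(1) by blast
qed

end

section \<open>Approximation of rotation vectors by ergodic sums\<close>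

definition birkhoff_average :: "((nat \<Rightarrow> nat) \<Rightarrow> 'a::real_normed_vector) \<Rightarrow> nat \<Rightarrow> (nat \<Rightarrow> nat) \<Rightarrow> 'a" where
  "birkhoff_average \<Phi> L x = (1 / real L) *\<^sub>R (\<Sum>k<L. \<Phi> ((shift ^^ k) x))"

definition multi_average :: "((nat \<Rightarrow> nat) \<Rightarrow> 'a::real_normed_vector) \<Rightarrow> nat \<Rightarrow> nat \<Rightarrow> (nat \<Rightarrow> nat \<Rightarrow> nat) \<Rightarrow> 'a" where
  "multi_average \<Phi> K L x = (1 / real K) *\<^sub>R (\<Sum>i<K. birkhoff_average \<Phi> L (x i))"

lemma norm_average_le:
  fixes f :: "nat \<Rightarrow> 'a::real_normed_vector"
  assumes "0 < K" "\<And>i. i < K \<Longrightarrow> norm (f i) \<le> B"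
  shows "norm ((1 / real K) *\<^sub>R (\<Sum>i<K. f i)) \<le> B"
proof -
  have "norm (\<Sum>i<K. f i) \<le> real K * B"
    using sum_norm_le[of "{..<K}" f "\<lambda>_. B"] assms by simp
  then show ?thesis
    using assms(1) by (simp add: field_simps)
qed

lemma sum_periodic:
  fixes h :: "nat \<Rightarrow> real"
  assumes "h P = h 0"
  shows "(\<Sum>k<P. h (Suc k)) = (\<Sum>k<P. h k)"
  using sum.lessThan_Suc_shift[of h P] sum.lessThan_Suc[of h P] assms by simp

context subshift
begin

lemma integral_inner_birkhoff:
  fixes \<Phi> :: "(nat \<Rightarrow> nat) \<Rightarrow> real ^ 'm::finite"
  assumes \<mu>: "\<mu> \<in> invariant_measures \<theta> d A" and \<Phi>: "continuous_on X \<Phi>" and "0 < L"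
  shows "(\<integral>x. birkhoff_average \<Phi> L x \<bullet> w \<partial>\<mu>) = rv \<Phi> \<mu> \<bullet> w"
    and "integrable \<mu> (\<lambda>x. birkhoff_average \<Phi> L x \<bullet> w)"
proof -
  have pr: "prob_space \<mu>" "sets \<mu> = sets XM"
    using \<mu> by (simp_all add: invariant_measures_iff)
  have ci: "continuous_on X (\<lambda>x. \<Phi> x $ i)" for i
    using \<Phi> by (simp add: continuous_on_component)
  have int: "integrable \<mu> (\<lambda>x. \<Phi> ((shift ^^ k) x) $ i)" for k i
    by (rule integrable_continuous[OF pr continuous_on_compose_funpow_shift[OF ci]])
  have eq: "birkhoff_average \<Phi> L x \<bullet> w =
      (1 / real L) * (\<Sum>k<L. \<Sum>i\<in>UNIV. \<Phi> ((shift ^^ k) x) $ i * w $ i)" for x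
    unfolding birkhoff_average_def by (simp add: inner_sum_left) (simp add: inner_vec_def)
  have "(\<integral>x. birkhoff_average \<Phi> L x \<bullet> w \<partial>\<mu>) =
      (1 / real L) * (\<Sum>k<L. \<Sum>i\<in>UNIV. (\<integral>x. \<Phi> ((shift ^^ k) x) $ i \<partial>\<mu>) * w $ i)"
    unfolding eq using int by simp
  also have "\<dots> = rv \<Phi> \<mu> \<bullet> w"
    using \<open>0 < L\<close> by (simp add: integral_funpow_shift[OF \<mu> ci] rv_def inner_vec_def)
  finally show "(\<integral>x. birkhoff_average \<Phi> L x \<bullet> w \<partial>\<mu>) = rv \<Phi> \<mu> \<bullet> w" .
  show "integrable \<mu> (\<lambda>x. birkhoff_average \<Phi> L x \<bullet> w)"
    unfolding eq using int by (intro integrable_mult_right Bochner_Integration.integrable_sum integrable_mult_left)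
qed

text \<open>By invariance the right side is the mean of the function on the left, and a function
  cannot exceed its mean everywhere. The argument works for any invariant measure and any length
  \<open>L\<close>.\<close>

lemma birkhoff_average_inner_le:
  fixes \<Phi> :: "(nat \<Rightarrow> nat) \<Rightarrow> real ^ 'm::finite"
  assumes \<mu>: "\<mu> \<in> invariant_measures \<theta> d A" and \<Phi>: "continuous_on X \<Phi>" and L: "0 < L"
  shows "\<exists>x\<in>X. birkhoff_average \<Phi> L x \<bullet> w \<le> rv \<Phi> \<mu> \<bullet> w"
proof (rule ccontr)
  assume neg: "\<not> (\<exists>x\<in>X. birkhoff_average \<Phi> L x \<bullet> w \<le> rv \<Phi> \<mu> \<bullet> w)"
  have pr: "prob_space \<mu>" and sp: "space \<mu> = X"
    using \<mu> sets_eq_imp_space_eq[of \<mu> XM] by (auto simp: invariant_measures_iff space_XM)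
  interpret prob_space \<mu> by (rule pr)
  have "(\<integral>x. rv \<Phi> \<mu> \<bullet> w \<partial>\<mu>) < (\<integral>x. birkhoff_average \<Phi> L x \<bullet> w \<partial>\<mu>)"
    by (rule integral_less_AE_space)
       (use neg sp emeasure_space_1 integral_inner_birkhoff(2)[OF \<mu> \<Phi> L] in \<open>auto intro!: AE_I2 simp: not_le\<close>)
  then show False
    by (simp add: integral_inner_birkhoff(1)[OF \<mu> \<Phi> L] prob_space)
qed

lemma norm_birkhoff_average_le:
  assumes "\<And>x. x \<in> X \<Longrightarrow> norm (\<Phi> x) \<le> C" "x \<in> X" "0 < L"
  shows "norm (birkhoff_average \<Phi> L x) \<le> C"
  unfolding birkhoff_average_def
  by (rule norm_average_le) (use assms funpow_shift_in_sft in auto)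

text \<open>Testing \<open>birkhoff_average_inner_le\<close> in the direction \<open>- v\<close> for
  \<open>L = 1\<close> bounds the square of \<open>norm v\<close> by
  \<open>C * norm v\<close>.\<close>

lemma norm_rv_le:
  fixes \<Phi> :: "(nat \<Rightarrow> nat) \<Rightarrow> real ^ 'm::finite"
  assumes \<mu>: "\<mu> \<in> invariant_measures \<theta> d A" and \<Phi>: "continuous_on X \<Phi>"
    and C: "\<And>x. x \<in> X \<Longrightarrow> norm (\<Phi> x) \<le> C"
  shows "norm (rv \<Phi> \<mu>) \<le> C"
proof -
  let ?v = "rv \<Phi> \<mu>"
  obtain x where x: "x \<in> X" "birkhoff_average \<Phi> 1 x \<bullet> (- ?v) \<le> ?v \<bullet> (- ?v)"
    using birkhoff_average_inner_le[OF \<mu> \<Phi>, of 1 "- ?v"] by auto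
  then have "norm ?v * norm ?v \<le> birkhoff_average \<Phi> 1 x \<bullet> ?v"
    by (simp add: norm_eq_sqrt_inner)
  also have "\<dots> \<le> C * norm ?v"
    using norm_cauchy_schwarz[of "birkhoff_average \<Phi> 1 x" ?v] norm_birkhoff_average_le[OF C x(1), where L = 1]
    by (meson mult_right_mono norm_ge_zero order_trans zero_less_one)
  finally have "norm ?v * norm ?v \<le> C * norm ?v" .
  moreover have "0 \<le> C"
    using C[OF x(1)] norm_ge_zero order_trans by blast
  ultimately show ?thesis
    by (cases "norm ?v = 0") (auto simp: mult_le_cancel_right)
qed

text \<open>
  The points are chosen greedily: the next average makes an obtuse angle with the sum of the
  deviations so far, so the squared norms of the deviations add up.
\<close>

lemma rotation_vector_approx:
  fixes \<Phi> :: "(nat \<Rightarrow> nat) \<Rightarrow> real ^ 'm::finite"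
  assumes v: "v \<in> Rot \<theta> d A \<Phi>" and \<Phi>: "continuous_on X \<Phi>"
    and C: "\<And>x. x \<in> X \<Longrightarrow> norm (\<Phi> x) \<le> C" and "0 < K" "0 < L"
  shows "\<exists>x. (\<forall>i. x i \<in> X) \<and> norm (multi_average \<Phi> K L x - v) \<le> 2 * C / sqrt (real K)"
proof -
  obtain \<mu> where \<mu>: "\<mu> \<in> invariant_measures \<theta> d A" and v: "v = rv \<Phi> \<mu>"
    using v by (auto simp: Rot_def)
  let ?a = "birkhoff_average \<Phi> L"
  have choice: "\<exists>x\<in>X. w \<bullet> (?a x - v) \<le> 0" for w
    using birkhoff_average_inner_le[OF \<mu> \<Phi> \<open>0 < L\<close>, of w] by (auto simp: v inner_diff_right inner_commute)
  then obtain p where p: "\<And>w. p w \<in> X" "\<And>w. w \<bullet> (?a (p w) - v) \<le> 0"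
    by metis
  have C0: "0 \<le> C"
    using C[OF p(1)] norm_ge_zero order_trans by blast
  define W where "W = rec_nat 0 (\<lambda>_ w. w + (?a (p w) - v))"
  define x where "x i = p (W i)" for i
  have W_Suc: "W (Suc k) = W k + (?a (x k) - v)" for k
    by (simp add: W_def x_def)
  have W: "W k = (\<Sum>i<k. ?a (x i) - v)" for k
    by (induction k) (simp_all add: W_Suc, simp add: W_def)
  have dev: "norm (?a (x k) - v) \<le> 2 * C" for k
  proof -
    have "norm (?a (x k)) \<le> C" "norm v \<le> C"
      using norm_birkhoff_average_le[OF C p(1) \<open>0 < L\<close>] norm_rv_le[OF \<mu> \<Phi> C]
      by (simp_all add: x_def v)
    then show ?thesis
      using norm_triangle_ineq4[of "?a (x k)" v] by linarith
  qed
  have norm_W: "(norm (W k))\<^sup>2 \<le> (2 * C)\<^sup>2 * real k" for k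
  proof (induction k)
    case (Suc k)
    have "(norm (W (Suc k)))\<^sup>2 = (norm (W k))\<^sup>2 + 2 * (W k \<bullet> (?a (x k) - v)) + (norm (?a (x k) - v))\<^sup>2"
      unfolding W_Suc power2_norm_eq_inner by (simp add: inner_add inner_commute)
    also have "\<dots> \<le> (2 * C)\<^sup>2 * real k + 0 + (2 * C)\<^sup>2"
      using Suc p(2)[of "W k"] power_mono[OF dev[of k], of 2] unfolding x_def by (intro add_mono) simp_all
    finally show ?case by (simp add: algebra_simps)
  qed (simp add: W_def)
  have "multi_average \<Phi> K L x - v = (1 / real K) *\<^sub>R W K"
    using \<open>0 < K\<close> by (simp add: multi_average_def W sum_subtractf scaleR_diff_right sum_constant_scaleR del: sum_constant)
  then have "norm (multi_average \<Phi> K L x - v) = norm (W K) / real K"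
    by simp
  also have "\<dots> \<le> 2 * C * sqrt (real K) / real K"
  proof (rule divide_right_mono)
    have "(norm (W K))\<^sup>2 \<le> (2 * C * sqrt (real K))\<^sup>2"
      using norm_W[of K] by (simp add: power_mult_distrib)
    then show "norm (W K) \<le> 2 * C * sqrt (real K)"
      by (rule power2_le_imp_le) (simp add: C0)
  qed simp
  also have "\<dots> = 2 * C / sqrt (real K)"
  proof -
    have "2 * C * s / (s * s) = 2 * C / s" if "s \<noteq> 0" for s :: real
      using that by simp
    from this[of "sqrt (real K)"] \<open>0 < K\<close> show ?thesis by simp
  qed
  finally have "norm (multi_average \<Phi> K L x - v) \<le> 2 * C / sqrt (real K)" .
  then show ?thesis
    using p(1) by (intro exI[of _ x]) (simp add: x_def)
qed

text \<open>The measure gives weight \<open>1 / (K * P i)\<close> to each of the first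
  \<open>P i\<close> points of orbit \<open>i\<close>. As \<open>P i\<close> need not be the least
  period and orbits may coincide, the weights are put on the index set \<open>I\<close> and pushed
  forward, so that repetitions add up.\<close>

lemma periodic_average_in_Rot:
  fixes \<Phi> :: "(nat \<Rightarrow> nat) \<Rightarrow> real ^ 'm::finite"
  assumes \<Phi>: "continuous_on X \<Phi>" and "0 < K"
    and y: "\<And>i. y i \<in> X" "\<And>i. 0 < P i" "\<And>i. (shift ^^ P i) (y i) = y i"
  shows "(1 / real K) *\<^sub>R (\<Sum>i<K. birkhoff_average \<Phi> (P i) (y i)) \<in> Rot \<theta> d A \<Phi>"
proof -
  define I where "I = Sigma {..<K} (\<lambda>i. {..<P i})"
  define w :: "nat \<times> nat \<Rightarrow> real" where "w = (\<lambda>(i, k). 1 / real K * (1 / real (P i)))"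
  define g where "g = (\<lambda>(i, k). (shift ^^ k) (y i))"
  define M where "M = point_measure I (\<lambda>a. ennreal (w a))"
  define \<mu> where "\<mu> = distr M XM g"
  have I: "finite I"
    by (simp add: I_def)
  have w: "0 \<le> w a" for a
    by (simp add: w_def split: prod.split)
  have space_M: "space M = I" and sets_M: "sets M = Pow I"
    by (simp_all add: M_def space_point_measure sets_point_measure)
  have meas_g: "g \<in> M \<rightarrow>\<^sub>M XM"
    unfolding M_def by (rule measurable_into_XM)
      (auto simp: g_def y funpow_shift_in_sft space_point_measure sets_point_measure)
  have sum_I: "(\<Sum>a\<in>I. w a * h (g a)) = (\<Sum>i<K. 1 / real K * (1 / real (P i)) * (\<Sum>k<P i. h ((shift ^^ k) (y i))))"
    for h :: "_ \<Rightarrow> real"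
  proof -
    have "(\<Sum>a\<in>I. w a * h (g a)) = (\<Sum>i<K. \<Sum>k<P i. w (i, k) * h (g (i, k)))"
      using sum.Sigma[of "{..<K}" "\<lambda>i. {..<P i}" "\<lambda>i k. w (i, k) * h (g (i, k))"]
      by (simp add: I_def split_beta)
    then show ?thesis
      by (simp add: w_def g_def sum_distrib_left)
  qed
  have em: "emeasure \<mu> B = ennreal (\<Sum>a\<in>I. w a * indicator B (g a))" if "B \<in> sets XM" for B
  proof -
    have "emeasure \<mu> B = emeasure M (g -` B \<inter> I)"
      unfolding \<mu>_def by (simp add: emeasure_distr[OF meas_g that] space_M)
    also have "\<dots> = (\<Sum>a\<in>g -` B \<inter> I. ennreal (w a))"
      unfolding M_def by (rule emeasure_point_measure_finite[OF I]) simp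
    also have "\<dots> = ennreal (\<Sum>a\<in>g -` B \<inter> I. w a)"
      by (rule sum_ennreal) (rule w)
    also have "(\<Sum>a\<in>g -` B \<inter> I. w a) = (\<Sum>a\<in>I. w a * indicator B (g a))"
      by (rule sum.mono_neutral_cong_left) (use I in \<open>auto simp: indicator_def\<close>)
    finally show ?thesis .
  qed
  have sets_\<mu>: "sets \<mu> = sets XM"
    by (simp add: \<mu>_def)
  have "emeasure \<mu> X = 1"
  proof -
    have "X \<in> sets XM"
      using sets.top[of XM] by (simp add: space_XM)
    moreover have "(\<Sum>a\<in>I. w a * indicator X (g a)) = 1"
      unfolding sum_I using y \<open>0 < K\<close> by (simp add: funpow_shift_in_sft indicator_def)
    ultimately show ?thesis by (simp add: em)
  qed
  then have pr: "prob_space \<mu>"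
    by (intro prob_spaceI) (simp add: \<mu>_def space_XM)
  have "emeasure \<mu> (shift -` B \<inter> X) = emeasure \<mu> B" if B: "B \<in> sets XM" for B
  proof -
    have B': "shift -` B \<inter> X \<in> sets XM"
      using measurable_sets[OF measurable_shift B] by (simp add: space_XM)
    \<comment> \<open>Pulling back by the shift moves each orbit point one step, and over a full
      period the sum does not change.\<close>
    have "(\<Sum>k<P i. indicator (shift -` B \<inter> X) ((shift ^^ k) (y i))) = (\<Sum>k<P i. indicator B ((shift ^^ k) (y i)) :: real)" for i
    proof -
      have "indicator (shift -` B \<inter> X) ((shift ^^ k) (y i)) = (indicator B ((shift ^^ Suc k) (y i)) :: real)" for k
        using y(1) by (simp add: indicator_def funpow_shift_in_sft)
      then show ?thesis
        using sum_periodic[of "\<lambda>k. indicator B ((shift ^^ k) (y i))" "P i"] y(3)[of i] by (simp del: funpow.simps(2))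
    qed
    then show ?thesis
      by (simp add: em[OF B] em[OF B'] sum_I)
  qed
  then have "\<mu> \<in> invariant_measures \<theta> d A"
    using pr sets_\<mu> by (simp add: invariant_measures_iff)
  moreover have "rv \<Phi> \<mu> = (1 / real K) *\<^sub>R (\<Sum>i<K. birkhoff_average \<Phi> (P i) (y i))"
  proof (rule vec_eq_iff[THEN iffD2, rule_format])
    fix j
    have "rv \<Phi> \<mu> $ j = (\<integral>a. \<Phi> (g a) $ j \<partial>M)"
      unfolding rv_def \<mu>_def
      using integral_distr[OF meas_g measurable_continuous[OF refl continuous_on_component[OF \<Phi>, of j]]] by simp
    also have "\<dots> = (\<Sum>a\<in>I. w a * \<Phi> (g a) $ j)"
      unfolding M_def using lebesgue_integral_point_measure_finite[OF I, of w "\<lambda>a. \<Phi> (g a) $ j"] w by simp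
    also have "\<dots> = ((1 / real K) *\<^sub>R (\<Sum>i<K. birkhoff_average \<Phi> (P i) (y i))) $ j"
      unfolding sum_I[of "\<lambda>x. \<Phi> x $ j"]
      by (simp add: birkhoff_average_def sum_distrib_left sum_component mult.assoc)
    finally show "rv \<Phi> \<mu> $ j = ((1 / real K) *\<^sub>R (\<Sum>i<K. birkhoff_average \<Phi> (P i) (y i))) $ j" .
  qed
  ultimately show ?thesis
    unfolding Rot_def by force
qed

section \<open>Closing orbit segments by transitivity\<close>

lemma transitive_connect:
  assumes "transition_matrix d A" "transitive_shift \<theta> d A" "a < d" "b < d"
  shows "\<exists>n. \<exists>z\<in>X. z 0 = a \<and> z n = b"
proof -
  have ne: "cyl d A [c] \<noteq> {}" if c: "c < d" for c
  proof -
    \<comment> \<open>The letter may occur at a later position only; shifting brings it to the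
      front.\<close>
    obtain x k where "x \<in> X" "x k = c"
      using assms(1) c unfolding transition_matrix_def by blast
    then have "(shift ^^ k) x \<in> cyl d A [c]"
      by (simp add: cyl_def funpow_shift_in_sft) (simp add: funpow_shift)
    then show ?thesis by blast
  qed
  obtain n where "(shift ^^ n) ` cyl d A [a] \<inter> cyl d A [b] \<noteq> {}"
    using assms(2)[unfolded transitive_shift_def sft_top_eq[OF theta], rule_format,
        of "cyl d A [a]" "cyl d A [b]"] ne[OF assms(3)] ne[OF assms(4)] openin_cyl by auto
  then show ?thesis
    by (auto simp: cyl_def funpow_shift)
qed

text \<open>The segment is followed by a word that leads back to its first letter. Such a word
  depends on two letters only, so \<open>R\<close> is a maximum over finitely many pairs and serves
  all \<open>x\<close> and \<open>L\<close>.\<close>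

lemma periodic_closing:
  assumes "transition_matrix d A" "transitive_shift \<theta> d A"
  obtains R where "\<And>x L. x \<in> X \<Longrightarrow> 0 < L \<Longrightarrow>
    \<exists>y\<in>X. \<exists>n\<le>R. agree L y x \<and> (shift ^^ (L + n)) y = y"
proof -
  obtain \<tau> where \<tau>: "\<And>a b. a < d \<Longrightarrow> b < d \<Longrightarrow> \<exists>z\<in>X. z 0 = a \<and> z (\<tau> a b) = b"
    using transitive_connect[OF assms] by metis
  define R where "R = Max (insert 0 ((\<lambda>(a, b). \<tau> a b) ` ({..<d} \<times> {..<d})))"
  have R: "\<tau> a b \<le> R" if "a < d" "b < d" for a b
    unfolding R_def using that by (intro Max_ge) auto
  have "\<exists>y\<in>X. \<exists>n\<le>R. agree L y x \<and> (shift ^^ (L + n)) y = y" if x: "x \<in> X" and L: "0 < L" for x L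
  proof -
    have x': "x j < d" "A (x j) (x (Suc j)) = 1" for j
      using x by (simp_all add: sft_def)
    \<comment> \<open>The connection starts at \<open>x L\<close> and not at the last letter
      \<open>x (L - 1)\<close> of the segment: the transition into \<open>z 0\<close> is then one
      that occurs in \<open>x\<close>, and \<open>n = 0\<close> is allowed.\<close>
    define n where "n = \<tau> (x L) (x 0)"
    obtain z where z: "z \<in> X" "z 0 = x L" "z n = x 0"
      using \<tau>[OF x'(1) x'(1)] unfolding n_def by blast
    have z': "z j < d" "A (z j) (z (Suc j)) = 1" for j
      using z(1) by (simp_all add: sft_def)
    define u where "u t = (if t < L then x t else z (t - L))" for t
    define y where "y j = u (j mod (L + n))" for j
    have u_step: "A (u t) (u (Suc t)) = 1" for t
    proof (cases "t < L")
      case True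
      then consider "Suc t < L" | "Suc t = L" by linarith
      then show ?thesis
        by cases (use True x'(2)[of t] z(2) in \<open>auto simp: u_def\<close>)
    next
      case False
      then show ?thesis
        using z'(2)[of "t - L"] by (simp add: u_def Suc_diff_le)
    qed
    have u_period: "u (L + n) = u 0"
      using L z(3) by (simp add: u_def)
    have "A (y j) (y (Suc j)) = 1" for j
      using u_step[of "j mod (L + n)"] u_period by (auto simp: y_def mod_Suc)
    moreover have "y j < d" for j
      using x' z' by (simp add: y_def u_def)
    ultimately have "y \<in> X"
      by (simp add: sft_def)
    moreover have "agree L y x"
      by (simp add: agree_def y_def u_def)
    moreover have "(shift ^^ (L + n)) y = y"
      unfolding funpow_shift by (simp add: y_def fun_eq_iff)
    moreover have "n \<le> R"
      unfolding n_def by (rule R) (rule x')+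
    ultimately show ?thesis by blast
  qed
  then show thesis by (rule that)
qed

text \<open>Times before \<open>L - N\<close> still see \<open>N\<close> common letters and cost
  \<open>\<omega>\<close> each; the remaining ones, at most \<open>N\<close>, cost
  \<open>2 * C\<close> each. The \<open>n\<close> additional terms cost \<open>n * C\<close>, and so
  does dividing by \<open>L + n\<close> in place of \<open>L\<close>.\<close>

lemma periodic_average_close:
  assumes C: "\<And>x. x \<in> X \<Longrightarrow> norm (\<Phi> x) \<le> C"
    and \<omega>: "\<And>x y. x \<in> X \<Longrightarrow> y \<in> X \<Longrightarrow> agree N x y \<Longrightarrow> norm (\<Phi> x - \<Phi> y) \<le> \<omega>"
    and xy: "x \<in> X" "y \<in> X" "agree L y x" and n: "n \<le> R" and L: "0 < L"
  shows "norm (birkhoff_average \<Phi> L x - birkhoff_average \<Phi> (L + n) y) \<le> \<omega> + 2 * C * real (N + R) / real L"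
proof -
  let ?x = "\<lambda>k. \<Phi> ((shift ^^ k) x)" and ?y = "\<lambda>k. \<Phi> ((shift ^^ k) y)"
  have C0: "0 \<le> C" using C[OF xy(1)] norm_ge_zero order_trans by blast
  have \<omega>0: "0 \<le> \<omega>" using \<omega>[OF xy(1) xy(1)] by simp
  have "norm (\<Sum>k<L. ?x k - ?y k) \<le> (\<Sum>k<L. \<omega> + (if L - N \<le> k then 2 * C else 0))"
  proof (rule sum_norm_le)
    fix k assume "k \<in> {..<L}"
    show "norm (?x k - ?y k) \<le> \<omega> + (if L - N \<le> k then 2 * C else 0)"
    proof (cases "L - N \<le> k")
      case True
      then show ?thesis
        using norm_triangle_ineq4[of "?x k" "?y k"] C[OF funpow_shift_in_sft[OF xy(1), of k]]
          C[OF funpow_shift_in_sft[OF xy(2), of k]] \<omega>0 by simp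
    next
      case False
      then have "agree N ((shift ^^ k) x) ((shift ^^ k) y)"
        using xy(3) by (simp add: agree_def funpow_shift)
      then show ?thesis
        using \<omega> xy False by (simp add: funpow_shift_in_sft)
    qed
  qed
  also have "\<dots> = real L * \<omega> + 2 * C * real (card {k \<in> {..<L}. L - N \<le> k})"
    by (simp add: sum.distrib sum.If_cases Int_def)
  also have "\<dots> \<le> real L * \<omega> + 2 * C * real N"
  proof -
    have "{k \<in> {..<L}. L - N \<le> k} = {L - N..<L}" by auto
    then have "card {k \<in> {..<L}. L - N \<le> k} \<le> N" by simp
    then show ?thesis using C0 by (intro add_left_mono mult_left_mono) simp_all
  qed
  finally have 1: "norm (\<Sum>k<L. ?x k - ?y k) \<le> real L * \<omega> + 2 * C * real N" .
  let ?S = "\<Sum>k<L + n. ?y k"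
  have split: "?S = (\<Sum>k<L. ?y k) + (\<Sum>k<n. ?y (L + k))"
    by (induction n) simp_all
  have 2: "norm (\<Sum>k<n. ?y (L + k)) \<le> real n * C"
    using sum_norm_le[of "{..<n}" "\<lambda>k. ?y (L + k)" "\<lambda>_. C"] C funpow_shift_in_sft[OF xy(2)] by simp
  have 3: "norm (birkhoff_average \<Phi> (L + n) y) \<le> C"
    by (rule norm_birkhoff_average_le[OF C xy(2)]) (use L in auto)
  have Sx: "real L *\<^sub>R birkhoff_average \<Phi> L x = (\<Sum>k<L. ?x k)"
    and S: "real (L + n) *\<^sub>R birkhoff_average \<Phi> (L + n) y = ?S"
    using L by (simp_all add: birkhoff_average_def)
  have "real L *\<^sub>R (birkhoff_average \<Phi> L x - birkhoff_average \<Phi> (L + n) y) =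
      (\<Sum>k<L. ?x k) - ?S + real n *\<^sub>R birkhoff_average \<Phi> (L + n) y"
    unfolding S[symmetric] Sx[symmetric] by (simp add: scaleR_diff_right scaleR_left_distrib)
  also have "\<dots> = (\<Sum>k<L. ?x k - ?y k) - (\<Sum>k<n. ?y (L + k)) + real n *\<^sub>R birkhoff_average \<Phi> (L + n) y"
    unfolding split by (simp add: sum_subtractf)
  finally have "real L * norm (birkhoff_average \<Phi> L x - birkhoff_average \<Phi> (L + n) y) =
      norm ((\<Sum>k<L. ?x k - ?y k) - (\<Sum>k<n. ?y (L + k)) + real n *\<^sub>R birkhoff_average \<Phi> (L + n) y)"
    by (metis norm_scaleR abs_of_nat)
  also have "\<dots> \<le> (real L * \<omega> + 2 * C * real N) + real n * C + real n * C"
    using 1 2 mult_left_mono[OF 3, of "real n"]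
    by (intro order_trans[OF norm_triangle_ineq] order_trans[OF add_right_mono[OF norm_triangle_ineq4]] add_mono) simp_all
  also have "\<dots> \<le> real L * \<omega> + 2 * C * real (N + R)"
    using n C0 mult_right_mono[of "real n" "real R" C] by (simp add: algebra_simps)
  finally show ?thesis
    using L by (simp add: field_simps)
qed

text \<open>The order of the quantifiers matters: \<open>R\<close> is fixed before \<open>N\<close>,
  \<open>\<omega>\<close>, \<open>K\<close> and \<open>L\<close>, so that \<open>L\<close> can be
  chosen with knowledge of \<open>R\<close> and of the modulus.\<close>

lemma multi_average_near_Rot:
  fixes \<Phi> :: "(nat \<Rightarrow> nat) \<Rightarrow> real ^ 'm::finite"
  assumes "transition_matrix d A" "transitive_shift \<theta> d A" and \<Phi>: "continuous_on X \<Phi>"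
    and C: "\<And>x. x \<in> X \<Longrightarrow> norm (\<Phi> x) \<le> C"
  obtains R where "\<And>N \<omega> K L x. (\<And>x y. x \<in> X \<Longrightarrow> y \<in> X \<Longrightarrow> agree N x y \<Longrightarrow> norm (\<Phi> x - \<Phi> y) \<le> \<omega>) \<Longrightarrow>
     0 < K \<Longrightarrow> 0 < L \<Longrightarrow> (\<And>i. x i \<in> X) \<Longrightarrow>
     \<exists>v\<in>Rot \<theta> d A \<Phi>. norm (multi_average \<Phi> K L x - v) \<le> \<omega> + 2 * C * real (N + R) / real L"
proof -
  obtain R where R: "\<And>x L. x \<in> X \<Longrightarrow> 0 < L \<Longrightarrow>
      \<exists>y\<in>X. \<exists>n\<le>R. agree L y x \<and> (shift ^^ (L + n)) y = y"
    using periodic_closing[OF assms(1,2)] by blast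
  show thesis
  proof (rule that)
    fix N K L :: nat and \<omega> :: real and x :: "nat \<Rightarrow> nat \<Rightarrow> nat"
    assume \<omega>: "\<And>x y. x \<in> X \<Longrightarrow> y \<in> X \<Longrightarrow> agree N x y \<Longrightarrow> norm (\<Phi> x - \<Phi> y) \<le> \<omega>"
      and KL: "0 < K" "0 < L" and x: "\<And>i. x i \<in> X"
    obtain y n where y: "\<And>i. y i \<in> X" "\<And>i. n i \<le> R" "\<And>i. agree L (y i) (x i)"
        "\<And>i. (shift ^^ (L + n i)) (y i) = y i"
      using R[OF x KL(2)] by metis
    let ?v = "(1 / real K) *\<^sub>R (\<Sum>i<K. birkhoff_average \<Phi> (L + n i) (y i))"
    have "?v \<in> Rot \<theta> d A \<Phi>"
      by (rule periodic_average_in_Rot[OF \<Phi>]) (use KL y in auto)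
    moreover have "norm (multi_average \<Phi> K L x - ?v) \<le> \<omega> + 2 * C * real (N + R) / real L"
    proof -
      have "multi_average \<Phi> K L x - ?v =
          (1 / real K) *\<^sub>R (\<Sum>i<K. birkhoff_average \<Phi> L (x i) - birkhoff_average \<Phi> (L + n i) (y i))"
        by (simp add: multi_average_def sum_subtractf scaleR_diff_right)
      then show ?thesis
        using norm_average_le[OF KL(1) periodic_average_close[OF C \<omega> x y(1,3,2) KL(2)]] by simp
    qed
    ultimately show "\<exists>v\<in>Rot \<theta> d A \<Phi>. norm (multi_average \<Phi> K L x - v) \<le> \<omega> + 2 * C * real (N + R) / real L"
      by blast
  qed
qed

end

section \<open>The algorithm\<close>

lemma int_encode_of_nat: "int_encode (int a) = 2 * a"
  by (simp add: int_encode_def sum_encode_def)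

lemma int_encode_diff:
  "int_encode (int a - int b) = (if b \<le> a then 2 * (a - b) else 2 * (b - a) - 1)"
proof (cases "b \<le> a")
  case True
  then have "int a - int b = int (a - b)" by simp
  with True show ?thesis by (simp only: int_encode_of_nat if_True)
next
  case False
  then have "nat (int b - int a - 1) = b - a - 1" by simp
  then show ?thesis using False by (simp add: int_encode_def sum_encode_def)
qed

lemma abs_int_decode: "\<bar>int_decode n\<bar> = int ((n + 1) div 2)"
  by (auto simp: int_decode_def sum_decode_def)

lemma int_decode_neg: "int_decode n < 0 \<longleftrightarrow> odd n"
  by (auto simp: int_decode_def sum_decode_def)

definition rat_value :: "nat \<Rightarrow> real" where
  "rat_value r = of_rat (nat_to_rat_surj r)"

lemma rat_value: "rat_value r = real_of_int (int_decode (pi1 r)) / real_of_int (int_decode (pi2 r))"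
proof (cases "int_decode (pi2 r) = 0")
  case True
  then show ?thesis
    by (simp add: rat_value_def nat_to_rat_surj_def pi1_def pi2_def split_beta rat_number_collapse)
next
  case False
  then show ?thesis
    by (simp add: rat_value_def nat_to_rat_surj_def pi1_def pi2_def split_beta of_rat_rat)
qed

text \<open>
  An integer code \<open>n\<close> has its sign in its parity and the absolute value \<open>(n + 1) div 2\<close>. The shift
  by \<open>C\<close> keeps all sums in the natural numbers.
\<close>

definition rounded :: "nat \<Rightarrow> nat \<Rightarrow> nat \<Rightarrow> nat" where
  "rounded D C r = (if pi1 r mod 2 = pi2 r mod 2
     then C * D + ((pi1 r + 1) div 2 * D) div ((pi2 r + 1) div 2)
     else C * D - ((pi1 r + 1) div 2 * D) div ((pi2 r + 1) div 2))"

text \<open>The absolute value is rounded down, which costs at most 1. The bound by \<open>C\<close>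
  ensures that the truncated subtraction for negative values cuts nothing off.\<close>

lemma rounded_close:
  assumes "\<bar>rat_value r\<bar> \<le> real C"
  shows "\<bar>real (rounded D C r) - real D * (rat_value r + real C)\<bar> \<le> 1"
proof -
  let ?a = "(pi1 r + 1) div 2" and ?b = "(pi2 r + 1) div 2"
  let ?q = "(?a * D) div ?b"
  have ab: "real ?a = \<bar>real_of_int (int_decode (pi1 r))\<bar>" "real ?b = \<bar>real_of_int (int_decode (pi2 r))\<bar>"
    using abs_int_decode[of "pi1 r"] abs_int_decode[of "pi2 r"]
    by (metis of_int_abs of_int_of_nat_eq)+
  have abs: "\<bar>rat_value r\<bar> = real ?a / real ?b"
    unfolding ab rat_value by (rule abs_divide)
  have quotient: "real n / real m - real (n div m) \<le> 1" for n m
    using mod_less_divisor[of m n] of_nat_of_nat_div_aux[of n m, where ?'a = real]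
    by (cases "m = 0") simp_all
  have q: "real ?q \<le> real D * \<bar>rat_value r\<bar>" "real D * \<bar>rat_value r\<bar> - real ?q \<le> 1"
    using of_nat_div_le_of_nat[of "?a * D" ?b, where ?'a = real] quotient[of "?a * D" ?b]
    unfolding abs by (simp_all add: mult.commute)
  show ?thesis
  proof (cases "pi1 r mod 2 = pi2 r mod 2")
    case True
    then have "odd (pi1 r) \<longleftrightarrow> odd (pi2 r)"
      by (metis odd_iff_mod_2_eq_one)
    then have "0 \<le> rat_value r"
      unfolding rat_value int_decode_neg[symmetric]
      by (auto simp: zero_le_divide_iff not_less)
    then show ?thesis
      using True q by (simp add: rounded_def algebra_simps abs_le_iff)
  next
    case False
    then have "odd (pi1 r) \<noteq> odd (pi2 r)"
      by (metis odd_iff_mod_2_eq_one not_mod_2_eq_1_eq_0)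
    then have "rat_value r \<le> 0"
      unfolding rat_value int_decode_neg[symmetric]
      by (auto simp: divide_le_0_iff not_less)
    moreover have "real ?q \<le> real (C * D)"
      using q(1) mult_left_mono[OF assms, of "real D"] by (simp add: mult.commute)
    then have "?q \<le> C * D"
      by (simp only: of_nat_le_iff)
    ultimately show ?thesis
      using False q by (simp add: rounded_def of_nat_diff algebra_simps abs_le_iff)
  qed
qed

lemma recursive_rounded:
  assumes "recursive f" "recursive g" "recursive h"
  shows "recursive (\<lambda>x. rounded (f x) (g x) (h x))"
  unfolding rounded_def by (intro recursive_basic assms)

lemma hausdorff_dist_le:
  assumes "S \<noteq> {}" "T \<noteq> {}"
    "\<And>x. x \<in> S \<Longrightarrow> infdist x T \<le> b" "\<And>y. y \<in> T \<Longrightarrow> infdist y S \<le> b"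
  shows "hausdorff_dist S T \<le> b"
  unfolding hausdorff_dist_def by (intro max.boundedI cSUP_least assms)

text \<open>\<open>C\<close> and \<open>R\<close> are constants of the machine to be built. The
  \<open>+ 1\<close> in the bound leaves room for the rational approximations, whose norms are then
  at most \<open>C\<close> as well. \<open>nxt\<close> chooses a possible successor of each letter,
  to repair inadmissible words.\<close>

locale computable_potential = subshift \<theta> d A for \<theta> d A +
  fixes \<Phi> :: "(nat \<Rightarrow> nat) \<Rightarrow> real ^ 'm::finite" and \<psi> :: tm and C R :: nat and nxt :: "nat \<Rightarrow> nat"
  assumes d: "0 < d"
    and nxt: "\<And>a. a < d \<Longrightarrow> nxt a < d \<and> A a (nxt a) = 1"
    and continuous: "continuous_on (sft d A) \<Phi>"
    and C: "\<And>x. x \<in> sft d A \<Longrightarrow> norm (\<Phi> x) + 1 \<le> real C"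
    and R: "\<And>N \<omega> K L x. (\<And>x y. x \<in> sft d A \<Longrightarrow> y \<in> sft d A \<Longrightarrow> agree N x y \<Longrightarrow> norm (\<Phi> x - \<Phi> y) \<le> \<omega>) \<Longrightarrow>
       0 < K \<Longrightarrow> 0 < L \<Longrightarrow> (\<And>i. x i \<in> sft d A) \<Longrightarrow>
       \<exists>v\<in>Rot \<theta> d A \<Phi>. norm (multi_average \<Phi> K L x - v) \<le> \<omega> + 2 * real C * real (N + R) / real L"
    and \<psi>: "oracle_TM \<psi>"
    and outputs: "\<And>x n. x \<in> sft d A \<Longrightarrow>
       \<exists>c q. outputs \<psi> x n c \<and> codes_rat_vector c q \<and> norm (q - \<Phi> x) < (1/2) ^ n"
begin

lemma halting: "x \<in> X \<Longrightarrow> halting \<psi> x n"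
  using outputs[of x n] outputs_imp_output_code(1)[OF \<psi>] by blast

lemma output_code:
  assumes "x \<in> X"
  obtains q where "codes_rat_vector (output_code \<psi> x n) q" "norm (q - \<Phi> x) < (1/2) ^ n"
  using outputs[OF assms, of n] outputs_imp_output_code(2)[OF \<psi>] by metis

lemma norm_le_C: "x \<in> X \<Longrightarrow> norm (\<Phi> x) \<le> real C"
  using C[of x] by simp

text \<open>
  Letter \<open>j\<close> of the point is digit \<open>off + j\<close> of \<open>P\<close> in base \<open>d\<close>, replaced by a possible successor
  where the digit is not admissible.
\<close>

definition admissible :: "nat set" where
  "admissible = {prod_encode (a, c) | a c. a < d \<and> c < d \<and> A a c = 1}"

definition point :: "nat \<Rightarrow> nat \<Rightarrow> nat \<Rightarrow> nat" where
  "point P off j = rec_nat (digit d P off)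
     (\<lambda>i a. if prod_encode (a, digit d P (off + Suc i)) \<in> admissible then digit d P (off + Suc i)
            else if a \<in> {..<d} then nxt a else 0) j"

lemma point_Suc: "point P off (Suc j) =
    (if prod_encode (point P off j, digit d P (off + Suc j)) \<in> admissible then digit d P (off + Suc j)
     else if point P off j \<in> {..<d} then nxt (point P off j) else 0)"
  by (simp add: point_def)

text \<open>Holds for all numbers, not only for those that spell an admissible word; this makes the
  simulated runs total.\<close>

lemma point_in_X: "point P off \<in> X"
proof -
  have lt: "point P off j < d" for j
  proof (induction j)
    case 0
    show ?case using d by (simp add: point_def digit_less)
  next
    case (Suc j)
    then show ?case using d nxt by (simp add: point_Suc digit_less)
  qed
  have "A (point P off j) (point P off (Suc j)) = 1" for j
    using nxt[OF lt[of j]] lt[of j] by (auto simp: point_Suc admissible_def)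
  with lt show ?thesis by (simp add: sft_def)
qed

lemma agree_point:
  assumes x: "x \<in> X" and digits: "\<And>j. j < n \<Longrightarrow> digit d P (off + j) = x j"
  shows "agree n (point P off) x"
proof -
  have "point P off j = x j" if "j < n" for j
    using that
  proof (induction j)
    case 0
    then show ?case using digits[of 0] by (simp add: point_def)
  next
    case (Suc j)
    then show ?case
      using digits[of "Suc j"] x unfolding point_Suc by (auto simp: admissible_def sft_def)
  qed
  then show ?thesis by (simp add: agree_def)
qed

text \<open>The case distinction in \<open>point\<close> cuts \<open>nxt\<close> off to a function
  of finite support, and \<open>admissible\<close> is a finite set of codes, so both are finite
  tables.\<close>

lemma recursive_point:
  assumes "recursive f" "recursive g" "recursive h"
  shows "recursive (\<lambda>x. point (f x) (g x) (h x))"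
proof -
  have "finite admissible"
    by (rule finite_subset[of _ "(\<lambda>(a, c). prod_encode (a, c)) ` ({..<d} \<times> {..<d})"])
       (auto simp: admissible_def)
  then have adm: "decidable (\<lambda>x. u x \<in> admissible)" if "recursive u" for u
    using recursive_comp[OF decidable_finite[unfolded decidable_def] that] by (simp add: decidable_def)
  have tab: "recursive (\<lambda>x. if u x \<in> {..<d} then nxt (u x) else 0)" if "recursive u" for u
    by (rule recursive_comp[OF recursive_finite_support that]) simp
  have "recursive (\<lambda>z. point (pi1 z) (pi1 (pi2 z)) (pi2 (pi2 z)))"
    unfolding point_def
    by (rule recursive_rec_nat[where h = "\<lambda>z i a.
          if prod_encode (a, digit d (pi1 z) (pi1 (pi2 z) + Suc i)) \<in> admissible
          then digit d (pi1 z) (pi1 (pi2 z) + Suc i) else if a \<in> {..<d} then nxt a else 0"])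
       (intro recursive_if adm tab recursive_digit recursive_prod_encode recursive_add recursive_Suc
          recursive_pi1 recursive_pi2 recursive_id recursive_const)+
  then show ?thesis
    using assms by (rule recursive_comp3)
qed

text \<open>Base word, offset and number of shifts are packed into one number, the index of a family
  of oracles as in \<open>recursive_final_code\<close>.\<close>

definition orbit_point :: "nat \<Rightarrow> nat \<Rightarrow> nat" where
  "orbit_point e j = point (pi1 e) (pi1 (pi2 e)) (j + pi2 (pi2 e))"

lemma orbit_point: "orbit_point (prod_encode (P, prod_encode (off, k))) = (shift ^^ k) (point P off)"
  by (simp add: fun_eq_iff orbit_point_def funpow_shift)

lemma orbit_point_in_X: "orbit_point e \<in> X"
proof -
  have "orbit_point e = (shift ^^ pi2 (pi2 e)) (point (pi1 e) (pi1 (pi2 e)))"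
    by (simp add: fun_eq_iff orbit_point_def funpow_shift)
  then show ?thesis by (simp add: funpow_shift_in_sft point_in_X)
qed

lemma recursive_orbit_point: "recursive (\<lambda>z. orbit_point (pi1 z) (pi2 z))"
  unfolding orbit_point_def by (intro recursive_point recursive_basic)

text \<open>By \<open>final_code_cong\<close> the query bound is constant on the cylinder whose
  length is its own value, and finitely many of these cylinders cover the space.\<close>

lemma query_bound_bounded: "\<exists>U. \<forall>x\<in>X. query_bound \<psi> x n \<le> U"
proof -
  let ?W = "\<lambda>x. {y. agree (query_bound \<psi> x n) y x}"
  have "X \<subseteq> (\<Union>x\<in>X. ?W x)" by auto
  then obtain D where D: "D \<subseteq> X" "finite D" "X \<subseteq> (\<Union>x\<in>D. ?W x)"
    by (rule compactE_image[OF compact_sft[of d A] open_agree])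
  have "query_bound \<psi> y n \<le> Max (insert 0 ((\<lambda>x. query_bound \<psi> x n) ` D))" if yX: "y \<in> X" for y
  proof -
    obtain x where x: "x \<in> D" "agree (query_bound \<psi> x n) y x"
      using D(3) yX by blast
    then have "query_bound \<psi> y n = query_bound \<psi> x n"
      using final_code_cong(2)[OF halting, of x n y] D(1) by (auto simp: agree_def query_bound_def)
    then show ?thesis
      using x D(2) by simp
  qed
  then show ?thesis by blast
qed

text \<open>
  If all points spelled by \<open>N\<close> digits are evaluated with queries below \<open>N\<close> only, then the output of
  the machine is constant on cylinders of length \<open>N\<close>. By compactness the search for such \<open>N\<close> ends,
  which makes a modulus of continuity computable.
\<close>

definition modulus :: "nat \<Rightarrow> nat" where
  "modulus n = (LEAST N. \<forall>P < d ^ N. query_bound \<psi> (orbit_point (prod_encode (P, prod_encode (0, 0)))) n \<le> N)"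

lemma modulus_exists:
  "\<exists>N. \<forall>P < d ^ N. query_bound \<psi> (orbit_point (prod_encode (P, prod_encode (0, 0)))) n \<le> N"
  using query_bound_bounded[of n] orbit_point_in_X by blast

lemma recursive_modulus: "recursive f \<Longrightarrow> recursive (\<lambda>x. modulus (f x))"
proof (rule recursive_comp[of modulus])
  show "recursive modulus"
    unfolding modulus_def[abs_def]
    by (rule recursive_Least)
       (intro decidable_Ball decidable_le recursive_query_bound[OF \<psi> recursive_orbit_point halting[OF orbit_point_in_X]]
          recursive_basic, rule modulus_exists)
qed

text \<open>The search tested spelled points only, so the comparison passes through the point
  \<open>p\<close> spelled by the first letters of \<open>x\<close>. On its cylinder the machine
  gives a single output, which is within \<open>(1/2) ^ n\<close> of both values.\<close>

lemma modulus:
  assumes "x \<in> X" "y \<in> X" "agree (modulus n) x y"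
  shows "norm (\<Phi> x - \<Phi> y) \<le> 2 * (1/2) ^ n"
proof -
  let ?N = "modulus n"
  obtain P where P: "P < d ^ ?N" "\<forall>j<?N. digit d P j = x j"
    using digits_exist[OF d, of x ?N] assms(1) by (auto simp: sft_def)
  define p where "p = point P 0"
  have p: "p \<in> X" "agree ?N p x"
    unfolding p_def using P(2) by (auto intro: point_in_X agree_point[OF assms(1)])
  have "query_bound \<psi> p n \<le> ?N"
    using LeastI_ex[OF modulus_exists[of n]] P(1) unfolding modulus_def[symmetric]
    by (simp add: orbit_point p_def)
  then have same: "output_code \<psi> z n = output_code \<psi> p n" if "agree ?N p z" for z
    using final_code_cong(2)[OF halting[OF p(1)], of n z] that by (simp add: agree_def output_code_def)
  obtain q where q: "codes_rat_vector (output_code \<psi> x n) q" "norm (q - \<Phi> x) < (1/2) ^ n"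
    using output_code[OF assms(1)] .
  obtain q' where q': "codes_rat_vector (output_code \<psi> y n) q'" "norm (q' - \<Phi> y) < (1/2) ^ n"
    using output_code[OF assms(2)] .
  have "output_code \<psi> x n = output_code \<psi> y n"
    using same[OF p(2)] same[OF agree_trans[OF p(2) assms(3)]] by simp
  then have "q = q'"
    using q(1) q'(1) by (simp add: codes_rat_vector_def vec_eq_iff)
  then show ?thesis
    using q(2) q'(2) norm_triangle_ineq4[of "q - \<Phi> y" "q - \<Phi> x"] by simp
qed

text \<open>
  Averaging over \<open>4 ^ n\<close> orbits makes the greedy error \<open>2 * C / 2 ^ n\<close>, and this orbit length does
  the same for the error of replacing an orbit segment by a periodic orbit.
\<close>

definition orbit_length :: "nat \<Rightarrow> nat" where
  "orbit_length n = (modulus n + R + 1) * 2 ^ n"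

text \<open>The extra \<open>modulus n\<close> letters keep the window of that length known at every
  shift below \<open>orbit_length n\<close>.\<close>

definition block_length :: "nat \<Rightarrow> nat" where
  "block_length n = orbit_length n + modulus n"

definition coordinate_sum :: "nat \<Rightarrow> nat \<Rightarrow> nat \<Rightarrow> nat" where
  "coordinate_sum n c P = (\<Sum>i<4 ^ n. \<Sum>k<orbit_length n. rounded (2 ^ n) C
     (nth_code c (output_code \<psi> (orbit_point (prod_encode (P, prod_encode (i * block_length n, k)))) n)))"

text \<open>The number of summands in \<open>coordinate_sum\<close> times the scale
  \<open>2 ^ n\<close> of the rounding, so that the quotient approximates a coordinate of the
  average, shifted by \<open>C\<close>.\<close>

definition denominator :: "nat \<Rightarrow> nat" where
  "denominator n = 4 ^ n * orbit_length n * 2 ^ n"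

text \<open>The two cases spell out \<open>int_encode\<close> of the numerator after the shift by
  \<open>C\<close> has been undone: even codes for nonnegative integers, odd ones for negative.
  \<open>2 * denominator n\<close> is the code of a positive integer.\<close>

definition rat_code :: "nat \<Rightarrow> nat \<Rightarrow> nat \<Rightarrow> nat" where
  "rat_code n c P = prod_encode
     (if C * denominator n \<le> coordinate_sum n c P then 2 * (coordinate_sum n c P - C * denominator n)
      else 2 * (C * denominator n - coordinate_sum n c P) - 1, 2 * denominator n)"

definition center_code :: "nat \<Rightarrow> nat \<Rightarrow> nat \<Rightarrow> nat" where
  "center_code m n P = list_encode (map (\<lambda>c. rat_code n c P) [0..<m])"

text \<open>\<open>2 * n\<close> is the integer code of \<open>n\<close>, so every radius is
  \<open>(1/2) ^ n\<close>. The balls only meet the output format; the net consists of their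
  centers.\<close>

definition ball_list_code :: "nat \<Rightarrow> nat \<Rightarrow> nat" where
  "ball_list_code m n = list_encode (map (\<lambda>P. prod_encode (center_code m n P, 2 * n))
     (rev [0..<d ^ (4 ^ n * block_length n)]))"

lemma recursive_ball_list_code: "recursive f \<Longrightarrow> recursive (\<lambda>x. ball_list_code m (f x))"
proof (rule recursive_comp[of "ball_list_code m"])
  have len: "recursive (\<lambda>x. orbit_length (f x))" "recursive (\<lambda>x. block_length (f x))"
    "recursive (\<lambda>x. denominator (f x))" if "recursive f" for f
    unfolding block_length_def denominator_def orbit_length_def
    by (intro recursive_basic recursive_modulus that)+
  have "recursive (\<lambda>z. coordinate_sum (pi1 z) c (pi2 z))" for c
    unfolding coordinate_sum_def
    by (intro recursive_sum recursive_rounded recursive_nth_code len recursive_basic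
        recursive_output_code[OF \<psi> recursive_orbit_point halting[OF orbit_point_in_X]])
  from recursive_comp2[OF this]
  have sum: "recursive (\<lambda>x. coordinate_sum (f x) c (g x))" if "recursive f" "recursive g" for f g c
    using that by blast
  show "recursive (ball_list_code m)"
    unfolding ball_list_code_def[abs_def] center_code_def rat_code_def
    by (intro recursive_list recursive_tuple recursive_basic len sum)
qed

section \<open>Accuracy of the centers\<close>

definition center :: "nat \<Rightarrow> nat \<Rightarrow> real ^ 'm" where
  "center n P = (\<chi> i. rat_value (rat_code n (to_nat_on (UNIV :: 'm set) i) P))"

lemma to_nat_on_less: "to_nat_on (UNIV :: 'm set) i < CARD('m)"
  using to_nat_on_finite[of "UNIV :: 'm set"] by (auto simp: bij_betw_def)

lemma codes_center: "codes_rat_vector (center_code CARD('m) n P) (center n P)"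
  by (simp add: codes_rat_vector_def center_code_def center_def rat_value_def to_nat_on_less)

lemma codes_ball_list_code:
  "codes_ball_list (ball_list_code CARD('m) n)
     (map (\<lambda>P. (center n P, int n)) (rev [0..<d ^ (4 ^ n * block_length n)]))"
  using int_encode_inverse[of "int n"]
  by (simp add: codes_ball_list_def ball_list_code_def list_all2_map1 list_all2_map2 list.rel_refl
      codes_center int_encode_of_nat del: int_encode_inverse)

lemma orbit_length_pos: "0 < orbit_length n"
  by (simp add: orbit_length_def)

lemma rat_value_rat_code:
  "rat_value (rat_code n c P) = real (coordinate_sum n c P) / real (denominator n) - real C"
proof -
  have "0 < denominator n"
    by (simp add: denominator_def orbit_length_pos)
  moreover have "rat_code n c P = prod_encode
      (int_encode (int (coordinate_sum n c P) - int (C * denominator n)), int_encode (int (denominator n)))"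
    unfolding rat_code_def int_encode_diff int_encode_of_nat ..
  ultimately show ?thesis
    by (simp add: rat_value field_simps)
qed

definition points :: "nat \<Rightarrow> nat \<Rightarrow> nat \<Rightarrow> nat \<Rightarrow> nat" where
  "points n P i = point P (i * block_length n)"

text \<open>Rounding costs \<open>(1/2) ^ n\<close> in each coordinate, and the coordinates are
  added up in the \<open>l1\<close> norm; the summand 1 accounts for the error of the outputs of
  \<open>\<psi>\<close>.\<close>

lemma center_close:
  "norm (center n P - multi_average \<Phi> (4 ^ n) (orbit_length n) (points n P)) \<le> (real CARD('m) + 1) * (1/2) ^ n"
proof -
  let ?K = "4 ^ n :: nat" and ?L = "orbit_length n"
  let ?x = "\<lambda>i k. (shift ^^ k) (points n P i)"
  have x: "?x i k \<in> X" for i k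
    by (simp add: points_def funpow_shift_in_sft point_in_X)
  define q where "q i k = (SOME q. codes_rat_vector (output_code \<psi> (?x i k) n) q \<and> norm (q - \<Phi> (?x i k)) < (1/2) ^ n)" for i k
  have "codes_rat_vector (output_code \<psi> (?x i k) n) (q i k) \<and> norm (q i k - \<Phi> (?x i k)) < (1/2) ^ n" for i k
    unfolding q_def by (rule someI_ex) (use output_code[OF x] in metis)
  then have q: "\<And>i k. codes_rat_vector (output_code \<psi> (?x i k) n) (q i k)"
    "\<And>i k. norm (q i k - \<Phi> (?x i k)) < (1/2) ^ n" by simp_all
  let ?avg = "(1 / real ?K) *\<^sub>R (\<Sum>i<?K. (1 / real ?L) *\<^sub>R (\<Sum>k<?L. q i k))"
  have coord: "\<bar>(center n P - ?avg) $ c\<bar> \<le> (1/2) ^ n" for c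
  proof -
    let ?c = "to_nat_on (UNIV :: 'm set) c"
    let ?r = "\<lambda>i k. nth_code ?c (output_code \<psi> (?x i k) n)"
    have val: "q i k $ c = rat_value (?r i k)" for i k
      using q(1)[of k i] to_nat_on_less[of c]
      by (simp add: codes_rat_vector_def rat_value_def nth_code_list_decode)
    have "norm (q i k) \<le> real C" for i k
    proof -
      have "norm (q i k) \<le> norm (\<Phi> (?x i k)) + norm (q i k - \<Phi> (?x i k))"
        by (rule norm_triangle_sub)
      moreover have "(1/2 :: real) ^ n \<le> 1"
        by (rule power_le_one) simp_all
      ultimately show ?thesis
        using q(2)[of i k] C[OF x[of k i]] by linarith
    qed
    then have "\<bar>rat_value (?r i k)\<bar> \<le> real C" for i k
      using component_le_norm_cart[of "q i k" c] order_trans unfolding val[symmetric] by blast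
    from rounded_close[OF this, of "2 ^ n"] have round:
      "\<bar>real (rounded (2 ^ n) C (?r i k)) - 2 ^ n * (q i k $ c + real C)\<bar> \<le> 1" for i k
      unfolding val by (simp only: of_nat_power of_nat_numeral)
    have cs: "real (coordinate_sum n ?c P) = (\<Sum>i<?K. \<Sum>k<?L. real (rounded (2 ^ n) C (?r i k)))"
      by (simp add: coordinate_sum_def orbit_point points_def)
    have KL: "0 < real ?K" "0 < real ?L" "real (denominator n) = real ?K * real ?L * 2 ^ n"
      using orbit_length_pos[of n] by (simp_all add: denominator_def)
    have "\<bar>real (coordinate_sum n ?c P) - (\<Sum>i<?K. \<Sum>k<?L. 2 ^ n * (q i k $ c + real C))\<bar> \<le> (\<Sum>i<?K. \<Sum>k<?L. 1)"
      unfolding cs sum_subtractf[symmetric] by (intro order_trans[OF sum_abs] sum_mono round)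
    moreover have "(\<Sum>i<?K. \<Sum>k<?L. 2 ^ n * (q i k $ c + real C)) =
        2 ^ n * (\<Sum>i<?K. \<Sum>k<?L. q i k $ c) + real (denominator n) * real C"
      unfolding KL(3) by (simp add: sum.distrib sum_distrib_left distrib_left)
    ultimately have bound: "\<bar>real (coordinate_sum n ?c P) - 2 ^ n * (\<Sum>i<?K. \<Sum>k<?L. q i k $ c) - real (denominator n) * real C\<bar>
        \<le> real ?K * real ?L"
      by (simp add: algebra_simps)
    have "?avg $ c = (\<Sum>i<?K. \<Sum>k<?L. q i k $ c) / (real ?K * real ?L)"
      by (simp add: sum_component sum_divide_distrib[symmetric])
    then have "(center n P - ?avg) $ c =
        (real (coordinate_sum n ?c P) - 2 ^ n * (\<Sum>i<?K. \<Sum>k<?L. q i k $ c) - real (denominator n) * real C) / real (denominator n)"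
      using KL by (simp add: center_def rat_value_rat_code diff_divide_distrib)
    then have "\<bar>(center n P - ?avg) $ c\<bar> \<le> real ?K * real ?L / real (denominator n)"
      using bound by (simp add: divide_right_mono)
    also have "\<dots> = (1/2) ^ n"
      unfolding KL(3) using KL(1,2) by (simp add: power_divide)
    finally show ?thesis .
  qed
  have "norm (center n P - ?avg) \<le> (\<Sum>c\<in>UNIV. \<bar>(center n P - ?avg) $ c\<bar>)"
    by (rule norm_le_l1_cart)
  also have "\<dots> \<le> (\<Sum>c\<in>(UNIV :: 'm set). (1/2) ^ n)"
    by (intro sum_mono coord)
  finally have 1: "norm (center n P - ?avg) \<le> real CARD('m) * (1/2) ^ n"
    by simp
  have "?avg - multi_average \<Phi> ?K ?L (points n P) =
      (1 / real ?K) *\<^sub>R (\<Sum>i<?K. (1 / real ?L) *\<^sub>R (\<Sum>k<?L. q i k - \<Phi> (?x i k)))"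
    by (simp add: multi_average_def birkhoff_average_def sum_subtractf scaleR_diff_right)
  also have "norm \<dots> \<le> (1/2) ^ n"
    by (intro norm_average_le orbit_length_pos less_imp_le[OF q(2)]) simp
  finally have "norm (?avg - multi_average \<Phi> ?K ?L (points n P)) \<le> (1/2) ^ n" .
  with 1 show ?thesis
    using norm_triangle_ineq[of "center n P - ?avg" "?avg - multi_average \<Phi> ?K ?L (points n P)"]
    by (simp add: distrib_right)
qed

lemma orbit_length_large: "2 * real C * real (modulus n + R) / real (orbit_length n) \<le> 2 * real C * (1/2) ^ n"
proof -
  have "real (modulus n + R) / real (orbit_length n) \<le> (1/2) ^ n"
    unfolding orbit_length_def
    by (simp add: divide_simps power_divide) (smt (verit) mult_nonneg_nonneg of_nat_0_le_iff zero_le_power)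
  then have "2 * real C * (real (modulus n + R) / real (orbit_length n)) \<le> 2 * real C * (1/2) ^ n"
    by (rule mult_left_mono) simp
  then show ?thesis by simp
qed

text \<open>Besides the error in \<open>center_close\<close>, the modulus contributes 2 and the
  closing of the orbit segments contributes \<open>2 * C\<close>.\<close>

lemma center_near_Rot: "\<exists>v\<in>Rot \<theta> d A \<Phi>. norm (center n P - v) \<le> (real CARD('m) + 3 + 2 * real C) * (1/2) ^ n"
proof -
  obtain v where v: "v \<in> Rot \<theta> d A \<Phi>"
    "norm (multi_average \<Phi> (4 ^ n) (orbit_length n) (points n P) - v)
      \<le> 2 * (1/2) ^ n + 2 * real C * real (modulus n + R) / real (orbit_length n)"
  proof -
    have "\<exists>v\<in>Rot \<theta> d A \<Phi>. norm (multi_average \<Phi> (4 ^ n) (orbit_length n) (points n P) - v)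
      \<le> 2 * (1/2) ^ n + 2 * real C * real (modulus n + R) / real (orbit_length n)"
      by (rule R[OF modulus]) (simp_all add: points_def point_in_X orbit_length_pos)
    then show ?thesis using that by blast
  qed
  have "norm (center n P - v) \<le> norm (center n P - multi_average \<Phi> (4 ^ n) (orbit_length n) (points n P))
      + norm (multi_average \<Phi> (4 ^ n) (orbit_length n) (points n P) - v)"
    using norm_triangle_ineq[of "center n P - multi_average \<Phi> (4 ^ n) (orbit_length n) (points n P)"
        "multi_average \<Phi> (4 ^ n) (orbit_length n) (points n P) - v"] by simp
  then show ?thesis
    using v center_close[of n P] orbit_length_large[of n] by (intro bexI[of _ v]) (auto simp: algebra_simps)
qed

text \<open>Here \<open>2 * C\<close> is the greedy error, with \<open>sqrt (4 ^ n) = 2 ^ n\<close>,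
  and 2 is the cost of replacing the chosen points by spelled ones.\<close>

lemma Rot_near_center:
  assumes "v \<in> Rot \<theta> d A \<Phi>"
  shows "\<exists>P < d ^ (4 ^ n * block_length n). norm (center n P - v) \<le> (real CARD('m) + 3 + 2 * real C) * (1/2) ^ n"
proof -
  let ?K = "4 ^ n :: nat" and ?L = "orbit_length n" and ?W = "block_length n"
  have W: "0 < ?W"
    using orbit_length_pos[of n] by (simp add: block_length_def)
  obtain x where x: "\<And>i. x i \<in> X" "norm (multi_average \<Phi> ?K ?L x - v) \<le> 2 * real C / sqrt (real ?K)"
    using rotation_vector_approx[OF assms continuous norm_le_C, of ?K ?L] orbit_length_pos by auto
  have "sqrt (real ?K) = 2 ^ n"
    by (rule real_sqrt_unique) (simp_all add: power_mult[symmetric] mult.commute[of n] power_mult)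
  with x(2) have 1: "norm (multi_average \<Phi> ?K ?L x - v) \<le> 2 * real C * (1/2) ^ n"
    by (simp add: power_divide)
  \<comment> \<open>The initial blocks of all the chosen points are written one after another as
    digits of a single number.\<close>
  obtain P where P: "P < d ^ (?K * ?W)" "\<forall>t<?K * ?W. digit d P t = x (t div ?W) (t mod ?W)"
    using digits_exist[OF d, of "\<lambda>t. x (t div ?W) (t mod ?W)" "?K * ?W"] x(1) by (auto simp: sft_def)
  have agree: "agree ?W (points n P i) (x i)" if "i < ?K" for i
    unfolding points_def
  proof (rule agree_point[OF x(1)])
    fix j assume j: "j < ?W"
    have "i * ?W + j < Suc i * ?W" using j by simp
    also have "\<dots> \<le> ?K * ?W" using that by (intro mult_le_mono1) simp
    finally show "digit d P (i * ?W + j) = x i j"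
      using P(2) j by simp
  qed
  have "norm (birkhoff_average \<Phi> ?L (points n P i) - birkhoff_average \<Phi> ?L (x i)) \<le> 2 * (1/2) ^ n" if "i < ?K" for i
  proof -
    have "birkhoff_average \<Phi> ?L (points n P i) - birkhoff_average \<Phi> ?L (x i) =
        (1 / real ?L) *\<^sub>R (\<Sum>k<?L. \<Phi> ((shift ^^ k) (points n P i)) - \<Phi> ((shift ^^ k) (x i)))"
      by (simp add: birkhoff_average_def sum_subtractf scaleR_diff_right)
    also have "norm \<dots> \<le> 2 * (1/2) ^ n"
    proof (intro norm_average_le orbit_length_pos modulus)
      fix k assume "k < ?L"
      then show "agree (modulus n) ((shift ^^ k) (points n P i)) ((shift ^^ k) (x i))"
        using agree[OF that] by (simp add: agree_def funpow_shift block_length_def)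
    qed (simp_all add: points_def funpow_shift_in_sft point_in_X x)
    finally show ?thesis .
  qed
  note close = this
  have "multi_average \<Phi> ?K ?L (points n P) - multi_average \<Phi> ?K ?L x = (1 / real ?K) *\<^sub>R
      (\<Sum>i<?K. birkhoff_average \<Phi> ?L (points n P i) - birkhoff_average \<Phi> ?L (x i))"
    by (simp add: multi_average_def sum_subtractf scaleR_diff_right)
  also have "norm \<dots> \<le> 2 * (1/2) ^ n"
    by (intro norm_average_le close) simp_all
  finally have 2: "norm (multi_average \<Phi> ?K ?L (points n P) - multi_average \<Phi> ?K ?L x) \<le> 2 * (1/2) ^ n" .
  have "norm (center n P - v) \<le> norm (center n P - multi_average \<Phi> ?K ?L (points n P)) +
     norm (multi_average \<Phi> ?K ?L (points n P) - multi_average \<Phi> ?K ?L x) + norm (multi_average \<Phi> ?K ?L x - v)"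
    using norm_triangle_ineq[of "center n P - multi_average \<Phi> ?K ?L (points n P)"
        "multi_average \<Phi> ?K ?L (points n P) - multi_average \<Phi> ?K ?L x"]
      norm_triangle_ineq[of "center n P - multi_average \<Phi> ?K ?L x" "multi_average \<Phi> ?K ?L x - v"] by simp
  also have "\<dots> \<le> (real CARD('m) + 3 + 2 * real C) * (1/2) ^ n"
    using 1 2 center_close[of n P] by (simp add: algebra_simps)
  finally show ?thesis
    using P(1) by blast
qed

theorem computable_compact_Rot: "computable_compact (Rot \<theta> d A \<Phi>)"
proof -
  \<comment> \<open>\<open>s\<close> is the total error factor; 1 of it is the radius of the balls.
    As \<open>s < 2 ^ s\<close>, working at level \<open>n + s\<close> brings the error strictly
    below \<open>(1/2) ^ n\<close>.\<close>
  define s where "s = CARD('m) + 4 + 2 * C"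
  obtain M where M: "plain_TM M" "\<And>n. plain_outputs M n (ball_list_code CARD('m) (n + s))"
    using recursive_imp_TM[OF recursive_ball_list_code[OF recursive_add[OF recursive_id recursive_const]]] by blast
  have ne: "Rot \<theta> d A \<Phi> \<noteq> {}"
    using center_near_Rot by blast
  have "\<exists>c ps. plain_outputs M n c \<and> codes_ball_list c ps \<and> (ps = [] \<longleftrightarrow> Rot \<theta> d A \<Phi> = {}) \<and>
      (Rot \<theta> d A \<Phi> \<noteq> {} \<longrightarrow>
        hausdorff_dist (\<Union>(q, l)\<in>set ps. cball q (2 powi (- l))) (Rot \<theta> d A \<Phi>) < (1/2) ^ n)" for n
  proof -
    define m where "m = n + s"
    define B where "B = d ^ (4 ^ m * block_length m)"
    define ps where "ps = map (\<lambda>P. (center m P, int m)) (rev [0..<B])"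
    have B: "0 < B"
      using d by (simp add: B_def)
    have U: "(\<Union>(q, l)\<in>set ps. cball q (2 powi (- l))) = (\<Union>P<B. cball (center m P) ((1/2) ^ m))" (is "_ = ?U")
      by (auto simp: ps_def power_int_minus power_one_over inverse_eq_divide)
    have "hausdorff_dist ?U (Rot \<theta> d A \<Phi>) \<le> (1/2) ^ m + (real CARD('m) + 3 + 2 * real C) * (1/2) ^ m"
    proof (rule hausdorff_dist_le)
      show "?U \<noteq> {}"
        using B by auto
      fix u assume "u \<in> ?U"
      then obtain P where P: "dist (center m P) u \<le> (1/2) ^ m"
        by auto
      obtain v where v: "v \<in> Rot \<theta> d A \<Phi>" "norm (center m P - v) \<le> (real CARD('m) + 3 + 2 * real C) * (1/2) ^ m"
        using center_near_Rot by blast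
      have "dist u v \<le> (1/2) ^ m + (real CARD('m) + 3 + 2 * real C) * (1/2) ^ m"
        using P v(2) dist_triangle[of u v "center m P"] by (simp add: dist_norm norm_minus_commute)
      with v(1) show "infdist u (Rot \<theta> d A \<Phi>) \<le> (1/2) ^ m + (real CARD('m) + 3 + 2 * real C) * (1/2) ^ m"
        by (rule infdist_le2)
    next
      fix v assume "v \<in> Rot \<theta> d A \<Phi>"
      then obtain P where P: "P < B" "norm (center m P - v) \<le> (real CARD('m) + 3 + 2 * real C) * (1/2) ^ m"
        using Rot_near_center unfolding B_def by blast
      from P(1) have "center m P \<in> ?U" by (auto intro!: bexI[of _ P])
      moreover have "dist v (center m P) \<le> (1/2) ^ m + (real CARD('m) + 3 + 2 * real C) * (1/2) ^ m"
        using P(2) by (simp add: dist_norm norm_minus_commute add_increasing)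
      ultimately show "infdist v ?U \<le> (1/2) ^ m + (real CARD('m) + 3 + 2 * real C) * (1/2) ^ m"
        by (rule infdist_le2)
    qed (rule ne)
    also have "\<dots> = real s * (1/2) ^ m"
      by (simp add: s_def algebra_simps)
    also have "\<dots> < 2 ^ s * (1/2) ^ m"
      using of_nat_less_iff[of s "2 ^ s", where ?'a = real] less_exp[of s]
      by (intro mult_strict_right_mono) simp_all
    also have "\<dots> = (1/2) ^ n"
      by (simp add: m_def power_add power_divide)
    finally have "hausdorff_dist ?U (Rot \<theta> d A \<Phi>) < (1/2) ^ n" .
    moreover have "codes_ball_list (ball_list_code CARD('m) m) ps"
      unfolding ps_def B_def by (rule codes_ball_list_code)
    moreover have "ps \<noteq> []"
      using B by (simp add: ps_def)
    ultimately show ?thesis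
      using M(2)[of n] ne unfolding U[symmetric] m_def[symmetric] by blast
  qed
  then show ?thesis
    unfolding computable_compact_def using compact_Rot[OF continuous] M(1) by blast
qed

end

theorem theorem5p8:
  fixes d :: nat and A :: "nat \<Rightarrow> nat \<Rightarrow> nat" and \<theta> :: real
    and \<Phi> :: "(nat \<Rightarrow> nat) \<Rightarrow> real ^ 'm::finite"
  assumes "transition_matrix d A"
    and "0 < \<theta>" and "\<theta> < 1" and "computable_real \<theta>"
    and "transitive_shift \<theta> d A"
    and "continuous_map (sft_top \<theta> d A) euclidean \<Phi>"
    and "computable_on (sft d A) \<Phi>"
  shows "computable_compact (Rot \<theta> d A \<Phi>)"
proof -
  interpret subshift \<theta> d A
    by standard (fact assms)+
  have continuous: "continuous_on X \<Phi>"
    using assms(6) by (simp add: sft_top_eq[OF theta])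
  \<comment> \<open>Every letter occurs in some point, where it is followed by another letter; this
    supplies \<open>nxt\<close>.\<close>
  have "\<exists>b<d. A a b = 1" if a: "a < d" for a
  proof -
    obtain x k where "x \<in> X" "x k = a"
      using assms(1) a unfolding transition_matrix_def by blast
    then show ?thesis
      by (auto simp: sft_def)
  qed
  then obtain nxt where nxt: "\<And>a. a < d \<Longrightarrow> nxt a < d \<and> A a (nxt a) = 1"
    by metis
  obtain B where B: "\<And>x. x \<in> X \<Longrightarrow> norm (\<Phi> x) \<le> B"
    using bounded_continuous[OF continuous] by blast
  define C where "C = nat \<lceil>B\<rceil> + 1"
  have C: "norm (\<Phi> x) + 1 \<le> real C" if "x \<in> X" for x
    using B[OF that] by (simp add: C_def) linarith
  then have "norm (\<Phi> x) \<le> real C" if "x \<in> X" for x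
    using C[OF that] by simp
  from multi_average_near_Rot[OF assms(1,5) continuous this]
  obtain R where R: "\<And>N \<omega> K L x. (\<And>x y. x \<in> X \<Longrightarrow> y \<in> X \<Longrightarrow> agree N x y \<Longrightarrow> norm (\<Phi> x - \<Phi> y) \<le> \<omega>) \<Longrightarrow>
     0 < K \<Longrightarrow> 0 < L \<Longrightarrow> (\<And>i. x i \<in> X) \<Longrightarrow>
     \<exists>v\<in>Rot \<theta> d A \<Phi>. norm (multi_average \<Phi> K L x - v) \<le> \<omega> + 2 * real C * real (N + R) / real L"
    by blast
  \<comment> \<open>Each point serves as its own oracle.\<close>
  obtain \<psi> where \<psi>: "oracle_TM \<psi>" "\<And>x n. x \<in> X \<Longrightarrow>
      \<exists>c q. outputs \<psi> x n c \<and> codes_rat_vector c q \<and> norm (q - \<Phi> x) < (1/2) ^ n"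
    using assms(7) unfolding computable_on_def oracle_for_def by blast
  have d: "0 < d"
    using assms(1) by (simp add: transition_matrix_def)
  interpret computable_potential \<theta> d A \<Phi> \<psi> C R nxt
    by unfold_locales (fact d nxt continuous C R \<psi>)+
  show ?thesis
    by (rule computable_compact_Rot)
qed

end
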